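(* Let $\theta^{\min}<c<\theta^{\max}$ and $\theta_i=c+i\cdot(\ln p-\ln q)$ for $i\in\mathbb Z$. Suppose $\Lambda$ is such that $\theta^{\min}<\theta_i<\theta^{\max}$ for all $i\in\Lambda$. If $\ell>-\infty$, suppose that $\mathfrak p_\ell$ and $\mathfrak q_\ell$ satisfy $$\frac{\mathfrak q_\ell(z+1)}{\mathfrak p_\ell(z)}=\frac{f(z+1)}{e^{\theta_\ell}}\qquad\text{for all } z\in I,\ z\ne\omega^{\max}.$$ If $\mathfrak r<\infty$, suppose that $\mathfrak p_{\mathfrak r}$ and $\mathfrak q_{\mathfrak r}$ satisfy $$\frac{\mathfrak p_{\mathfrak r}(z+1)}{\mathfrak q_{\mathfrak r}(z)}=\frac{f(z+1)}{e^{\theta_{\mathfrak r}}}\qquad\text{for all } z\in I,\ z\ne\omega^{\max}.$$ Then the product distribution $\underline\mu^c:=\bigotimes_{i\in\Lambda}\mu^{\theta_i}$ (which is concentrated on $\Omega$) is a reversible stationary distribution for the process on the countable state space $\Omega$.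
   Context: Volume and states. Fix possibly infinite integers $-\infty\le\ell\le0\le\mathfrak r\le\infty$ and $-\infty\le\omega^{\min}\le0<\omega^{\max}\le\infty$. Let $\Lambda=\{i\in\mathbb Z:\ell-1<i<\mathfrak r+1\}$ and $I=\{z\in\mathbb Z:\omega^{\min}-1<z<\omega^{\max}+1\}$. If $\ell=-\infty$ it is assumed that $\omega^{\min}>-\infty$; if $\mathfrak r=\infty$ it is assumed that $\omega^{\max}<\infty$. For $\underline z\in I^\Lambda$ put $N_{\mathrm p}(\underline z)=\sum_{i=\ell}^0(z_i-\omega^{\min})$ and $N_{\mathrm h}(\underline z)=\sum_{i=1}^{\mathfrak r}(\omega^{\max}-z_i)$. The state space is the countable set $$\Omega=\{\underline z\in I^\Lambda:(\ell>-\infty\text{ or }N_{\mathrm p}(\underline z)<\infty)\text{ and }(\mathfrak r<\infty\text{ or }N_{\mathrm h}(\underline z)<\infty)\}.$$ Dynamics. $\underline z^{i,j}$ denotes the configuration obtained from $\underline z$ by decreasing $z_i$ by one (if $i\in\Lambda$) and increasing $z_j$ by one (if $j\in\Lambda$). There are rate functions $\mathfrak p,\mathfrak q:I^2\to[0,\infty)$ with $\mathfrak p(\omega^{\min},\cdot)\equiv\mathfrak p(\cdot,\omega^{\max})\equiv\mathfrak q(\omega^{\max},\cdot)\equiv\mathfrak q(\cdot,\omega^{\min})\equiv0$ whenever the respective $\omega^{\min}$ or $\omega^{\max}$ is finite. If $\ell>-\infty$ there are left boundary rates $\mathfrak p_\ell,\mathfrak q_\ell:I\to[0,\infty)$ with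 $\mathfrak q_\ell(\omega^{\min})=0$ and $\mathfrak p_\ell(\omega^{\max})=0$; if $\mathfrak r<\infty$ there are right boundary rates $\mathfrak p_{\mathfrak r},\mathfrak q_{\mathfrak r}:I\to[0,\infty)$ with $\mathfrak q_{\mathfrak r}(\omega^{\max})=0$ and $\mathfrak p_{\mathfrak r}(\omega^{\min})=0$ (each condition being imposed only when the argument is finite). The process is the continuous-time Markov chain on $\Omega$ with the following jumps from $\underline z$: for each $i$ with $\ell-1<i<\mathfrak r$, $\underline z\to\underline z^{i,i+1}$ at rate $\mathfrak p(z_i,z_{i+1})$ and $\underline z\to\underline z^{i+1,i}$ at rate $\mathfrak q(z_i,z_{i+1})$; if $\ell>-\infty$, $\underline z\to\underline z^{\ell-1,\ell}$ at rate $\mathfrak p_\ell(z_\ell)$ and $\underline z\to\underline z^{\ell,\ell-1}$ at rate $\mathfrak q_\ell(z_\ell)$; if $\mathfrak r<\infty$, $\underline z\to\underline z^{\mathfrak r,\mathfrak r+1}$ at rate $\mathfrak p_{\mathfrak r}(z_{\mathfrak r})$ and $\underline z\to\underline z^{\mathfrak r+1,\mathfrak r}$ at rate $\mathfrak q_{\mathfrak r}(z_{\mathfrak r})$. Assumptions on rates. (1) Attractivity: whenever $y,z,z+1\in I$: $\mathfrak p(z+1,y)\ge\mathfrak p(z,y)$, $\mathfrak p(y,z+1)\le\mathfrak p(y,z)$, $\mathfrak q(y,z+1)\ge\mathfrak q(y,z)$, $\mathfrak q(z+1,y)\le\mathfrak q(z,y)$, $\mathfrak p_\ell(z+1)\le\mathfrak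 p_\ell(z)$, $\mathfrak q_\ell(z+1)\ge\mathfrak q_\ell(z)$, $\mathfrak p_{\mathfrak r}(z+1)\ge\mathfrak p_{\mathfrak r}(z)$, $\mathfrak q_{\mathfrak r}(z+1)\le\mathfrak q_{\mathfrak r}(z)$. (2) Except for the zeros prescribed above, all values of $\mathfrak p,\mathfrak q,\mathfrak p_\ell,\mathfrak q_\ell,\mathfrak p_{\mathfrak r},\mathfrak q_{\mathfrak r}$ are non-zero. (3) There are reals $\tfrac12<p=1-q\le1$ (by (2), $q>0$), a function $f:I\to[0,\infty)$ with $f(\omega^{\min})=0$ if $\omega^{\min}$ is finite, and a function $s:I\times I\to[0,\infty)$, extended by $s(\omega^{\max}+1,\cdot)=s(\cdot,\omega^{\max}+1)=0$ if $\omega^{\max}$ is finite, such that $\mathfrak p(y,z)=p\,s(y,z+1)f(y)$ and $\mathfrak q(y,z)=q\,s(y+1,z)f(z)$. (Attractivity makes $f$ non-decreasing.) Marginals. $\theta^{\min}=-\infty$ if $\omega^{\min}>-\infty$ and $\theta^{\min}=\lim_{z\to-\infty}\ln f(z)$ if $\omega^{\min}=-\infty$; $\theta^{\max}=\infty$ if $\omega^{\max}<\infty$ and $\theta^{\max}=\lim_{z\to\infty}\ln f(z)$ if $\omega^{\max}=\infty$. It is assumed that the open interval $(\theta^{\min},\theta^{\max})$ is non-empty. For $z\in I$ let $f(z)!=\prod_{y=1}^zf(y)$ for $z>0$, $f(0)!=1$, and $f(z)!=1/\prod_{y=z+1}^0f(y)$ for $z<0$. For $\theta^{\min}<\theta<\theta^{\max}$,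 $\mu^\theta$ is the probability distribution on $I$ with $\mu^\theta(z)=\frac1{Z(\theta)}\frac{e^{\theta z}}{f(z)!}$, where $Z(\theta)=\sum_{y\in I}\frac{e^{\theta y}}{f(y)!}<\infty$. *)

theory Defs
  imports "HOL-Probability.Probability" "HOL-Library.Extended"
begin

section \<open>Continuous-time Markov chains on a countable state space\<close>

text \<open>
  \<open>k x y\<close> is the rate of the jump from \<open>x\<close> to \<open>y \<noteq> x\<close>; the diagonal of \<open>k\<close> is ignored.
\<close>

definition exit_rate :: "'a set \<Rightarrow> ('a \<Rightarrow> 'a \<Rightarrow> ennreal) \<Rightarrow> 'a \<Rightarrow> real" where
  "exit_rate S k x = enn2real (\<Sum>\<^sub>\<infinity>y\<in>S - {x}. k x y)"

text \<open>
  \<open>ctmc_trans_n S k n t x y\<close> is the probability that the chain with exponential holding times,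
  started in \<open>x\<close>, has made exactly \<open>n\<close> jumps by time \<open>t\<close> and is in \<open>y\<close> at time \<open>t\<close>. The recursion
  conditions on the time \<open>u\<close> and the target \<open>z\<close> of the first jump.
\<close>

primrec ctmc_trans_n ::
  "'a set \<Rightarrow> ('a \<Rightarrow> 'a \<Rightarrow> ennreal) \<Rightarrow> nat \<Rightarrow> real \<Rightarrow> 'a \<Rightarrow> 'a \<Rightarrow> ennreal" where
  "ctmc_trans_n S k 0 t x y = (if x = y then ennreal (exp (- exit_rate S k x * t)) else 0)"
| "ctmc_trans_n S k (Suc n) t x y =
     (\<integral>\<^sup>+u\<in>{0..t}. (ennreal (exp (- exit_rate S k x * u)) *
        (\<Sum>\<^sub>\<infinity>z\<in>S - {x}. k x z * ctmc_trans_n S k n (t - u) z y)) \<partial>lborel)"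

text \<open>
  The transition function of the chain, that is, the minimal solution of Kolmogorov's equations.
  It is substochastic in general, the missing mass being the probability of explosion before \<open>t\<close>.
\<close>

definition ctmc_trans :: "'a set \<Rightarrow> ('a \<Rightarrow> 'a \<Rightarrow> ennreal) \<Rightarrow> real \<Rightarrow> 'a \<Rightarrow> 'a \<Rightarrow> ennreal" where
  "ctmc_trans S k t x y = (\<Sum>n. ctmc_trans_n S k n t x y)"

text \<open>
  The measure may live on a larger space than \<open>S\<close>, so concentration on \<open>S\<close> is part of the
  following notion. As a stationary distribution on \<open>S\<close> has total mass one for all times,
  stationarity rules out that the chain started from \<open>\<pi>\<close> explodes.
\<close>

definition distribution_on :: "'a set \<Rightarrow> 'a measure \<Rightarrow> bool" where
  "distribution_on S \<pi> \<longleftrightarrow> prob_space \<pi> \<and> S \<in> sets \<pi> \<and> emeasure \<pi> S = 1"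

definition stationary_distribution ::
  "'a set \<Rightarrow> ('a \<Rightarrow> 'a \<Rightarrow> ennreal) \<Rightarrow> 'a measure \<Rightarrow> bool" where
  "stationary_distribution S k \<pi> \<longleftrightarrow> distribution_on S \<pi> \<and>
     (\<forall>t\<ge>0. \<forall>y\<in>S. (\<Sum>\<^sub>\<infinity>x\<in>S. emeasure \<pi> {x} * ctmc_trans S k t x y) = emeasure \<pi> {y})"

definition reversible_distribution ::
  "'a set \<Rightarrow> ('a \<Rightarrow> 'a \<Rightarrow> ennreal) \<Rightarrow> 'a measure \<Rightarrow> bool" where
  "reversible_distribution S k \<pi> \<longleftrightarrow> distribution_on S \<pi> \<and>
     (\<forall>t\<ge>0. \<forall>x\<in>S. \<forall>y\<in>S.
        emeasure \<pi> {x} * ctmc_trans S k t x y = emeasure \<pi> {y} * ctmc_trans S k t y x)"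


section \<open>Volume and states\<close>

text \<open>Used both for the volume \<open>\<Lambda>\<close> and for the set \<open>I\<close> of single-site values.\<close>

definition int_interval :: "int extended \<Rightarrow> int extended \<Rightarrow> int set" where
  "int_interval a b = {i. a \<le> Fin i \<and> Fin i \<le> b}"

text \<open>
  Configurations are functions on \<open>\<int>\<close> that are \<open>undefined\<close> off the volume, as in the
  space of a product measure. The sums \<open>N_particles\<close> and \<open>N_holes\<close> may be infinite; if \<open>\<omega>\<^sup>m\<^sup>i\<^sup>n\<close>
  (respectively \<open>\<omega>\<^sup>m\<^sup>a\<^sup>x\<close>) is infinite then every summand is.
\<close>

definition N_particles ::
  "int extended \<Rightarrow> int extended \<Rightarrow> int extended \<Rightarrow> (int \<Rightarrow> int) \<Rightarrow> ennreal" where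
  "N_particles L R wmin x =
     (\<Sum>\<^sub>\<infinity>i\<in>{i \<in> int_interval L R. i \<le> 0}.
        case wmin of Fin m \<Rightarrow> ennreal (of_int (x i - m)) | _ \<Rightarrow> top)"

definition N_holes ::
  "int extended \<Rightarrow> int extended \<Rightarrow> int extended \<Rightarrow> (int \<Rightarrow> int) \<Rightarrow> ennreal" where
  "N_holes L R wmax x =
     (\<Sum>\<^sub>\<infinity>i\<in>{i \<in> int_interval L R. 1 \<le> i}.
        case wmax of Fin m \<Rightarrow> ennreal (of_int (m - x i)) | _ \<Rightarrow> top)"

definition state_space ::
  "int extended \<Rightarrow> int extended \<Rightarrow> int extended \<Rightarrow> int extended \<Rightarrow> (int \<Rightarrow> int) set" where
  "state_space L R wmin wmax =
     {x \<in> int_interval L R \<rightarrow>\<^sub>E int_interval wmin wmax.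
        (L > Minf \<or> N_particles L R wmin x < top) \<and> (R < Pinf \<or> N_holes L R wmax x < top)}"


section \<open>Dynamics\<close>

text \<open>\<open>move \<Lambda> i j x\<close> is \<open>x\<^sup>i\<^sup>,\<^sup>j\<close>.\<close>

definition move :: "int set \<Rightarrow> int \<Rightarrow> int \<Rightarrow> (int \<Rightarrow> int) \<Rightarrow> int \<Rightarrow> int" where
  "move \<Lambda> i j x = (\<lambda>k. if k \<in> \<Lambda> then x k - of_bool (k = i) + of_bool (k = j) else x k)"

text \<open>
  Total rate of the jump from \<open>x\<close> to \<open>y\<close>: bulk rates \<open>P\<close>, \<open>Q\<close>, left boundary rates \<open>PL\<close>, \<open>QL\<close> and
  right boundary rates \<open>PR\<close>, \<open>QR\<close>. Distinct mechanisms can lead to the same target (in a volume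
  with one site), in which case their rates add up.
\<close>

definition jump_rate ::
  "int extended \<Rightarrow> int extended \<Rightarrow> (int \<Rightarrow> int \<Rightarrow> real) \<Rightarrow> (int \<Rightarrow> int \<Rightarrow> real) \<Rightarrow>
   (int \<Rightarrow> real) \<Rightarrow> (int \<Rightarrow> real) \<Rightarrow> (int \<Rightarrow> real) \<Rightarrow> (int \<Rightarrow> real) \<Rightarrow>
   (int \<Rightarrow> int) \<Rightarrow> (int \<Rightarrow> int) \<Rightarrow> ennreal" where
  "jump_rate L R P Q PL QL PR QR x y =
     (let \<Lambda> = int_interval L R;
          jump = (\<lambda>i j (rate :: real). if y = move \<Lambda> i j x then ennreal rate else 0)
      in (\<Sum>\<^sub>\<infinity>i\<in>{i. L \<le> Fin i \<and> Fin i < R}.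
            jump i (i + 1) (P (x i) (x (i + 1))) + jump (i + 1) i (Q (x i) (x (i + 1))))
       + (case L of Fin l \<Rightarrow> jump (l - 1) l (PL (x l)) + jump l (l - 1) (QL (x l)) | _ \<Rightarrow> 0)
       + (case R of Fin r \<Rightarrow> jump r (r + 1) (PR (x r)) + jump (r + 1) r (QR (x r)) | _ \<Rightarrow> 0))"


section \<open>Marginals\<close>

definition theta_min :: "int extended \<Rightarrow> (int \<Rightarrow> real) \<Rightarrow> ereal" where
  "theta_min wmin f = (if wmin > Minf then MInfty else Lim at_bot (\<lambda>z. ereal (ln (f z))))"

definition theta_max :: "int extended \<Rightarrow> (int \<Rightarrow> real) \<Rightarrow> ereal" where
  "theta_max wmax f = (if wmax < Pinf then PInfty else Lim at_top (\<lambda>z. ereal (ln (f z))))"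

text \<open>The generalised factorial \<open>f(z)!\<close>.\<close>

definition gen_fact :: "(int \<Rightarrow> real) \<Rightarrow> int \<Rightarrow> real" where
  "gen_fact f z = (if z \<ge> 0 then \<Prod>y\<in>{1..z}. f y else 1 / (\<Prod>y\<in>{z + 1..0}. f y))"

definition partition_fun :: "int extended \<Rightarrow> int extended \<Rightarrow> (int \<Rightarrow> real) \<Rightarrow> real \<Rightarrow> real" where
  "partition_fun wmin wmax f \<theta> =
     (\<Sum>\<^sub>\<infinity>y\<in>int_interval wmin wmax. exp (\<theta> * of_int y) / gen_fact f y)"

definition marginal ::
  "int extended \<Rightarrow> int extended \<Rightarrow> (int \<Rightarrow> real) \<Rightarrow> real \<Rightarrow> int measure" where
  "marginal wmin wmax f \<theta> =
     density (count_space (int_interval wmin wmax))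
       (\<lambda>z. ennreal (1 / partition_fun wmin wmax f \<theta> * (exp (\<theta> * of_int z) / gen_fact f z)))"


section \<open>Standing assumptions\<close>

text \<open>
  All rate functions are total functions of integers, constrained only on \<open>I\<close>; the boundary rates
  are constrained only if the corresponding end of the volume is finite.
\<close>

locale blocking_system =
  fixes L R wmin wmax :: "int extended"
    and P Q :: "int \<Rightarrow> int \<Rightarrow> real"
    and PL QL PR QR :: "int \<Rightarrow> real"
    and p q :: real
    and f :: "int \<Rightarrow> real"
    and s :: "int \<Rightarrow> int \<Rightarrow> real"
  assumes volume: "L \<le> Fin 0" "Fin 0 \<le> R"
    and site_values: "wmin \<le> Fin 0" "Fin 0 < wmax"
    and left_infinite: "L = Minf \<Longrightarrow> wmin > Minf"
    and right_infinite: "R = Pinf \<Longrightarrow> wmax < Pinf"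
    and bulk_nonneg: "\<And>y z. y \<in> int_interval wmin wmax \<Longrightarrow> z \<in> int_interval wmin wmax \<Longrightarrow>
          P y z \<ge> 0 \<and> Q y z \<ge> 0"
    and bulk_zero_min: "\<And>m z. wmin = Fin m \<Longrightarrow> z \<in> int_interval wmin wmax \<Longrightarrow>
          P m z = 0 \<and> Q z m = 0"
    and bulk_zero_max: "\<And>m z. wmax = Fin m \<Longrightarrow> z \<in> int_interval wmin wmax \<Longrightarrow>
          P z m = 0 \<and> Q m z = 0"
    and left_nonneg: "\<And>z. L > Minf \<Longrightarrow> z \<in> int_interval wmin wmax \<Longrightarrow> PL z \<ge> 0 \<and> QL z \<ge> 0"
    and left_zero_min: "\<And>m. L > Minf \<Longrightarrow> wmin = Fin m \<Longrightarrow> QL m = 0"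
    and left_zero_max: "\<And>m. L > Minf \<Longrightarrow> wmax = Fin m \<Longrightarrow> PL m = 0"
    and right_nonneg: "\<And>z. R < Pinf \<Longrightarrow> z \<in> int_interval wmin wmax \<Longrightarrow> PR z \<ge> 0 \<and> QR z \<ge> 0"
    and right_zero_min: "\<And>m. R < Pinf \<Longrightarrow> wmin = Fin m \<Longrightarrow> PR m = 0"
    and right_zero_max: "\<And>m. R < Pinf \<Longrightarrow> wmax = Fin m \<Longrightarrow> QR m = 0"
    and bulk_attractive: "\<And>y z. y \<in> int_interval wmin wmax \<Longrightarrow> z \<in> int_interval wmin wmax \<Longrightarrow>
          z + 1 \<in> int_interval wmin wmax \<Longrightarrow>
          P (z + 1) y \<ge> P z y \<and> P y (z + 1) \<le> P y z \<and> Q y (z + 1) \<ge> Q y z \<and> Q (z + 1) y \<le> Q z y"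
    and left_attractive: "\<And>z. L > Minf \<Longrightarrow> z \<in> int_interval wmin wmax \<Longrightarrow>
          z + 1 \<in> int_interval wmin wmax \<Longrightarrow> PL (z + 1) \<le> PL z \<and> QL (z + 1) \<ge> QL z"
    and right_attractive: "\<And>z. R < Pinf \<Longrightarrow> z \<in> int_interval wmin wmax \<Longrightarrow>
          z + 1 \<in> int_interval wmin wmax \<Longrightarrow> PR (z + 1) \<ge> PR z \<and> QR (z + 1) \<le> QR z"
    and P_nonzero: "\<And>y z. y \<in> int_interval wmin wmax \<Longrightarrow> z \<in> int_interval wmin wmax \<Longrightarrow>
          Fin y \<noteq> wmin \<Longrightarrow> Fin z \<noteq> wmax \<Longrightarrow> P y z \<noteq> 0"
    and Q_nonzero: "\<And>y z. y \<in> int_interval wmin wmax \<Longrightarrow> z \<in> int_interval wmin wmax \<Longrightarrow>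
          Fin y \<noteq> wmax \<Longrightarrow> Fin z \<noteq> wmin \<Longrightarrow> Q y z \<noteq> 0"
    and PL_nonzero: "\<And>z. L > Minf \<Longrightarrow> z \<in> int_interval wmin wmax \<Longrightarrow> Fin z \<noteq> wmax \<Longrightarrow> PL z \<noteq> 0"
    and QL_nonzero: "\<And>z. L > Minf \<Longrightarrow> z \<in> int_interval wmin wmax \<Longrightarrow> Fin z \<noteq> wmin \<Longrightarrow> QL z \<noteq> 0"
    and PR_nonzero: "\<And>z. R < Pinf \<Longrightarrow> z \<in> int_interval wmin wmax \<Longrightarrow> Fin z \<noteq> wmin \<Longrightarrow> PR z \<noteq> 0"
    and QR_nonzero: "\<And>z. R < Pinf \<Longrightarrow> z \<in> int_interval wmin wmax \<Longrightarrow> Fin z \<noteq> wmax \<Longrightarrow> QR z \<noteq> 0"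
    and asymmetry: "1 / 2 < p" "p = 1 - q" "p \<le> 1"
    and f_nonneg: "\<And>z. z \<in> int_interval wmin wmax \<Longrightarrow> f z \<ge> 0"
    and f_zero_min: "\<And>m. wmin = Fin m \<Longrightarrow> f m = 0"
    and s_nonneg: "\<And>y z. y \<in> int_interval wmin wmax \<Longrightarrow> z \<in> int_interval wmin wmax \<Longrightarrow> s y z \<ge> 0"
    and s_zero_max: "\<And>m y. wmax = Fin m \<Longrightarrow> y \<in> insert (m + 1) (int_interval wmin wmax) \<Longrightarrow>
          s (m + 1) y = 0 \<and> s y (m + 1) = 0"
    and P_eq: "\<And>y z. y \<in> int_interval wmin wmax \<Longrightarrow> z \<in> int_interval wmin wmax \<Longrightarrow>
          P y z = p * s y (z + 1) * f y"
    and Q_eq: "\<And>y z. y \<in> int_interval wmin wmax \<Longrightarrow> z \<in> int_interval wmin wmax \<Longrightarrow>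
          Q y z = q * s (y + 1) z * f z"
    and theta_interval_nonempty: "theta_min wmin f < theta_max wmax f"

end

theory Submission
  imports Defs
begin

text \<open>
  Reversibility and stationarity of a distribution \<open>\<pi>\<close> are statements about the transition function,
  whereas the rates only give access to detailed balance \<open>\<pi> x * k x y = \<pi> y * k y x\<close>. On a countable
  state space with unbounded rates detailed balance yields reversibility of the minimal transition
  function, but not stationarity: the chain might explode. The proof therefore has three parts.

  From detailed balance to the transition function (\<open>reversible_stationary_if_mean_rate_finite\<close>).
  The probability of having made exactly \<open>n\<close> jumps obeys not only the recursion over the first jump
  but also the one over the last jump, and the two are exchanged by time reversal; hence the
  \<open>n\<close>-jump transition functions are symmetric with respect to \<open>\<pi>\<close>. Under \<open>\<pi>\<close>, the expected number of
  jumps before time \<open>t\<close> is at most \<open>t\<close> times the mean total jump rate. If that mean is finite, there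
  are almost surely finitely many jumps before \<open>t\<close>, so no mass is lost, and reversibility gives
  stationarity.

  Detailed balance for the product measure. The marginals satisfy
  \<open>\<mu>\<^sup>\<theta>(z) * f z = exp \<theta> * \<mu>\<^sup>\<theta>(z - 1)\<close>. As \<open>exp (\<theta> (i + 1) - \<theta> i) = p / q\<close>, a jump of a particle
  over an edge is balanced by the reverse jump: the factors \<open>p\<close> and \<open>q\<close> of the rates are
  compensated by the change of \<open>\<theta>\<close>, and \<open>s\<close> takes the same value on both sides. The hypotheses on the boundary rates are
  detailed balance for the reservoirs. A jump changes at most two coordinates of a possibly infinite
  product; the point masses are limits of finite products, in which all other factors agree.

  Finiteness of the mean total rate. Above the minimal single-site value, attractivity makes
  \<open>s\<close> decreasing in both arguments but \<open>s a b * f a\<close> increasing in \<open>a\<close> and \<open>s a b * f b\<close> in \<open>b\<close>, which bounds every rate by a product of a function of one coordinate and a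
  function of the other (\<open>s_le\<close>, \<open>bulk_rate_le\<close>, \<open>reservoir_rate_le\<close>). The means of these functions
  are controlled by those of \<open>f z\<close> and \<open>1 / f (z + 1)\<close>, which are at most \<open>exp \<theta>\<close> and \<open>exp (- \<theta>)\<close>.
  If the volume is infinite to the right, then single-site values are bounded above, and the mean
  rates over the edges decrease geometrically with ratio \<open>q / p\<close>; similarly on the left.
  The same estimates and the Borel--Cantelli lemma show that almost every configuration has only
  finitely many particles on the left if \<open>\<Lambda>\<close> is unbounded there, and only finitely many holes on the
  right if \<open>\<Lambda>\<close> is unbounded there.
\<close>

section \<open>Sums and integrals\<close>


lemma infsum_eq_nn_integral_count_space:
  fixes f :: "'a \<Rightarrow> ennreal"
  assumes "countable A"
  shows "infsum f A = (\<integral>\<^sup>+x. f x \<partial>count_space A)"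
proof (rule antisym)
  have *: "infsum f A = (SUP F\<in>{F. finite F \<and> F \<subseteq> A}. sum f F)"
    by (rule nonneg_infsum_complete) simp
  show "infsum f A \<le> (\<integral>\<^sup>+x. f x \<partial>count_space A)"
    unfolding *
  proof (rule SUP_least)
    fix F assume F: "F \<in> {F. finite F \<and> F \<subseteq> A}"
    have "sum f F = (\<integral>\<^sup>+x. f x * indicator F x \<partial>count_space A)"
      using F by (subst nn_integral_count_space'[of F]) auto
    also have "\<dots> \<le> (\<integral>\<^sup>+x. f x \<partial>count_space A)"
      by (intro nn_integral_mono) (auto simp: indicator_def)
    finally show "sum f F \<le> (\<integral>\<^sup>+x. f x \<partial>count_space A)" .
  qed
  obtain B where B: "\<And>n. finite (B n)" "\<And>n. B n \<subseteq> A" "incseq B" "(\<Union>n. B n) = A"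
  proof
    define B where "B n = {x\<in>A. to_nat_on A x \<le> n}" for n
    show "finite (B n)" for n
      by (rule inj_on_finite[of "to_nat_on A" _ "{..n}"])
         (use inj_on_to_nat_on[OF assms] in \<open>auto simp: B_def inj_on_def\<close>)
    show "B n \<subseteq> A" for n by (auto simp: B_def)
    show "incseq B" by (auto simp: B_def incseq_def)
    show "(\<Union>n. B n) = A" by (auto simp: B_def)
  qed
  have "(\<integral>\<^sup>+x. f x \<partial>count_space A) = (\<integral>\<^sup>+x. (SUP n. f x * indicator (B n) x) \<partial>count_space A)"
  proof (intro nn_integral_cong)
    fix x assume "x \<in> space (count_space A)"
    then obtain n where "x \<in> B n" using B by auto
    then show "f x = (SUP n. f x * indicator (B n) x)"
      by (intro antisym SUP_upper2[of n] SUP_least) (auto simp: indicator_def)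
  qed
  also have "\<dots> = (SUP n. \<integral>\<^sup>+x. f x * indicator (B n) x \<partial>count_space A)"
    using B(3) by (intro nn_integral_monotone_convergence_SUP)
       (auto simp: incseq_def le_fun_def indicator_def split: if_splits)
  also have "\<dots> = (SUP n. sum f (B n))"
  proof (intro SUP_cong refl)
    fix n
    show "(\<integral>\<^sup>+x. f x * indicator (B n) x \<partial>count_space A) = sum f (B n)"
      using B(1,2)[of n] by (subst nn_integral_count_space'[of "B n"]) (auto intro: sum.cong)
  qed
  also have "\<dots> \<le> infsum f A"
    unfolding * using B by (intro SUP_least SUP_upper) auto
  finally show "(\<integral>\<^sup>+x. f x \<partial>count_space A) \<le> infsum f A" .
qed

lemma measurable_nn_integral_count_space:
  assumes S: "countable S" and "\<And>z. z \<in> S \<Longrightarrow> (\<lambda>w. f z w) \<in> borel_measurable N"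
  shows "(\<lambda>w. \<integral>\<^sup>+z. f z w \<partial>count_space S) \<in> borel_measurable N"
proof -
  interpret S: sigma_finite_measure "count_space S"
    by (rule sigma_finite_measure_count_space_countable[OF S])
  have "(\<lambda>(w, z). f z w) \<in> borel_measurable (N \<Otimes>\<^sub>M count_space S)"
    unfolding case_prod_beta
    by (rule measurable_compose_countable'[OF _ measurable_snd S])
       (rule measurable_compose[OF measurable_fst assms(2)])
  then show ?thesis
    by measurable
qed

lemma nn_integral_reflect_interval:
  fixes f :: "real \<Rightarrow> ennreal"
  assumes [measurable]: "f \<in> borel_measurable borel"
  shows "(\<integral>\<^sup>+u. indicator {0..t} u * f (t - u) \<partial>lborel) = (\<integral>\<^sup>+u. indicator {0..t} u * f u \<partial>lborel)"
proof -
  have "(\<integral>\<^sup>+u. indicator {0..t} u * f u \<partial>lborel)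
      = (\<integral>\<^sup>+u. indicator {0..t} (t + (-1) * u) * f (t + (-1) * u) \<partial>lborel)"
    by (subst nn_integral_real_affine[where c = "-1" and t = t]) auto
  also have "\<dots> = (\<integral>\<^sup>+u. indicator {0..t} u * f (t - u) \<partial>lborel)"
    by (intro nn_integral_cong) (auto simp: indicator_def)
  finally show ?thesis ..
qed

text \<open>
  An exponential holding time either exceeds \<open>t\<close> or has a density on the interval from \<open>0\<close> to \<open>t\<close>.
  The identity is stated additively because subtraction of extended non-negative reals truncates.
\<close>

lemma exponential_holding_time:
  fixes r t :: real
  assumes "0 \<le> r" "0 \<le> t"
  shows "ennreal (exp (- r * t)) + ennreal r * (\<integral>\<^sup>+u. indicator {0..t} u * ennreal (exp (- r * u)) \<partial>lborel) = 1"
proof -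
  have "(\<integral>\<^sup>+u. ennreal (r * exp (- r * u)) * indicator {0..t} u \<partial>lborel)
      = ennreal (- exp (- r * t) - - exp (- r * 0))"
    using assms by (intro nn_integral_FTC_Icc) (auto intro!: derivative_eq_intros)
  moreover have "(\<integral>\<^sup>+u. ennreal (r * exp (- r * u)) * indicator {0..t} u \<partial>lborel)
      = ennreal r * (\<integral>\<^sup>+u. indicator {0..t} u * ennreal (exp (- r * u)) \<partial>lborel)"
    using assms by (subst nn_integral_cmult[symmetric])
       (auto intro!: nn_integral_cong simp: ennreal_mult' mult_ac)
  ultimately have "ennreal r * (\<integral>\<^sup>+u. indicator {0..t} u * ennreal (exp (- r * u)) \<partial>lborel)
      = ennreal (1 - exp (- r * t))"
    by simp
  then show ?thesis
    using assms by (simp del: ennreal_minus flip: ennreal_plus ennreal_1)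
qed

lemma measurable_indicator_interval [measurable (raw)]:
  fixes a b :: "'w \<Rightarrow> real"
  assumes [measurable]: "a \<in> borel_measurable N" "b \<in> borel_measurable N"
  shows "(\<lambda>w. indicator {0..a w} (b w) :: ennreal) \<in> borel_measurable N"
proof -
  have "(\<lambda>w. indicator {w \<in> space N. 0 \<le> b w \<and> b w \<le> a w} w :: ennreal) \<in> borel_measurable N"
    by measurable
  then show ?thesis
    by (rule measurable_cong[THEN iffD1, rotated]) (auto simp: indicator_def)
qed

section \<open>Conditioning on the first and on the last jump\<close>

locale countable_chain =
  fixes S :: "'a set" and k :: "'a \<Rightarrow> 'a \<Rightarrow> ennreal"
  assumes countable_S: "countable S"
begin

text \<open>
  Setting the diagonal to zero replaces the index sets \<open>S - {x}\<close>, which vary with the state, by \<open>S\<close>,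
  so that sums over several intermediate states can be exchanged.
\<close>

definition off_diag :: "'a \<Rightarrow> 'a \<Rightarrow> ennreal" where
  "off_diag x y = (if x = y then 0 else k x y)"

text \<open>
  The probability that the holding time in \<open>x\<close> exceeds \<open>u\<close>.
\<close>

definition survival :: "'a \<Rightarrow> real \<Rightarrow> ennreal" where
  "survival x u = ennreal (exp (- exit_rate S k x * u))"

abbreviation T :: "nat \<Rightarrow> real \<Rightarrow> 'a \<Rightarrow> 'a \<Rightarrow> ennreal" where
  "T \<equiv> ctmc_trans_n S k"

text \<open>
  In contrast to \<open>exit_rate\<close>, this keeps the value \<open>\<infinity>\<close>.
\<close>

definition total_rate :: "'a \<Rightarrow> ennreal" where
  "total_rate x = (\<integral>\<^sup>+y. off_diag x y \<partial>count_space S)"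

lemma survival_measurable [measurable]: "survival x \<in> borel_measurable borel"
  unfolding survival_def by measurable

lemma sum_off_diagonal:
  "(\<Sum>\<^sub>\<infinity>z\<in>S - {x}. k x z * g z) = (\<integral>\<^sup>+z. off_diag x z * g z \<partial>count_space S)"
proof -
  have "(\<Sum>\<^sub>\<infinity>z\<in>S - {x}. k x z * g z) = (\<Sum>\<^sub>\<infinity>z\<in>S. off_diag x z * g z)"
    by (rule infsum_cong_neutral) (auto simp: off_diag_def)
  then show ?thesis
    using infsum_eq_nn_integral_count_space[OF countable_S] by simp
qed

lemma exit_rate_eq: "exit_rate S k x = enn2real (total_rate x)"
  using sum_off_diagonal[of x "\<lambda>_. 1"] by (simp add: exit_rate_def total_rate_def)

lemma T_0: "T 0 t x y = (if x = y then survival x t else 0)"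
  by (simp add: survival_def)

lemma T_Suc_first_jump:
  "T (Suc n) t x y = (\<integral>\<^sup>+u. indicator {0..t} u *
     (survival x u * (\<integral>\<^sup>+z. off_diag x z * T n (t - u) z y \<partial>count_space S)) \<partial>lborel)"
  by (simp add: sum_off_diagonal survival_def mult_ac)

declare ctmc_trans_n.simps [simp del]

lemmas measurable_sum_S = measurable_nn_integral_count_space[OF countable_S]

lemma T_measurable: "(\<lambda>t. T n t x y) \<in> borel_measurable borel"
proof (induction n arbitrary: x y)
  case 0
  then show ?case by (auto simp: T_0)
next
  case (Suc n)
  have [measurable]: "(\<lambda>w. \<integral>\<^sup>+z. off_diag x z * T n (fst w - snd w) z y \<partial>count_space S)
      \<in> borel_measurable (borel \<Otimes>\<^sub>M lborel)"
    by (intro measurable_sum_S borel_measurable_times_ennreal measurable_compose[OF _ Suc]) measurable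
  show ?case
    unfolding T_Suc_first_jump
    by (rule lborel.borel_measurable_nn_integral) (simp add: case_prod_beta)
qed

lemma T_measurable' [measurable (raw)]:
  "g \<in> borel_measurable N \<Longrightarrow> (\<lambda>w. T n (g w) x y) \<in> borel_measurable N"
  using measurable_compose[OF _ T_measurable] .

lemma swap_S:
  assumes "\<And>z. z \<in> S \<Longrightarrow> (\<lambda>w. f z w) \<in> borel_measurable N"
  shows "(\<integral>\<^sup>+w. \<integral>\<^sup>+z. f z w \<partial>count_space S \<partial>N) = (\<integral>\<^sup>+z. \<integral>\<^sup>+w. f z w \<partial>N \<partial>count_space S)"
  using nn_integral_count_space_nn_integral[OF countable_S assms] .

lemma T_Suc_first_jump':
  "T (Suc n) t x y = (\<integral>\<^sup>+z. \<integral>\<^sup>+u. indicator {0..t} u * survival x u * off_diag x z * T n (t - u) z y \<partial>lborel \<partial>count_space S)"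
proof -
  have "T (Suc n) t x y =
      (\<integral>\<^sup>+u. \<integral>\<^sup>+z. indicator {0..t} u * survival x u * off_diag x z * T n (t - u) z y \<partial>count_space S \<partial>lborel)"
    unfolding T_Suc_first_jump by (simp add: mult.assoc nn_integral_cmult)
  then show ?thesis
    by (subst (asm) swap_S) auto
qed

text \<open>
  The companion of the defining recursion: the last jump goes from \<open>z\<close> to \<open>y\<close>, and \<open>v\<close> is the time
  spent in \<open>y\<close> since then. In the induction step both recursions are applied once, and the integral
  over the first holding time \<open>u\<close> and the final one \<open>v\<close>, subject to \<open>u + v \<le> t\<close>, is
  evaluated in either order.
\<close>

lemma T_Suc_last_jump:
  assumes "x \<in> S" "y \<in> S"
  shows "T (Suc n) t x y =
    (\<integral>\<^sup>+z. \<integral>\<^sup>+v. indicator {0..t} v * T n (t - v) x z * off_diag z y * survival y v \<partial>lborel \<partial>count_space S)"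
  using assms
proof (induction n arbitrary: t x y)
  case 0
  have "T (Suc 0) t x y = (\<integral>\<^sup>+u. indicator {0..t} u * survival x u * off_diag x y * survival y (t - u) \<partial>lborel)"
    using 0 unfolding T_Suc_first_jump'
    by (subst nn_integral_count_space'[of "{y}"]) (auto simp: T_0)
  also have "\<dots> = (\<integral>\<^sup>+u. indicator {0..t} u * (survival x u * off_diag x y * survival y (t - u)) \<partial>lborel)"
    by (simp add: mult.assoc)
  also have "\<dots> = (\<integral>\<^sup>+u. indicator {0..t} u * (survival x (t - u) * off_diag x y * survival y (t - (t - u))) \<partial>lborel)"
    by (rule nn_integral_reflect_interval[symmetric]) measurable
  also have "\<dots> = (\<integral>\<^sup>+z. \<integral>\<^sup>+v. indicator {0..t} v * T 0 (t - v) x z * off_diag z y * survival y v \<partial>lborel \<partial>count_space S)"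
    using 0 by (subst nn_integral_count_space'[of "{x}"]) (auto simp: T_0 mult.assoc)
  finally show ?case .
next
  case (Suc n)
  \<comment> \<open>the indicator of the simplex \<open>u, v \<ge> 0\<close>, \<open>u + v \<le> t\<close>\<close>
  define J :: "real \<Rightarrow> real \<Rightarrow> ennreal" where "J u v = indicator {0..t} u * indicator {0..t - u} v" for u v
  have J_sym: "J u v = J v u" for u v
    by (auto simp: J_def indicator_def)
  have J_meas [measurable]: "(\<lambda>w. J (a w) (b w)) \<in> borel_measurable N"
    if [measurable]: "a \<in> borel_measurable N" "b \<in> borel_measurable N" for a b :: "'z \<Rightarrow> real" and N
    unfolding J_def by measurable
  let ?F = "\<lambda>z w u v. J u v * (survival x u * off_diag x z * T n (t - u - v) z w * off_diag w y * survival y v)"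
  have [measurable]: "(\<lambda>(u, v). ?F z w u v) \<in> borel_measurable (lborel \<Otimes>\<^sub>M lborel)" for z w
    by measurable
  have "T (Suc (Suc n)) t x y = (\<integral>\<^sup>+z. \<integral>\<^sup>+u. \<integral>\<^sup>+w. \<integral>\<^sup>+v. ?F z w u v \<partial>lborel \<partial>count_space S \<partial>lborel \<partial>count_space S)"
    unfolding T_Suc_first_jump'[of "Suc n"]
    using Suc by (intro nn_integral_cong)
      (simp add: Suc.IH J_def mult_ac nn_integral_cmult[symmetric])
  also have "\<dots> = (\<integral>\<^sup>+z. \<integral>\<^sup>+w. \<integral>\<^sup>+u. \<integral>\<^sup>+v. ?F z w u v \<partial>lborel \<partial>lborel \<partial>count_space S \<partial>count_space S)"
    by (intro nn_integral_cong swap_S) measurable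
  also have "\<dots> = (\<integral>\<^sup>+w. \<integral>\<^sup>+z. \<integral>\<^sup>+u. \<integral>\<^sup>+v. ?F z w u v \<partial>lborel \<partial>lborel \<partial>count_space S \<partial>count_space S)"
    by (rule swap_S) simp
  also have "\<dots> = (\<integral>\<^sup>+w. \<integral>\<^sup>+z. \<integral>\<^sup>+v. \<integral>\<^sup>+u. ?F z w u v \<partial>lborel \<partial>lborel \<partial>count_space S \<partial>count_space S)"
    by (intro nn_integral_cong lborel_pair.Fubini') measurable
  also have "\<dots> = (\<integral>\<^sup>+w. \<integral>\<^sup>+v. \<integral>\<^sup>+z. \<integral>\<^sup>+u. ?F z w u v \<partial>lborel \<partial>count_space S \<partial>lborel \<partial>count_space S)"
    by (intro nn_integral_cong swap_S[symmetric]) measurable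
  also have "\<dots> = (\<integral>\<^sup>+w. \<integral>\<^sup>+v. indicator {0..t} v * T (Suc n) (t - v) x w * off_diag w y * survival y v \<partial>lborel \<partial>count_space S)"
    unfolding T_Suc_first_jump'[of n]
    by (subst J_sym)
       (simp add: J_def mult_ac nn_integral_cmult[symmetric] diff_diff_eq add.commute)
  finally show ?case .
qed

end

section \<open>Detailed balance and non-explosion\<close>

locale reversible_chain = countable_chain S k for S :: "'a set" and k +
  fixes \<pi> :: "'a \<Rightarrow> ennreal"
  assumes detailed_balance: "x \<in> S \<Longrightarrow> y \<in> S \<Longrightarrow> x \<noteq> y \<Longrightarrow> \<pi> x * k x y = \<pi> y * k y x"
    and finite_mean_rate: "(\<integral>\<^sup>+x. \<pi> x * total_rate x \<partial>count_space S) < \<infinity>"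
begin

lemma off_diag_balance: "x \<in> S \<Longrightarrow> y \<in> S \<Longrightarrow> \<pi> x * off_diag x y = \<pi> y * off_diag y x"
  using detailed_balance[of x y] by (auto simp: off_diag_def)

text \<open>
  Detailed balance moves \<open>\<pi>\<close> along a path one jump at a time. Reversing a path turns its first jump
  into its last one, so the first-jump recursion for one side meets the last-jump recursion for the
  other.
\<close>

lemma T_balance:
  assumes "x \<in> S" "y \<in> S"
  shows "\<pi> x * T n t x y = \<pi> y * T n t y x"
  using assms
proof (induction n arbitrary: t x y)
  case 0
  then show ?case by (auto simp: T_0)
next
  case (Suc n)
  have "\<pi> x * T (Suc n) t x y =
      (\<integral>\<^sup>+z. \<integral>\<^sup>+u. indicator {0..t} u * survival x u * (\<pi> x * off_diag x z) * T n (t - u) z y \<partial>lborel \<partial>count_space S)"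
    unfolding T_Suc_first_jump' by (simp add: nn_integral_cmult[symmetric] mult_ac)
  also have "\<dots> = (\<integral>\<^sup>+z. \<integral>\<^sup>+u. \<pi> y * (indicator {0..t} u * T n (t - u) y z * off_diag z x * survival x u) \<partial>lborel \<partial>count_space S)"
  proof (intro nn_integral_cong)
    fix z u assume "z \<in> space (count_space S)"
    then have z: "z \<in> S" by simp
    have "indicator {0..t} u * survival x u * (\<pi> x * off_diag x z) * T n (t - u) z y
        = indicator {0..t} u * survival x u * off_diag z x * (\<pi> z * T n (t - u) z y)"
      using off_diag_balance[OF Suc.prems(1) z] by (simp add: mult_ac)
    also have "\<dots> = \<pi> y * (indicator {0..t} u * T n (t - u) y z * off_diag z x * survival x u)"
      by (simp add: Suc.IH[OF z Suc.prems(2)] mult_ac)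
    finally show "indicator {0..t} u * survival x u * (\<pi> x * off_diag x z) * T n (t - u) z y = \<dots>" .
  qed
  also have "\<dots> = \<pi> y * T (Suc n) t y x"
    unfolding T_Suc_last_jump[OF Suc.prems(2,1)] by (simp add: nn_integral_cmult)
  finally show ?case .
qed

text \<open>
  A state of positive mass cannot have an infinite total rate, so for such states \<open>exit_rate\<close> is the
  true total rate.
\<close>

lemma total_rate_finite:
  assumes "x \<in> S" "\<pi> x \<noteq> 0"
  shows "total_rate x = ennreal (exit_rate S k x)"
proof -
  have "\<pi> x * total_rate x \<le> (\<integral>\<^sup>+x. \<pi> x * total_rate x \<partial>count_space S)"
    using assms(1) by (rule nn_integral_ge_point)
  then have "\<pi> x * total_rate x < \<infinity>"
    using finite_mean_rate by simp
  then have "total_rate x < \<infinity>"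
    using assms(2) by (auto simp: ennreal_mult_less_top)
  then show ?thesis
    by (simp add: exit_rate_eq)
qed

text \<open>
  Null states, for which nothing is known about the total rate, cannot be reached from states of
  positive mass.
\<close>

lemma T_null:
  assumes "x \<in> S" "y \<in> S" "\<pi> x \<noteq> 0" "\<pi> y = 0"
  shows "T n t x y = 0"
  using T_balance[OF assms(1,2), of n t] assms(3,4) by simp

text \<open>
  The rate of entering \<open>y\<close> at time \<open>v\<close> by jump number \<open>n + 1\<close>, for the chain started in \<open>x\<close>.
\<close>

definition entrance_rate :: "nat \<Rightarrow> 'a \<Rightarrow> real \<Rightarrow> 'a \<Rightarrow> ennreal" where
  "entrance_rate n x v y = (\<integral>\<^sup>+z. T n v x z * off_diag z y \<partial>count_space S)"

lemma entrance_rate_measurable [measurable (raw)]: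
  "g \<in> borel_measurable N \<Longrightarrow> (\<lambda>w. entrance_rate n x (g w) y) \<in> borel_measurable N"
  unfolding entrance_rate_def
  by (intro measurable_sum_S borel_measurable_times_ennreal T_measurable') auto

lemma T_Suc_entrance:
  assumes "x \<in> S" "y \<in> S"
  shows "T (Suc n) t x y = (\<integral>\<^sup>+v. indicator {0..t} v * (entrance_rate n x v y * survival y (t - v)) \<partial>lborel)"
proof -
  have "T (Suc n) t x y =
      (\<integral>\<^sup>+v. \<integral>\<^sup>+z. indicator {0..t} v * T n (t - v) x z * off_diag z y * survival y v \<partial>count_space S \<partial>lborel)"
    unfolding T_Suc_last_jump[OF assms] by (rule swap_S[symmetric]) measurable
  also have "\<dots> = (\<integral>\<^sup>+v. indicator {0..t} v * (entrance_rate n x (t - v) y * survival y (t - (t - v))) \<partial>lborel)"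
    by (simp add: entrance_rate_def nn_integral_cmult[symmetric] mult_ac)
  also have "\<dots> = (\<integral>\<^sup>+v. indicator {0..t} v * (entrance_rate n x v y * survival y (t - v)) \<partial>lborel)"
    by (rule nn_integral_reflect_interval) measurable
  finally show ?thesis .
qed

lemma holding_time:
  assumes "y \<in> S" "\<pi> y \<noteq> 0" "0 \<le> t"
  shows "survival y t + total_rate y * (\<integral>\<^sup>+u. indicator {0..t} u * survival y u \<partial>lborel) = 1"
  using exponential_holding_time[of "exit_rate S k y" t] assms
  by (simp add: total_rate_finite survival_def exit_rate_def)

text \<open>
  A chain that has entered \<open>y\<close> by its jump number \<open>n + 1\<close> before time \<open>t\<close> is either still there, or
  has left again before \<open>t\<close>. The entrance at time \<open>v\<close> is followed by a holding time in \<open>y\<close>, to which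
  \<open>holding_time\<close> applies with the remaining time \<open>t - v\<close>.
\<close>

lemma entrance_balance:
  assumes x: "x \<in> S" "\<pi> x \<noteq> 0" and y: "y \<in> S"
  shows "T (Suc n) t x y + (\<integral>\<^sup>+s. indicator {0..t} s * (T (Suc n) s x y * total_rate y) \<partial>lborel)
       = (\<integral>\<^sup>+v. indicator {0..t} v * entrance_rate n x v y \<partial>lborel)"
proof (cases "\<pi> y = 0")
  case True
  have "T n v x z * off_diag z y = 0" if z: "z \<in> S" for z v
  proof (cases "\<pi> z = 0")
    case False
    then show ?thesis
      using off_diag_balance[OF z y] True by simp
  qed (simp add: T_null[OF x(1) z x(2)])
  then have "entrance_rate n x v y = 0" for v
    unfolding entrance_rate_def by (subst nn_integral_cong[where v = "\<lambda>_. 0"]) auto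
  then show ?thesis
    by (simp add: T_null[OF x(1) y x(2) True])
next
  case False
  let ?h = "\<lambda>v. entrance_rate n x v y" and ?R = "total_rate y"
  have "(\<integral>\<^sup>+s. indicator {0..t} s * (T (Suc n) s x y * ?R) \<partial>lborel)
      = (\<integral>\<^sup>+s. \<integral>\<^sup>+v. indicator {0..t} s * indicator {0..s} v * (?h v * ?R * survival y (s - v)) \<partial>lborel \<partial>lborel)"
    by (simp add: T_Suc_entrance[OF x(1) y] nn_integral_cmult[symmetric] nn_integral_multc[symmetric] mult_ac)
  also have "\<dots> = (\<integral>\<^sup>+v. \<integral>\<^sup>+s. indicator {0..t} s * indicator {0..s} v * (?h v * ?R * survival y (s - v)) \<partial>lborel \<partial>lborel)"
    by (rule lborel_pair.Fubini') measurable
  also have "\<dots> = (\<integral>\<^sup>+v. indicator {0..t} v * ?h v * (?R * (\<integral>\<^sup>+u. indicator {0..t - v} u * survival y u \<partial>lborel)) \<partial>lborel)"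
  proof (intro nn_integral_cong)
    fix v
    \<comment> \<open>\<open>u = s - v\<close> is the time since the entrance\<close>
    have "(\<integral>\<^sup>+s. indicator {0..t} s * indicator {0..s} v * (?h v * ?R * survival y (s - v)) \<partial>lborel)
        = (\<integral>\<^sup>+u. indicator {0..t} (v + u) * indicator {0..v + u} v * (?h v * ?R * survival y (v + u - v)) \<partial>lborel)"
      by (subst nn_integral_real_affine[where c = 1 and t = v]) simp_all
    also have "\<dots> = (\<integral>\<^sup>+u. (indicator {0..t} v * ?h v * ?R) * (indicator {0..t - v} u * survival y u) \<partial>lborel)"
      by (intro nn_integral_cong) (auto simp: indicator_def mult_ac)
    finally show "(\<integral>\<^sup>+s. indicator {0..t} s * indicator {0..s} v * (?h v * ?R * survival y (s - v)) \<partial>lborel)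
       = indicator {0..t} v * ?h v * (?R * (\<integral>\<^sup>+u. indicator {0..t - v} u * survival y u \<partial>lborel))"
      by (simp add: nn_integral_cmult mult.assoc)
  qed
  finally have "T (Suc n) t x y + (\<integral>\<^sup>+s. indicator {0..t} s * (T (Suc n) s x y * ?R) \<partial>lborel)
     = (\<integral>\<^sup>+v. indicator {0..t} v * (?h v * survival y (t - v)) \<partial>lborel) +
       (\<integral>\<^sup>+v. indicator {0..t} v * ?h v * (?R * (\<integral>\<^sup>+u. indicator {0..t - v} u * survival y u \<partial>lborel)) \<partial>lborel)"
    by (simp add: T_Suc_entrance[OF x(1) y])
  also have "\<dots> = (\<integral>\<^sup>+v. indicator {0..t} v * (?h v * survival y (t - v)) +
       indicator {0..t} v * ?h v * (?R * (\<integral>\<^sup>+u. indicator {0..t - v} u * survival y u \<partial>lborel)) \<partial>lborel)"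
    by (rule nn_integral_add[symmetric]) measurable
  also have "\<dots> = (\<integral>\<^sup>+v. indicator {0..t} v * ?h v \<partial>lborel)"
  proof (intro nn_integral_cong)
    fix v
    have "indicator {0..t} v * (?h v * survival y (t - v)) +
       indicator {0..t} v * ?h v * (?R * (\<integral>\<^sup>+u. indicator {0..t - v} u * survival y u \<partial>lborel))
       = indicator {0..t} v * ?h v * (survival y (t - v) + ?R * (\<integral>\<^sup>+u. indicator {0..t - v} u * survival y u \<partial>lborel))"
      by (simp add: algebra_simps)
    also have "\<dots> = indicator {0..t} v * ?h v"
      using holding_time[OF y False, of "t - v"] by (auto simp: indicator_def)
    finally show "indicator {0..t} v * (?h v * survival y (t - v)) +
       indicator {0..t} v * ?h v * (?R * (\<integral>\<^sup>+u. indicator {0..t - v} u * survival y u \<partial>lborel))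
       = indicator {0..t} v * ?h v" .
  qed
  finally show ?thesis .
qed

definition prob_jumps :: "nat \<Rightarrow> real \<Rightarrow> 'a \<Rightarrow> ennreal" where
  "prob_jumps n t x = (\<integral>\<^sup>+y. T n t x y \<partial>count_space S)"

text \<open>
  The probability of at least \<open>n + 1\<close> jumps before time \<open>t\<close>, written as the integral of the rate at
  which jump number \<open>n + 1\<close> occurs.
\<close>

definition prob_more_jumps :: "nat \<Rightarrow> real \<Rightarrow> 'a \<Rightarrow> ennreal" where
  "prob_more_jumps n t x = (\<integral>\<^sup>+y. \<integral>\<^sup>+v. indicator {0..t} v * (T n v x y * total_rate y) \<partial>lborel \<partial>count_space S)"

lemma prob_jumps_0:
  assumes "x \<in> S" "\<pi> x \<noteq> 0" "0 \<le> t"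
  shows "prob_jumps 0 t x + prob_more_jumps 0 t x = 1"
proof -
  have "prob_jumps 0 t x = survival x t"
    unfolding prob_jumps_def using assms by (subst nn_integral_count_space'[of "{x}"]) (auto simp: T_0)
  moreover have "prob_more_jumps 0 t x = (\<integral>\<^sup>+u. indicator {0..t} u * (survival x u * total_rate x) \<partial>lborel)"
    unfolding prob_more_jumps_def using assms by (subst nn_integral_count_space'[of "{x}"]) (auto simp: T_0)
  moreover have "\<dots> = total_rate x * (\<integral>\<^sup>+u. indicator {0..t} u * survival x u \<partial>lborel)"
    by (subst nn_integral_cmult[symmetric]) (auto simp: mult_ac)
  ultimately show ?thesis
    using holding_time[OF assms] by simp
qed

text \<open>
  Summation of \<open>entrance_balance\<close> over the state \<open>y\<close> entered by jump number \<open>n + 1\<close>: at least \<open>n + 1\<close>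
  jumps means exactly \<open>n + 1\<close> or at least \<open>n + 2\<close>.
\<close>

lemma prob_jumps_Suc:
  assumes "x \<in> S" "\<pi> x \<noteq> 0"
  shows "prob_jumps (Suc n) t x + prob_more_jumps (Suc n) t x = prob_more_jumps n t x"
proof -
  have "prob_jumps (Suc n) t x + prob_more_jumps (Suc n) t x =
     (\<integral>\<^sup>+y. T (Suc n) t x y +
        (\<integral>\<^sup>+v. indicator {0..t} v * (T (Suc n) v x y * total_rate y) \<partial>lborel) \<partial>count_space S)"
    unfolding prob_jumps_def prob_more_jumps_def by (rule nn_integral_add[symmetric]) simp_all
  also have "\<dots> = (\<integral>\<^sup>+y. \<integral>\<^sup>+v. indicator {0..t} v * entrance_rate n x v y \<partial>lborel \<partial>count_space S)"
    using assms by (intro nn_integral_cong) (simp add: entrance_balance)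
  also have "\<dots> = (\<integral>\<^sup>+y. \<integral>\<^sup>+z. \<integral>\<^sup>+v. indicator {0..t} v * (T n v x z * off_diag z y) \<partial>lborel \<partial>count_space S \<partial>count_space S)"
    by (subst swap_S[symmetric]) (auto simp: entrance_rate_def nn_integral_cmult)
  also have "\<dots> = (\<integral>\<^sup>+z. \<integral>\<^sup>+y. \<integral>\<^sup>+v. indicator {0..t} v * (T n v x z * off_diag z y) \<partial>lborel \<partial>count_space S \<partial>count_space S)"
    by (rule swap_S) simp
  also have "\<dots> = prob_more_jumps n t x"
    unfolding prob_more_jumps_def
    by (subst swap_S[symmetric]) (auto simp: total_rate_def nn_integral_cmult mult.assoc[symmetric])
  finally show ?thesis .
qed

lemma prob_jumps_partial_sum:
  assumes "x \<in> S" "\<pi> x \<noteq> 0" "0 \<le> t"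
  shows "(\<Sum>m\<le>n. prob_jumps m t x) + prob_more_jumps n t x = 1"
proof (induction n)
  case 0
  then show ?case using prob_jumps_0[OF assms] by simp
next
  case (Suc n)
  then show ?case
    using prob_jumps_Suc[OF assms(1,2), of n t] by (simp add: add.assoc)
qed

lemma prob_jumps_sum_le_1:
  assumes "x \<in> S" "\<pi> x \<noteq> 0" "0 \<le> t"
  shows "(\<Sum>n. prob_jumps n t x) \<le> 1"
proof (rule suminf_le_const)
  show "summable (\<lambda>n. prob_jumps n t x)" by simp
  show "(\<Sum>m<n. prob_jumps m t x) \<le> 1" for n
  proof -
    have "(\<Sum>m<n. prob_jumps m t x) \<le> (\<Sum>m\<le>n. prob_jumps m t x)"
      by (intro sum_mono2) auto
    also have "\<dots> \<le> 1"
      unfolding prob_jumps_partial_sum[OF assms, of n, symmetric] by simp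
    finally show ?thesis .
  qed
qed

text \<open>
  The sum over \<open>n\<close> of the probabilities of at least \<open>n + 1\<close> jumps is the expected number of jumps
  before \<open>t\<close>. If the chain is started from \<open>\<pi>\<close>, reversibility replaces the probability of being in \<open>y\<close> at
  time \<open>v\<close> by \<open>\<pi> y\<close> times the mass of the chain started in \<open>y\<close>, which is at most one. So jumps
  from \<open>y\<close> occur at rate at most \<open>\<pi> y * total_rate y\<close>, uniformly in time.
\<close>

lemma mean_number_of_jumps_finite:
  assumes "0 \<le> t"
  shows "(\<integral>\<^sup>+x. \<pi> x * (\<Sum>n. prob_more_jumps n t x) \<partial>count_space S) < \<infinity>"
proof -
  let ?J = "\<lambda>n x y. \<integral>\<^sup>+v. indicator {0..t} v * (\<pi> y * total_rate y * T n v y x) \<partial>lborel"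
  have "\<pi> x * (\<Sum>n. prob_more_jumps n t x) = (\<Sum>n. \<integral>\<^sup>+y. ?J n x y \<partial>count_space S)" if x: "x \<in> S" for x
  proof -
    have "\<pi> x * prob_more_jumps n t x = (\<integral>\<^sup>+y. ?J n x y \<partial>count_space S)" for n
    proof -
      have "\<pi> x * prob_more_jumps n t x =
        (\<integral>\<^sup>+y. \<integral>\<^sup>+v. indicator {0..t} v * (total_rate y * (\<pi> x * T n v x y)) \<partial>lborel \<partial>count_space S)"
        unfolding prob_more_jumps_def by (simp add: nn_integral_cmult[symmetric] mult_ac)
      also have "\<dots> = (\<integral>\<^sup>+y. ?J n x y \<partial>count_space S)"
        using x by (intro nn_integral_cong) (simp add: T_balance mult_ac)
      finally show ?thesis .
    qed
    then show ?thesis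
      by (simp flip: ennreal_suminf_cmult)
  qed
  then have "(\<integral>\<^sup>+x. \<pi> x * (\<Sum>n. prob_more_jumps n t x) \<partial>count_space S)
      = (\<integral>\<^sup>+x. (\<Sum>n. \<integral>\<^sup>+y. ?J n x y \<partial>count_space S) \<partial>count_space S)"
    by (intro nn_integral_cong) simp
  also have "\<dots> = (\<Sum>n. \<integral>\<^sup>+x. \<integral>\<^sup>+y. ?J n x y \<partial>count_space S \<partial>count_space S)"
    by (rule nn_integral_suminf) simp
  also have "\<dots> = (\<Sum>n. \<integral>\<^sup>+y. \<integral>\<^sup>+x. ?J n x y \<partial>count_space S \<partial>count_space S)"
    by (intro arg_cong[where f = suminf] ext swap_S) simp
  also have "\<dots> = (\<Sum>n. \<integral>\<^sup>+y. \<integral>\<^sup>+v. indicator {0..t} v * (\<pi> y * total_rate y * prob_jumps n v y) \<partial>lborel \<partial>count_space S)"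
    by (subst swap_S[symmetric]) (auto simp: prob_jumps_def nn_integral_cmult)
  also have "\<dots> = (\<integral>\<^sup>+y. (\<Sum>n. \<integral>\<^sup>+v. indicator {0..t} v * (\<pi> y * total_rate y * prob_jumps n v y) \<partial>lborel) \<partial>count_space S)"
    by (rule nn_integral_suminf[symmetric]) simp
  also have "\<dots> \<le> (\<integral>\<^sup>+y. \<pi> y * total_rate y * ennreal t \<partial>count_space S)"
  proof (intro nn_integral_mono)
    fix y assume "y \<in> space (count_space S)"
    then have y: "y \<in> S" by simp
    have [measurable]: "(\<lambda>v. prob_jumps n v y) \<in> borel_measurable borel" for n
      unfolding prob_jumps_def by (rule measurable_sum_S) measurable
    have "(\<Sum>n. \<integral>\<^sup>+v. indicator {0..t} v * (\<pi> y * total_rate y * prob_jumps n v y) \<partial>lborel)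
        = (\<integral>\<^sup>+v. indicator {0..t} v * (\<pi> y * total_rate y * (\<Sum>n. prob_jumps n v y)) \<partial>lborel)"
      by (subst nn_integral_suminf[symmetric]) (auto simp flip: ennreal_suminf_cmult)
    also have "\<dots> \<le> (\<integral>\<^sup>+v. \<pi> y * total_rate y * indicator {0..t} v \<partial>lborel)"
    proof (intro nn_integral_mono)
      fix v
      show "indicator {0..t} v * (\<pi> y * total_rate y * (\<Sum>n. prob_jumps n v y))
          \<le> \<pi> y * total_rate y * indicator {0..t} v"
      proof (cases "\<pi> y = 0 \<or> v \<notin> {0..t}")
        case False
        then have "\<pi> y * total_rate y * (\<Sum>n. prob_jumps n v y) \<le> \<pi> y * total_rate y * 1"
          using y by (intro mult_left_mono prob_jumps_sum_le_1) auto
        then show ?thesis using False by simp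
      qed auto
    qed
    also have "\<dots> = \<pi> y * total_rate y * ennreal t"
      using assms by (subst nn_integral_cmult_indicator) auto
    finally show "(\<Sum>n. \<integral>\<^sup>+v. indicator {0..t} v * (\<pi> y * total_rate y * prob_jumps n v y) \<partial>lborel) \<le> \<dots>" .
  qed
  also have "\<dots> = (\<integral>\<^sup>+y. \<pi> y * total_rate y \<partial>count_space S) * ennreal t"
    by (rule nn_integral_multc) simp
  also have "\<dots> < \<infinity>"
    using finite_mean_rate by (simp add: ennreal_mult_less_top)
  finally show ?thesis .
qed

text \<open>
  As the expected number of jumps before \<open>t\<close> is finite, the probability of at least \<open>n + 1\<close> jumps
  tends to zero.
\<close>

lemma no_explosion:
  assumes x: "x \<in> S" "\<pi> x \<noteq> 0" and t: "0 \<le> t"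
  shows "(\<Sum>n. prob_jumps n t x) = 1"
proof -
  have "\<pi> x * (\<Sum>n. prob_more_jumps n t x) \<le> (\<integral>\<^sup>+x. \<pi> x * (\<Sum>n. prob_more_jumps n t x) \<partial>count_space S)"
    using x(1) by (rule nn_integral_ge_point)
  then have "\<pi> x * (\<Sum>n. prob_more_jumps n t x) < \<infinity>"
    using mean_number_of_jumps_finite[OF t] by simp
  then have fin: "(\<Sum>n. prob_more_jumps n t x) \<noteq> \<infinity>"
    using x(2) by (auto simp: ennreal_mult_less_top)
  have "prob_more_jumps n t x \<noteq> \<infinity>" for n
    using fin ennreal_suminf_lessD[of "\<lambda>n. prob_more_jumps n t x" top n] by (simp add: less_top)
  then have jumps_real: "prob_more_jumps n t x = ennreal (enn2real (prob_more_jumps n t x))" for n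
    by (simp add: less_top)
  have "summable (\<lambda>n. enn2real (prob_more_jumps n t x))"
    using fin by (intro summable_suminf_not_top) (simp_all flip: jumps_real)
  from tendsto_ennrealI[OF summable_LIMSEQ_zero[OF this]]
  have "(\<lambda>n. prob_more_jumps n t x) \<longlonglongrightarrow> 0"
    by (simp flip: jumps_real)
  moreover have "(\<lambda>n. \<Sum>m\<le>n. prob_jumps m t x) \<longlonglongrightarrow> (\<Sum>n. prob_jumps n t x)"
    by (rule summable_LIMSEQ') simp
  ultimately have "(\<lambda>n. (\<Sum>m\<le>n. prob_jumps m t x) + prob_more_jumps n t x) \<longlonglongrightarrow> (\<Sum>n. prob_jumps n t x) + 0"
    by (intro tendsto_add)
  then have "(\<lambda>n. 1) \<longlonglongrightarrow> (\<Sum>n. prob_jumps n t x)"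
    unfolding prob_jumps_partial_sum[OF x t] by simp
  then show ?thesis
    by (simp add: LIMSEQ_const_iff)
qed

lemma ctmc_trans_balance:
  assumes "x \<in> S" "y \<in> S"
  shows "\<pi> x * ctmc_trans S k t x y = \<pi> y * ctmc_trans S k t y x"
  unfolding ctmc_trans_def ennreal_suminf_cmult[symmetric] using T_balance[OF assms] by simp

text \<open>
  By reversibility the mass flowing into \<open>y\<close> is \<open>\<pi> y\<close> times the total mass of the chain started in
  \<open>y\<close>.
\<close>

lemma ctmc_trans_invariant:
  assumes "y \<in> S" "0 \<le> t"
  shows "(\<Sum>\<^sub>\<infinity>x\<in>S. \<pi> x * ctmc_trans S k t x y) = \<pi> y"
proof -
  have "(\<Sum>\<^sub>\<infinity>x\<in>S. \<pi> x * ctmc_trans S k t x y) = (\<integral>\<^sup>+x. \<pi> x * ctmc_trans S k t x y \<partial>count_space S)"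
    by (rule infsum_eq_nn_integral_count_space[OF countable_S])
  also have "\<dots> = (\<integral>\<^sup>+x. \<pi> y * (\<Sum>n. T n t y x) \<partial>count_space S)"
    using ctmc_trans_balance[OF _ assms(1), of _ t]
    by (intro nn_integral_cong) (simp add: ctmc_trans_def)
  also have "\<dots> = \<pi> y * (\<Sum>n. prob_jumps n t y)"
    by (simp add: nn_integral_cmult nn_integral_suminf prob_jumps_def)
  also have "\<dots> = \<pi> y"
    using no_explosion[OF assms(1) _ assms(2)] by (cases "\<pi> y = 0") auto
  finally show ?thesis .
qed

end

text \<open>
  The criterion through which the theorem is proved. Without the condition on the mean total rate
  only reversibility would follow.
\<close>

lemma reversible_stationary_if_mean_rate_finite:
  assumes S: "countable S" and \<pi>: "distribution_on S \<pi>"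
    and "\<And>x y. x \<in> S \<Longrightarrow> y \<in> S \<Longrightarrow> x \<noteq> y \<Longrightarrow> emeasure \<pi> {x} * k x y = emeasure \<pi> {y} * k y x"
    and rate: "(\<integral>\<^sup>+x. emeasure \<pi> {x} * (\<Sum>\<^sub>\<infinity>y\<in>S - {x}. k x y) \<partial>count_space S) < \<infinity>"
  shows "stationary_distribution S k \<pi>" "reversible_distribution S k \<pi>"
proof -
  interpret countable_chain S k
    using S by unfold_locales
  interpret reversible_chain S k "\<lambda>x. emeasure \<pi> {x}"
    using assms sum_off_diagonal[of _ "\<lambda>_. 1"] by unfold_locales (simp_all add: total_rate_def)
  show "stationary_distribution S k \<pi>" "reversible_distribution S k \<pi>"
    using \<pi> by (auto simp: stationary_distribution_def reversible_distribution_def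
        ctmc_trans_invariant intro: ctmc_trans_balance)
qed


section \<open>Bounds on the rates\<close>

lemma infsum_ennreal:
  fixes f :: "'a \<Rightarrow> real"
  assumes "f summable_on A" "\<And>x. x \<in> A \<Longrightarrow> 0 \<le> f x"
  shows "infsum (\<lambda>x. ennreal (f x)) A = ennreal (infsum f A)"
proof -
  have "ennreal (infsum f A) = (SUP F\<in>{F. finite F \<and> F \<subseteq> A}. ennreal (sum f F))"
    using assms by (rule infsum_nonneg_is_SUPREMUM_ennreal)
  also have "\<dots> = (SUP F\<in>{F. finite F \<and> F \<subseteq> A}. \<Sum>x\<in>F. ennreal (f x))"
    using assms by (intro SUP_cong refl) (subst sum_ennreal, auto)
  also have "\<dots> = infsum (\<lambda>x. ennreal (f x)) A"
    by (rule nonneg_infsum_complete[symmetric]) simp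
  finally show ?thesis ..
qed

context blocking_system
begin

abbreviation I :: "int set" where "I \<equiv> int_interval wmin wmax"

lemma I_convex: "a \<in> I \<Longrightarrow> b \<in> I \<Longrightarrow> a \<le> z \<Longrightarrow> z \<le> b \<Longrightarrow> z \<in> I"
  by (cases wmin; cases wmax) (auto simp: int_interval_def)

lemma zero_in_I: "0 \<in> I" and one_in_I: "1 \<in> I"
  and zero_less_wmax: "Fin 0 \<noteq> wmax" and wmin_less_one: "Fin 1 \<noteq> wmin"
  using site_values by (cases wmin; cases wmax; simp add: int_interval_def)+

lemma pred_in_I: "z \<in> I \<Longrightarrow> Fin z \<noteq> wmin \<Longrightarrow> z - 1 \<in> I" "z \<in> I \<Longrightarrow> Fin (z - 1) \<noteq> wmax"
  by (cases wmin; cases wmax; auto simp: int_interval_def)+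

lemma succ_in_I: "z \<in> I \<Longrightarrow> Fin z \<noteq> wmax \<Longrightarrow> z + 1 \<in> I" "z \<in> I \<Longrightarrow> Fin (z + 1) \<noteq> wmin"
  by (cases wmin; cases wmax; auto simp: int_interval_def)+

lemma above_min: "y \<in> I \<Longrightarrow> y < z \<Longrightarrow> Fin z \<noteq> wmin"
  by (cases wmin) (auto simp: int_interval_def)

lemma p_pos: "p > 0"
  using asymmetry by simp

lemma q_pos: "q > 0"
  using Q_nonzero[of 0 1] Q_eq[of 0 1] zero_in_I one_in_I zero_less_wmax wmin_less_one asymmetry
  by (cases "q = 0") auto

lemma q_less_p: "q < p"
  using asymmetry by simp

lemma f_pos: "z \<in> I \<Longrightarrow> Fin z \<noteq> wmin \<Longrightarrow> f z > 0"
  using P_nonzero[of z 0] P_eq[of z 0] zero_in_I zero_less_wmax f_nonneg[of z]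
  by (cases "f z = 0") auto

lemma f_one_pos: "f 1 > 0"
  using f_pos one_in_I wmin_less_one by blast

lemma s_pos:
  assumes "a \<in> I" "Fin a \<noteq> wmin" "b \<in> I" "Fin b \<noteq> wmin"
  shows "s a b > 0"
proof -
  have "s a b \<noteq> 0"
    using P_nonzero[of a "b - 1"] P_eq[of a "b - 1"] pred_in_I[of b] assms by auto
  then show ?thesis
    using s_nonneg[of a b] assms by simp
qed

text \<open>
  Attractivity in terms of \<open>s\<close> and \<open>f\<close>. The index of \<open>s\<close> is shifted by one against the rates,
  so the states \<open>a\<close> and \<open>b\<close> range over the values above the minimum.
\<close>

lemma s_step:
  assumes "a \<in> I" "Fin a \<noteq> wmin" "a + 1 \<in> I" "b \<in> I" "Fin b \<noteq> wmin"
  shows "s a b * f a \<le> s (a + 1) b * f (a + 1)" "s b a * f a \<le> s b (a + 1) * f (a + 1)"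
    "s (a + 1) b \<le> s a b" "s b (a + 1) \<le> s b a"
proof -
  have "p * (s a b * f a) \<le> p * (s (a + 1) b * f (a + 1))"
    using bulk_attractive[of "b - 1" a] P_eq[of a "b - 1"] P_eq[of "a + 1" "b - 1"] pred_in_I[of b] assms
    by (simp add: mult.assoc)
  then show "s a b * f a \<le> s (a + 1) b * f (a + 1)"
    using p_pos by simp
  have "q * (s b a * f a) \<le> q * (s b (a + 1) * f (a + 1))"
    using bulk_attractive[of "b - 1" a] Q_eq[of "b - 1" a] Q_eq[of "b - 1" "a + 1"] pred_in_I[of b] assms
    by (simp add: mult.assoc)
  then show "s b a * f a \<le> s b (a + 1) * f (a + 1)"
    using q_pos by simp
  have "(q * f b) * s (a + 1) b \<le> (q * f b) * s a b"
    using bulk_attractive[of b "a - 1"] Q_eq[of "a - 1" b] Q_eq[of a b] pred_in_I[of a] assms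
    by (simp add: mult_ac)
  then show "s (a + 1) b \<le> s a b"
    using q_pos f_pos[of b] assms by simp
  have "(p * f b) * s b (a + 1) \<le> (p * f b) * s b a"
    using bulk_attractive[of b "a - 1"] P_eq[of b "a - 1"] P_eq[of b a] pred_in_I[of a] assms
    by (simp add: mult_ac)
  then show "s b (a + 1) \<le> s b a"
    using p_pos f_pos[of b] assms by simp
qed

text \<open>
  Monotonicity on the single-site values above the minimum follows from monotonicity in unit steps.
\<close>

lemma I_mono_induct:
  fixes g :: "int \<Rightarrow> real"
  assumes "\<And>a. a \<in> I \<Longrightarrow> Fin a \<noteq> wmin \<Longrightarrow> a + 1 \<in> I \<Longrightarrow> g a \<le> g (a + 1)"
    and a: "a \<in> I" "Fin a \<noteq> wmin" and "b \<in> I" "a \<le> b"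
  shows "g a \<le> g b"
proof -
  have "b \<in> I \<longrightarrow> g a \<le> g b"
    using \<open>a \<le> b\<close>
  proof (induction b rule: int_ge_induct)
    case (step i)
    show ?case
    proof
      assume i: "i + 1 \<in> I"
      then have "i \<in> I"
        using I_convex[of a "i + 1" i] a step by simp
      moreover have "Fin i \<noteq> wmin"
        using above_min[of a i] a step by (cases "a = i") auto
      ultimately show "g a \<le> g (i + 1)"
        using assms(1)[of i] i step by simp
    qed
  qed simp
  then show ?thesis using assms by simp
qed

lemma s_mono:
  assumes "a \<in> I" "Fin a \<noteq> wmin" "a' \<in> I" "a \<le> a'" "b \<in> I" "Fin b \<noteq> wmin"
  shows "s a b * f a \<le> s a' b * f a'" "s b a * f a \<le> s b a' * f a'"
    "s a' b \<le> s a b" "s b a' \<le> s b a"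
proof -
  show "s a b * f a \<le> s a' b * f a'"
    by (rule I_mono_induct[of "\<lambda>a. s a b * f a"]) (use assms s_step in auto)
  show "s b a * f a \<le> s b a' * f a'"
    by (rule I_mono_induct[of "\<lambda>a. s b a * f a"]) (use assms s_step in auto)
  have "- s a b \<le> - s a' b"
    by (rule I_mono_induct[of "\<lambda>a. - s a b"]) (use assms s_step in auto)
  then show "s a' b \<le> s a b" by simp
  have "- s b a \<le> - s b a'"
    by (rule I_mono_induct[of "\<lambda>a. - s b a"]) (use assms s_step in auto)
  then show "s b a' \<le> s b a" by simp
qed

text \<open>
  Compare \<open>s a 1 * f a\<close>, which increases with \<open>a\<close>, and \<open>s a 1\<close>, which decreases with \<open>a\<close>: the increase
  must come from \<open>f\<close>.
\<close>

lemma f_mono: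
  assumes "a \<in> I" "b \<in> I" "a \<le> b"
  shows "f a \<le> f b"
proof (cases "Fin a = wmin")
  case True
  then show ?thesis
    using f_zero_min[of a] f_nonneg[OF assms(2)] by simp
next
  case False
  then have b: "Fin b \<noteq> wmin"
    using above_min[OF assms(1), of b] assms(3) by (cases "a = b") auto
  have "s a 1 * f a \<le> s b 1 * f b"
    using s_mono(1)[of a b 1] assms False one_in_I wmin_less_one by simp
  also have "\<dots> \<le> s a 1 * f b"
    using s_mono(3)[of a b 1] assms False one_in_I wmin_less_one f_nonneg
    by (intro mult_right_mono) auto
  finally show ?thesis
    using s_pos[of a 1] assms False one_in_I wmin_less_one by simp
qed

text \<open>
  The growth of \<open>s\<close> in one argument, normalised to be one at the value \<open>1\<close>, which is always a
  single-site value above the minimum.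
\<close>

definition s_factor :: "int \<Rightarrow> real" where
  "s_factor a = max 1 (f 1 / f a)"

text \<open>
  To the right of \<open>1\<close> the function \<open>s\<close> decreases; to the left of \<open>1\<close> the product of \<open>s\<close> and \<open>f\<close> increases, so that \<open>s\<close>
  grows at most like \<open>1 / f\<close>. This holds in both arguments, one after the other.
\<close>

lemma s_le:
  assumes "a \<in> I" "Fin a \<noteq> wmin" "b \<in> I" "Fin b \<noteq> wmin"
  shows "s a b \<le> s 1 1 * (s_factor a * s_factor b)"
proof -
  note one = one_in_I wmin_less_one
  have m1: "1 \<le> s_factor x" "f 1 / f x \<le> s_factor x" for x
    by (auto simp: s_factor_def)
  have left: "s x y \<le> s 1 y * s_factor x" if "x \<in> I" "Fin x \<noteq> wmin" "y \<in> I" "Fin y \<noteq> wmin" for x y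
  proof (cases "1 \<le> x")
    case True
    then have "s x y \<le> s 1 y * 1"
      using s_mono(3)[of 1 x y] that one by simp
    also have "\<dots> \<le> s 1 y * s_factor x"
      using m1 s_pos[of 1 y] that one by (intro mult_left_mono) auto
    finally show ?thesis .
  next
    case False
    then have "s x y \<le> s 1 y * (f 1 / f x)"
      using s_mono(1)[of x 1 y] that one f_pos[of x] by (simp add: field_simps)
    also have "\<dots> \<le> s 1 y * s_factor x"
      using m1 s_pos[of 1 y] that one by (intro mult_left_mono) auto
    finally show ?thesis .
  qed
  have right: "s 1 y \<le> s 1 1 * s_factor y" if "y \<in> I" "Fin y \<noteq> wmin" for y
  proof (cases "1 \<le> y")
    case True
    then have "s 1 y \<le> s 1 1 * 1"
      using s_mono(4)[of 1 y 1] that one by simp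
    also have "\<dots> \<le> s 1 1 * s_factor y"
      using m1 s_pos[of 1 1] that one by (intro mult_left_mono) auto
    finally show ?thesis .
  next
    case False
    then have "s 1 y \<le> s 1 1 * (f 1 / f y)"
      using s_mono(2)[of y 1 1] that one f_pos[of y] by (simp add: field_simps)
    also have "\<dots> \<le> s 1 1 * s_factor y"
      using m1 s_pos[of 1 1] that one by (intro mult_left_mono) auto
    finally show ?thesis .
  qed
  have "s a b \<le> s 1 b * s_factor a" using left assms by blast
  also have "\<dots> \<le> s 1 1 * s_factor b * s_factor a"
    using right[of b] assms m1[of a] by (intro mult_right_mono) auto
  finally show ?thesis by (simp add: mult_ac)
qed

text \<open>
  Up to constants, \<open>removal z\<close> bounds the rate at which a site with value \<open>z\<close> loses a particle, and
  \<open>insertion z\<close> the rate at which it gains one. They vanish at the minimum and at the maximum,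
  respectively.
\<close>

definition removal :: "int \<Rightarrow> real" where
  "removal y = (if Fin y = wmin then 0 else max (f y) (f 1))"

definition insertion :: "int \<Rightarrow> real" where
  "insertion y = (if Fin y = wmax then 0 else max 1 (f 1 / f (y + 1)))"

lemma removal_nonneg: "y \<in> I \<Longrightarrow> 0 \<le> removal y"
  using f_one_pos by (auto simp: removal_def)

lemma insertion_nonneg: "0 \<le> insertion y"
  by (auto simp: insertion_def)

lemma s_factor_f_eq_removal: "y \<in> I \<Longrightarrow> Fin y \<noteq> wmin \<Longrightarrow> s_factor y * f y = removal y"
  using f_pos[of y] by (auto simp: s_factor_def removal_def max_def field_simps)

lemma s_factor_eq_insertion: "Fin y \<noteq> wmax \<Longrightarrow> s_factor (y + 1) = insertion y"
  by (simp add: s_factor_def insertion_def)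

lemma bulk_rate_le:
  assumes "y \<in> I" "z \<in> I"
  shows "P y z \<le> s 1 1 * (removal y * insertion z)" "Q y z \<le> s 1 1 * (insertion y * removal z)"
proof -
  have s11: "0 < s 1 1"
    using s_pos one_in_I wmin_less_one by simp
  have rhs: "0 \<le> s 1 1 * (removal y * insertion z)" "0 \<le> s 1 1 * (insertion y * removal z)"
    using s11 assms by (auto intro!: mult_nonneg_nonneg removal_nonneg insertion_nonneg)
  show "P y z \<le> s 1 1 * (removal y * insertion z)"
  proof (cases "Fin y = wmin \<or> Fin z = wmax")
    case True
    then have "P y z = 0"
      using bulk_zero_min[of y z] bulk_zero_max[of z y] assms by auto
    then show ?thesis using rhs by simp
  next
    case False
    then have "s y (z + 1) \<le> s 1 1 * (s_factor y * insertion z)"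
      using s_le[of y "z + 1"] succ_in_I[of z] assms s_factor_eq_insertion[of z] by simp
    moreover have "0 \<le> s y (z + 1)"
      using s_pos[of y "z + 1"] succ_in_I[of z] assms False by simp
    ultimately have "p * s y (z + 1) * f y \<le> 1 * (s 1 1 * (s_factor y * insertion z)) * f y"
      using asymmetry p_pos f_nonneg assms by (intro mult_right_mono mult_mono) auto
    also have "\<dots> = s 1 1 * (removal y * insertion z)"
      using s_factor_f_eq_removal[of y] assms False by (simp add: mult_ac)
    finally show ?thesis
      using P_eq assms by simp
  qed
  show "Q y z \<le> s 1 1 * (insertion y * removal z)"
  proof (cases "Fin z = wmin \<or> Fin y = wmax")
    case True
    then have "Q y z = 0"
      using bulk_zero_min[of z y] bulk_zero_max[of y z] assms by auto
    then show ?thesis using rhs by simp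
  next
    case False
    then have "s (y + 1) z \<le> s 1 1 * (insertion y * s_factor z)"
      using s_le[of "y + 1" z] succ_in_I[of y] assms s_factor_eq_insertion[of y] by simp
    moreover have "0 \<le> s (y + 1) z"
      using s_pos[of "y + 1" z] succ_in_I[of y] assms False by simp
    ultimately have "q * s (y + 1) z * f z \<le> 1 * (s 1 1 * (insertion y * s_factor z)) * f z"
      using asymmetry q_pos f_nonneg assms by (intro mult_right_mono mult_mono) auto
    also have "\<dots> = s 1 1 * (insertion y * removal z)"
      using s_factor_f_eq_removal[of z] assms False by (simp add: mult_ac)
    finally show ?thesis
      using Q_eq assms by simp
  qed
qed

text \<open>
  Boundary rates satisfy bounds of the same form as the bulk rates. Here \<open>\<alpha>\<close> is the rate of adding a
  particle from the reservoir and \<open>\<beta>\<close> the rate of removing one. On one side of the origin the bound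
  is monotonicity of the rate itself, on the other side it is monotonicity of the opposite
  rate, transported by the balance relation.
\<close>

lemma reservoir_rate_le:
  fixes \<alpha> \<beta> :: "int \<Rightarrow> real" and \<theta> :: real
  assumes nonneg: "\<And>z. z \<in> I \<Longrightarrow> 0 \<le> \<alpha> z"
    and zero: "\<And>z. Fin z = wmin \<Longrightarrow> \<beta> z = 0" "\<And>z. Fin z = wmax \<Longrightarrow> \<alpha> z = 0"
    and mono: "\<And>z. z \<in> I \<Longrightarrow> z + 1 \<in> I \<Longrightarrow> \<alpha> (z + 1) \<le> \<alpha> z"
      "\<And>z. z \<in> I \<Longrightarrow> z + 1 \<in> I \<Longrightarrow> \<beta> z \<le> \<beta> (z + 1)"
    and balance: "\<And>z. z \<in> I \<Longrightarrow> Fin z \<noteq> wmax \<Longrightarrow> \<beta> (z + 1) = \<alpha> z * f (z + 1) / exp \<theta>"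
    and z: "z \<in> I"
  shows "\<alpha> z \<le> \<alpha> 0 * insertion z" "\<beta> z \<le> \<alpha> 0 / exp \<theta> * removal z"
proof -
  have \<beta>_le: "\<beta> a \<le> \<beta> b" if "a \<in> I" "Fin a \<noteq> wmin" "b \<in> I" "a \<le> b" for a b
    by (rule I_mono_induct) (use that mono in auto)
  have \<alpha>_le: "\<alpha> b \<le> \<alpha> a" if "a \<in> I" "Fin a \<noteq> wmin" "b \<in> I" "a \<le> b" for a b
    using I_mono_induct[of "\<lambda>a. - \<alpha> a"] that mono by simp
  have \<alpha>_0: "\<alpha> b \<le> \<alpha> 0" if "b \<in> I" "0 \<le> b" for b
  proof (cases "b = 0")
    case False
    then have "\<alpha> b \<le> \<alpha> 1"
      using \<alpha>_le[of 1 b] that one_in_I wmin_less_one by simp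
    also have "\<dots> \<le> \<alpha> 0"
      using mono(1)[of 0] zero_in_I one_in_I by simp
    finally show ?thesis .
  qed simp
  have \<beta>_1: "\<beta> 1 = \<alpha> 0 * f 1 / exp \<theta>"
    using balance[of 0] zero_in_I zero_less_wmax by simp
  show "\<alpha> z \<le> \<alpha> 0 * insertion z"
  proof (cases "Fin z = wmax")
    case True
    then show ?thesis using zero by (simp add: insertion_def)
  next
    case zmax: False
    have z1: "z + 1 \<in> I" "Fin (z + 1) \<noteq> wmin" using succ_in_I[of z] z zmax by auto
    show ?thesis
    proof (cases "0 \<le> z")
      case True
      then have "\<alpha> z \<le> \<alpha> 0 * 1" using \<alpha>_0 z by simp
      also have "\<dots> \<le> \<alpha> 0 * insertion z"
        using zmax nonneg zero_in_I by (intro mult_left_mono) (auto simp: insertion_def)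
      finally show ?thesis .
    next
      case False
      then have "\<beta> (z + 1) \<le> \<beta> 1"
        using \<beta>_le[of "z + 1" 1] z1 one_in_I by simp
      then have "\<alpha> z * f (z + 1) \<le> \<alpha> 0 * f 1"
        using balance[of z] z zmax \<beta>_1 by (simp add: divide_le_cancel)
      then have "\<alpha> z \<le> \<alpha> 0 * (f 1 / f (z + 1))"
        using f_pos[OF z1] by (simp add: field_simps)
      also have "\<dots> \<le> \<alpha> 0 * insertion z"
        using zmax nonneg zero_in_I by (intro mult_left_mono) (auto simp: insertion_def)
      finally show ?thesis .
    qed
  qed
  show "\<beta> z \<le> \<alpha> 0 / exp \<theta> * removal z"
  proof (cases "Fin z = wmin")
    case True
    then show ?thesis using zero by (simp add: removal_def)
  next
    case zmin: False
    show ?thesis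
    proof (cases "1 \<le> z")
      case True
      have "\<beta> z = \<alpha> (z - 1) * f z / exp \<theta>"
        using balance[of "z - 1"] pred_in_I[of z] z zmin by simp
      also have "\<dots> \<le> \<alpha> 0 * removal z / exp \<theta>"
        using \<alpha>_0[of "z - 1"] pred_in_I[of z] z zmin True f_nonneg[of z] nonneg[of 0] zero_in_I
        by (intro divide_right_mono mult_mono) (auto simp: removal_def)
      finally show ?thesis by simp
    next
      case False
      then have "\<beta> z \<le> \<alpha> 0 * f 1 / exp \<theta>"
        using \<beta>_le[of z 1] z zmin one_in_I \<beta>_1 by simp
      also have "\<dots> \<le> \<alpha> 0 * removal z / exp \<theta>"
        using zmin nonneg[of 0] zero_in_I
        by (intro divide_right_mono mult_left_mono) (auto simp: removal_def)
      finally show ?thesis by simp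
    qed
  qed
qed

section \<open>Single-site marginals\<close>

definition weight :: "real \<Rightarrow> int \<Rightarrow> real" where
  "weight \<theta> z = exp (\<theta> * of_int z) / gen_fact f z"

lemma gen_fact_pos:
  assumes "z \<in> I"
  shows "gen_fact f z > 0"
proof -
  have "0 < (\<Prod>y\<in>{1..z}. f y)"
  proof (intro prod_pos ballI f_pos)
    fix y assume "y \<in> {1..z}"
    then show "y \<in> I" "Fin y \<noteq> wmin"
      using I_convex[OF zero_in_I assms, of y] above_min[OF zero_in_I, of y] by auto
  qed
  moreover have "0 < (\<Prod>y\<in>{z + 1..0}. f y)"
  proof (intro prod_pos ballI f_pos)
    fix y assume "y \<in> {z + 1..0}"
    then show "y \<in> I" "Fin y \<noteq> wmin"
      using I_convex[OF assms zero_in_I, of y] above_min[OF assms, of y] by auto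
  qed
  ultimately show ?thesis
    by (simp add: gen_fact_def)
qed

lemma gen_fact_rec:
  assumes "f z \<noteq> 0"
  shows "gen_fact f z = f z * gen_fact f (z - 1)"
proof (cases "z \<ge> 1")
  case True
  then have "{1..z} = insert z {1..z - 1}" by auto
  then show ?thesis using True by (simp add: gen_fact_def)
next
  case False
  then have "{z..0} = insert z {z + 1..0}" by auto
  then show ?thesis using False assms by (auto simp: gen_fact_def)
qed

lemma weight_pos: "z \<in> I \<Longrightarrow> weight \<theta> z > 0"
  using gen_fact_pos by (simp add: weight_def)

text \<open>
  The identity behind detailed balance.
\<close>

lemma weight_rec:
  assumes "z \<in> I" "Fin z \<noteq> wmin"
  shows "weight \<theta> z * f z = exp \<theta> * weight \<theta> (z - 1)"
  using gen_fact_rec[of z] f_pos[OF assms]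
  by (simp add: weight_def exp_diff algebra_simps)

text \<open>
  As \<open>f\<close> is monotone, the limit defining \<open>theta_max\<close> is a supremum.
\<close>

lemma exists_f_greater:
  assumes "wmax = Pinf" "ereal \<theta> < theta_max wmax f"
  obtains z where "1 \<le> z" "exp \<theta> < f z"
proof -
  let ?g = "\<lambda>z. ereal (ln (f z))" and ?l = "SUP z\<in>{1..}. ereal (ln (f z))"
  have inI: "z \<in> I" "Fin z \<noteq> wmin" if "1 \<le> z" for z
    using that site_values assms(1) above_min[OF zero_in_I, of z]
    by (cases wmin; auto simp: int_interval_def)+
  have "(?g \<longlongrightarrow> ?l) at_top"
  proof (rule increasing_tendsto)
    show "\<forall>\<^sub>F z in at_top. ?g z \<le> ?l"
      using eventually_ge_at_top[of "1::int"] by eventually_elim (auto intro: SUP_upper)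
    fix x assume "x < ?l"
    then obtain z where z: "1 \<le> z" "x < ?g z" by (auto simp: less_SUP_iff)
    have "x < ?g y" if "z \<le> y" for y
    proof -
      have "ln (f z) \<le> ln (f y)"
        using f_mono[of z y] f_pos[of z] inI z that by (intro ln_mono) auto
      then show ?thesis using z(2) by (meson ereal_less_eq(3) less_le_trans)
    qed
    then show "\<forall>\<^sub>F y in at_top. x < ?g y"
      by (rule eventually_mono[OF eventually_ge_at_top])
  qed
  then have "theta_max wmax f = ?l"
    using assms(1) by (simp add: theta_max_def tendsto_Lim)
  then obtain z where z: "1 \<le> z" "\<theta> < ln (f z)"
    using assms(2) by (auto simp: less_SUP_iff)
  then have "exp \<theta> < exp (ln (f z))" by simp
  then show ?thesis
    using that[of z] z f_pos inI by simp
qed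

text \<open>
  As \<open>f\<close> is monotone, the limit defining \<open>theta_min\<close> is an infimum.
\<close>

lemma exists_f_less:
  assumes "wmin = Minf" "theta_min wmin f < ereal \<theta>"
  obtains z where "z \<le> 0" "f z < exp \<theta>"
proof -
  let ?g = "\<lambda>z. ereal (ln (f z))" and ?l = "INF z\<in>{..0}. ereal (ln (f z))"
  have inI: "z \<in> I" "Fin z \<noteq> wmin" if "z \<le> 0" for z
    using that site_values assms(1)
    by (cases wmax; auto simp: int_interval_def)+
  have "(?g \<longlongrightarrow> ?l) at_bot"
  proof (rule decreasing_tendsto)
    show "\<forall>\<^sub>F z in at_bot. ?l \<le> ?g z"
      using eventually_le_at_bot[of "0::int"] by eventually_elim (auto intro: INF_lower)
    fix x assume "?l < x"
    then obtain z where z: "z \<le> 0" "?g z < x" by (auto simp: INF_less_iff)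
    have "?g y < x" if "y \<le> z" for y
    proof -
      have "ln (f y) \<le> ln (f z)"
        using f_mono[of y z] f_pos[of y] inI z that by (intro ln_mono) auto
      then show ?thesis using z(2) by (meson ereal_less_eq(3) le_less_trans)
    qed
    then show "\<forall>\<^sub>F y in at_bot. ?g y < x"
      by (rule eventually_mono[OF eventually_le_at_bot])
  qed
  then have "theta_min wmin f = ?l"
    using assms(1) by (simp add: theta_min_def tendsto_Lim trivial_limit_at_bot_linorder)
  then obtain z where z: "z \<le> 0" "ln (f z) < \<theta>"
    using assms(2) by (auto simp: INF_less_iff)
  then have "exp (ln (f z)) < exp \<theta>" by simp
  then show ?thesis
    using that[of z] z f_pos inI by simp
qed

text \<open>
  The ratio test: consecutive weights have ratio \<open>exp \<theta> / f (z + 1)\<close>, which is eventually bounded by a constant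
  below one since \<open>\<theta>\<close> is below \<open>theta_max\<close>.
\<close>

lemma weight_summable_right:
  assumes "ereal \<theta> < theta_max wmax f"
  shows "weight \<theta> summable_on (I \<inter> {0..})"
proof (cases wmax)
  case (Fin M)
  then have "I \<inter> {0..} \<subseteq> {0..M}" by (auto simp: int_interval_def)
  then show ?thesis by (intro summable_on_finite) (rule finite_subset, auto)
next
  case Minf
  then show ?thesis using site_values by simp
next
  case Pinf
  then obtain z0 where z0: "1 \<le> z0" "exp \<theta> < f z0"
    using exists_f_greater assms by blast
  have inI: "z \<in> I" if "0 \<le> z" for z
    using that site_values Pinf by (cases wmin; auto simp: int_interval_def)
  have "summable (\<lambda>n. weight \<theta> (int n))"
  proof (rule summable_ratio_test)
    show "exp \<theta> / f z0 < 1"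
      using z0 less_trans[OF exp_gt_zero z0(2)] by simp
    fix n assume n: "nat z0 \<le> n"
    let ?z = "int (Suc n)"
    have fz: "f z0 \<le> f ?z" "0 < f z0"
      using n z0 by (auto intro!: f_mono inI f_pos above_min[OF zero_in_I])
    have z: "?z \<in> I" "Fin ?z \<noteq> wmin"
      using inI above_min[OF zero_in_I, of ?z] by auto
    have "weight \<theta> ?z = exp \<theta> / f ?z * weight \<theta> (int n)"
      using weight_rec[OF z, of \<theta>] fz by (simp add: field_simps)
    also have "\<dots> \<le> exp \<theta> / f z0 * weight \<theta> (int n)"
      using fz weight_pos[of "int n" \<theta>] inI[of "int n"]
      by (intro mult_right_mono divide_left_mono) auto
    finally show "norm (weight \<theta> ?z) \<le> exp \<theta> / f z0 * norm (weight \<theta> (int n))"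
      using weight_pos[of "int n" \<theta>] weight_pos[of ?z \<theta>] inI by simp
  qed
  then have "(weight \<theta> \<circ> int) summable_on UNIV"
    using weight_pos[of _ \<theta>] inI by (intro summable_nonneg_imp_summable_on) (auto simp: less_imp_le comp_def)
  then have "weight \<theta> summable_on range int"
    by (subst summable_on_reindex) auto
  moreover have "range int = I \<inter> {0..}"
    using inI by (auto simp: image_iff intro: zero_le_imp_eq_int)
  ultimately show ?thesis by simp
qed

text \<open>
  The ratio test in the opposite direction: for decreasing \<open>z\<close> the ratio of consecutive weights is
  \<open>f z / exp \<theta>\<close>, and \<open>\<theta>\<close> is above \<open>theta_min\<close>.
\<close>

lemma weight_summable_left:
  assumes "theta_min wmin f < ereal \<theta>"
  shows "weight \<theta> summable_on (I \<inter> {..0})"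
proof (cases wmin)
  case (Fin M)
  then have "I \<inter> {..0} \<subseteq> {M..0}" by (auto simp: int_interval_def)
  then show ?thesis by (intro summable_on_finite) (rule finite_subset, auto)
next
  case Pinf
  then show ?thesis using site_values by simp
next
  case Minf
  then obtain z0 where z0: "z0 \<le> 0" "f z0 < exp \<theta>"
    using exists_f_less assms by blast
  have inI: "z \<in> I" if "z \<le> 0" for z
    using that site_values Minf by (cases wmax; auto simp: int_interval_def)
  have "summable (\<lambda>n. weight \<theta> (- int n))"
  proof (rule summable_ratio_test)
    show "f z0 / exp \<theta> < 1" using z0 by (simp add: field_simps)
    fix n assume n: "nat (- z0) \<le> n"
    let ?z = "- int n"
    have fz: "f ?z \<le> f z0"
      using n z0 by (auto intro!: f_mono inI)
    have z: "?z \<in> I" "Fin ?z \<noteq> wmin"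
      using inI Minf by auto
    have "- int (Suc n) = ?z - 1" by simp
    then have "weight \<theta> (- int (Suc n)) = f ?z / exp \<theta> * weight \<theta> ?z"
      using weight_rec[OF z, of \<theta>] by (simp only:) (simp add: field_simps)
    also have "\<dots> \<le> f z0 / exp \<theta> * weight \<theta> ?z"
      using fz weight_pos[of ?z \<theta>] inI[of ?z]
      by (intro mult_right_mono divide_right_mono) auto
    finally show "norm (weight \<theta> (- int (Suc n))) \<le> f z0 / exp \<theta> * norm (weight \<theta> ?z)"
      using weight_pos[of ?z \<theta>] weight_pos[of "- int (Suc n)" \<theta>] inI by simp
  qed
  then have "(weight \<theta> \<circ> (\<lambda>n. - int n)) summable_on UNIV"
    using weight_pos[of _ \<theta>] inI by (intro summable_nonneg_imp_summable_on) (auto simp: less_imp_le comp_def)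
  then have "weight \<theta> summable_on range (\<lambda>n. - int n)"
    by (subst summable_on_reindex) (auto simp: inj_on_def)
  moreover have "range (\<lambda>n. - int n) = I \<inter> {..0}"
    using inI by (auto simp: image_iff) (metis add.inverse_inverse neg_0_le_iff_le zero_le_imp_eq_int)
  ultimately show ?thesis by simp
qed

definition mean_removal :: "real \<Rightarrow> ennreal" where
  "mean_removal \<theta> = (\<integral>\<^sup>+z. ennreal (removal z) \<partial>marginal wmin wmax f \<theta>)"

definition mean_insertion :: "real \<Rightarrow> ennreal" where
  "mean_insertion \<theta> = (\<integral>\<^sup>+z. ennreal (insertion z) \<partial>marginal wmin wmax f \<theta>)"

end

locale site = blocking_system +
  fixes \<theta> :: real
  assumes theta: "theta_min wmin f < ereal \<theta>" "ereal \<theta> < theta_max wmax f"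
begin

abbreviation Z :: real where "Z \<equiv> partition_fun wmin wmax f \<theta>"
abbreviation \<mu> :: "int measure" where "\<mu> \<equiv> marginal wmin wmax f \<theta>"

lemma weight_summable: "weight \<theta> summable_on I"
proof -
  have "weight \<theta> summable_on (I \<inter> {0..}) \<union> ((I \<inter> {..0}) - {0})"
    using weight_summable_right weight_summable_left theta
    by (intro summable_on_Un_disjoint) (auto intro: summable_on_subset_banach)
  moreover have "I \<inter> {0..} \<union> ((I \<inter> {..0}) - {0}) = I" by auto
  ultimately show ?thesis by simp
qed

lemma Z_eq: "Z = infsum (weight \<theta>) I"
  unfolding partition_fun_def weight_def[abs_def] ..

lemma Z_pos: "Z > 0"
proof -
  have "sum (weight \<theta>) {0} \<le> Z"
    unfolding Z_eq
    using weight_summable zero_in_I weight_pos[of _ \<theta>]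
    by (intro finite_sum_le_infsum) (auto simp: less_imp_le)
  then show ?thesis
    using weight_pos[OF zero_in_I, of \<theta>] by simp
qed

lemma \<mu>_eq: "\<mu> = density (count_space I) (\<lambda>z. ennreal (weight \<theta> z / Z))"
  by (simp add: marginal_def weight_def mult.commute)

lemma space_\<mu> [simp]: "space \<mu> = I" and sets_\<mu> [simp]: "sets \<mu> = Pow I"
  by (simp_all add: \<mu>_eq)

lemma nn_integral_\<mu>: "(\<integral>\<^sup>+z. g z \<partial>\<mu>) = (\<integral>\<^sup>+z. ennreal (weight \<theta> z / Z) * g z \<partial>count_space I)"
  unfolding \<mu>_eq by (rule nn_integral_density) auto

lemma emeasure_\<mu>_singleton: "z \<in> I \<Longrightarrow> emeasure \<mu> {z} = ennreal (weight \<theta> z / Z)"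
  unfolding \<mu>_eq by (subst emeasure_density) (auto simp: nn_integral_count_space_indicator[symmetric]
      nn_integral_count_space' nn_integral_count_space'[of "{z}"])

lemma prob_space_\<mu>: "prob_space \<mu>"
proof
  have "emeasure \<mu> (space \<mu>) = (\<integral>\<^sup>+z. ennreal (weight \<theta> z / Z) \<partial>count_space I)"
    using nn_integral_\<mu>[of "\<lambda>_. 1"] by simp
  also have "\<dots> = infsum (\<lambda>z. ennreal (weight \<theta> z / Z)) I"
    by (subst infsum_eq_nn_integral_count_space) auto
  also have "\<dots> = ennreal (infsum (\<lambda>z. weight \<theta> z / Z) I)"
    using weight_summable weight_pos[of _ \<theta>] Z_pos
    by (intro infsum_ennreal) (auto simp: less_imp_le divide_inverse intro: summable_on_cmult_left)
  also have "infsum (\<lambda>z. weight \<theta> z / Z) I = 1"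
    using Z_pos weight_summable by (simp add: Z_eq divide_inverse infsum_cmult_left)
  finally show "emeasure \<mu> (space \<mu>) = 1" by simp
qed

text \<open>
  The recursion for the weights shifts the sum by one; only a possible term at the maximum is lost,
  whence the inequality.
\<close>

lemma nn_integral_f_le: "(\<integral>\<^sup>+z. ennreal (f z) \<partial>\<mu>) \<le> ennreal (exp \<theta>)"
proof -
  let ?h = "\<lambda>z. ennreal (weight \<theta> z / Z) * indicator I z"
  have "(\<integral>\<^sup>+z. ennreal (f z) \<partial>\<mu>) = (\<integral>\<^sup>+z. ennreal (weight \<theta> z / Z) * ennreal (f z) * indicator I z \<partial>count_space UNIV)"
    by (simp add: nn_integral_\<mu> nn_integral_count_space_indicator)
  also have "\<dots> \<le> (\<integral>\<^sup>+z. ennreal (exp \<theta>) * ?h (z - 1) \<partial>count_space UNIV)"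
  proof (intro nn_integral_mono)
    fix z
    show "ennreal (weight \<theta> z / Z) * ennreal (f z) * indicator I z \<le> ennreal (exp \<theta>) * ?h (z - 1)"
    proof (cases "z \<in> I \<and> Fin z \<noteq> wmin")
      case True
      then have "weight \<theta> z / Z * f z = exp \<theta> * (weight \<theta> (z - 1) / Z)"
        using weight_rec[of z \<theta>] by simp
      then have "ennreal (weight \<theta> z / Z) * ennreal (f z) = ennreal (exp \<theta>) * ennreal (weight \<theta> (z - 1) / Z)"
        using True f_nonneg[of z] by (subst (1 2) ennreal_mult''[symmetric]) (use Z_pos weight_pos[of "z - 1" \<theta>] pred_in_I[of z] in \<open>auto simp: less_imp_le\<close>)
      then show ?thesis
        using True pred_in_I[of z] by simp
    qed (auto simp: f_zero_min)
  qed
  also have "\<dots> = ennreal (exp \<theta>) * (\<integral>\<^sup>+z. ?h (z - 1) \<partial>count_space UNIV)"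
    by (simp add: nn_integral_cmult)
  also have "(\<integral>\<^sup>+z. ?h (z - 1) \<partial>count_space UNIV) = (\<integral>\<^sup>+z. ?h z \<partial>count_space UNIV)"
    by (rule nn_integral_bij_count_space) (rule bij_betwI[where g = "\<lambda>z. z + 1"], auto)
  also have "\<dots> = emeasure \<mu> (space \<mu>)"
    using nn_integral_\<mu>[of "\<lambda>_. 1"] by (simp add: nn_integral_count_space_indicator)
  finally show ?thesis
    using prob_space.emeasure_space_1[OF prob_space_\<mu>] by simp
qed

lemma nn_integral_inverse_f_le:
  "(\<integral>\<^sup>+z. ennreal (if Fin z = wmax then 0 else 1 / f (z + 1)) \<partial>\<mu>) \<le> ennreal (exp (- \<theta>))"
proof -
  let ?h = "\<lambda>z. ennreal (weight \<theta> z / Z) * indicator I z"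
  let ?g = "\<lambda>z. if Fin z = wmax then 0 else 1 / f (z + 1)"
  have "(\<integral>\<^sup>+z. ennreal (?g z) \<partial>\<mu>) = (\<integral>\<^sup>+z. ennreal (weight \<theta> z / Z) * ennreal (?g z) * indicator I z \<partial>count_space UNIV)"
    by (simp add: nn_integral_\<mu> nn_integral_count_space_indicator)
  also have "\<dots> \<le> (\<integral>\<^sup>+z. ennreal (exp (- \<theta>)) * ?h (z + 1) \<partial>count_space UNIV)"
  proof (intro nn_integral_mono)
    fix z
    show "ennreal (weight \<theta> z / Z) * ennreal (?g z) * indicator I z \<le> ennreal (exp (- \<theta>)) * ?h (z + 1)"
    proof (cases "z \<in> I \<and> Fin z \<noteq> wmax")
      case True
      then have z1: "z + 1 \<in> I" "Fin (z + 1) \<noteq> wmin" using succ_in_I[of z] by auto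
      then have "weight \<theta> z / Z * (1 / f (z + 1)) = exp (- \<theta>) * (weight \<theta> (z + 1) / Z)"
        using weight_rec[OF z1, of \<theta>] f_pos[OF z1] Z_pos by (simp add: field_simps exp_minus)
      then have "ennreal (weight \<theta> z / Z) * ennreal (1 / f (z + 1))
          = ennreal (exp (- \<theta>)) * ennreal (weight \<theta> (z + 1) / Z)"
        using f_pos[OF z1] by (subst (1 2) ennreal_mult''[symmetric]) (use Z_pos weight_pos[OF z1(1), of \<theta>] in \<open>auto simp: less_imp_le\<close>)
      then show ?thesis
        using True z1 by simp
    qed auto
  qed
  also have "\<dots> = ennreal (exp (- \<theta>)) * (\<integral>\<^sup>+z. ?h (z + 1) \<partial>count_space UNIV)"
    by (simp add: nn_integral_cmult)
  also have "(\<integral>\<^sup>+z. ?h (z + 1) \<partial>count_space UNIV) = (\<integral>\<^sup>+z. ?h z \<partial>count_space UNIV)"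
    by (rule nn_integral_bij_count_space) (rule bij_betwI[where g = "\<lambda>z. z - 1"], auto)
  also have "\<dots> = emeasure \<mu> (space \<mu>)"
    using nn_integral_\<mu>[of "\<lambda>_. 1"] by (simp add: nn_integral_count_space_indicator)
  finally show ?thesis
    using prob_space.emeasure_space_1[OF prob_space_\<mu>] by simp
qed


lemma nn_integral_\<mu>_le:
  assumes "\<And>z. z \<in> I \<Longrightarrow> g z \<le> a + b * h z" and h: "(\<integral>\<^sup>+z. h z \<partial>\<mu>) \<le> e"
  shows "(\<integral>\<^sup>+z. g z \<partial>\<mu>) \<le> a + b * e"
proof -
  have meas: "h' \<in> borel_measurable \<mu>" for h' :: "int \<Rightarrow> ennreal"
    by (simp add: measurable_def)
  have "(\<integral>\<^sup>+z. g z \<partial>\<mu>) \<le> (\<integral>\<^sup>+z. a + b * h z \<partial>\<mu>)"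
    using assms(1) by (intro nn_integral_mono) simp
  also have "\<dots> = a * emeasure \<mu> (space \<mu>) + b * (\<integral>\<^sup>+z. h z \<partial>\<mu>)"
    by (simp only: nn_integral_add[OF meas meas] nn_integral_cmult[OF meas] nn_integral_const)
  also have "\<dots> \<le> a + b * e"
    using h prob_space.emeasure_space_1[OF prob_space_\<mu>] by (auto intro!: mult_left_mono add_mono)
  finally show ?thesis .
qed

lemma mean_removal_finite: "mean_removal \<theta> < top" and mean_insertion_finite: "mean_insertion \<theta> < top"
proof -
  have "mean_removal \<theta> \<le> ennreal (f 1) + 1 * ennreal (exp \<theta>)"
    unfolding mean_removal_def using f_nonneg f_one_pos
    by (intro nn_integral_\<mu>_le[OF _ nn_integral_f_le]) (auto simp: removal_def simp flip: ennreal_plus intro!: ennreal_leI)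
  then show "mean_removal \<theta> < top" by (rule le_less_trans) simp
  have "mean_insertion \<theta> \<le> 1 + ennreal (f 1) * ennreal (exp (- \<theta>))"
    unfolding mean_insertion_def
  proof (intro nn_integral_\<mu>_le[OF _ nn_integral_inverse_f_le])
    fix z assume z: "z \<in> I"
    show "ennreal (insertion z) \<le> 1 + ennreal (f 1) * ennreal (if Fin z = wmax then 0 else 1 / f (z + 1))"
    proof (cases "Fin z = wmax")
      case False
      then have "0 < f (z + 1)" using f_pos succ_in_I z by blast
      then show ?thesis
        using False f_one_pos
        by (auto simp: insertion_def simp flip: ennreal_mult' ennreal_plus ennreal_1 intro!: ennreal_leI)
    qed (simp add: insertion_def)
  qed
  then show "mean_insertion \<theta> < top" by (rule le_less_trans) (simp add: ennreal_mult_less_top)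
qed

text \<open>
  These bounds serve for \<open>\<theta>\<close> tending to infinity, as it does along a volume that is infinite to the right:
  sites are then mostly at the maximal value, and a particle can rarely be inserted.
\<close>

lemma means_le_if_bounded_above:
  assumes M: "wmax = Fin M"
  shows "mean_removal \<theta> \<le> ennreal (f M)" "mean_insertion \<theta> \<le> ennreal (f M) * ennreal (exp (- \<theta>))"
proof -
  have fM: "f z \<le> f M" if "z \<in> I" for z
    using that M site_values order_trans[of wmin "Fin 0" "Fin M"]
    by (intro f_mono) (auto simp: int_interval_def)
  have "mean_removal \<theta> \<le> ennreal (f M) + 0 * ennreal (exp \<theta>)"
    unfolding mean_removal_def using fM one_in_I f_one_pos
    by (intro nn_integral_\<mu>_le[OF _ nn_integral_f_le]) (auto simp: removal_def intro!: ennreal_leI)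
  then show "mean_removal \<theta> \<le> ennreal (f M)" by simp
  have "mean_insertion \<theta> \<le> 0 + ennreal (f M) * ennreal (exp (- \<theta>))"
    unfolding mean_insertion_def
  proof (intro nn_integral_\<mu>_le[OF _ nn_integral_inverse_f_le])
    fix z assume z: "z \<in> I"
    show "ennreal (insertion z) \<le> 0 + ennreal (f M) * ennreal (if Fin z = wmax then 0 else 1 / f (z + 1))"
    proof (cases "Fin z = wmax")
      case False
      then have "0 < f (z + 1)" "f (z + 1) \<le> f M" using f_pos fM succ_in_I z by blast+
      then show ?thesis
        using False fM[OF one_in_I]
        by (auto simp: insertion_def divide_right_mono simp flip: ennreal_mult' intro!: ennreal_leI)
    qed (simp add: insertion_def)
  qed
  then show "mean_insertion \<theta> \<le> ennreal (f M) * ennreal (exp (- \<theta>))" by simp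
qed

text \<open>
  These bounds serve for \<open>\<theta>\<close> tending to minus infinity, as it does along a volume that is infinite to the left:
  sites are then mostly at the minimal value, and there is rarely a particle to remove.
\<close>

lemma means_le_if_bounded_below:
  assumes M: "wmin = Fin M"
  shows "mean_removal \<theta> \<le> ennreal (f 1 / f (M + 1)) * ennreal (exp \<theta>)" "mean_insertion \<theta> \<le> ennreal (f 1 / f (M + 1))"
proof -
  have M1: "M + 1 \<in> I" "Fin (M + 1) \<noteq> wmin"
    using one_in_I zero_in_I site_values M by (cases wmax; auto simp: int_interval_def)+
  have fM: "f (M + 1) \<le> f z" if "z \<in> I" "Fin z \<noteq> wmin" for z
    using that M M1 by (intro f_mono) (auto simp: int_interval_def)
  have ge1: "1 \<le> f 1 / f (M + 1)"
    using fM[OF one_in_I wmin_less_one] f_pos[OF M1] by simp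
  have "mean_removal \<theta> \<le> 0 + ennreal (f 1 / f (M + 1)) * ennreal (exp \<theta>)"
    unfolding mean_removal_def
  proof (intro nn_integral_\<mu>_le[OF _ nn_integral_f_le])
    fix z assume z: "z \<in> I"
    show "ennreal (removal z) \<le> 0 + ennreal (f 1 / f (M + 1)) * ennreal (f z)"
    proof (cases "Fin z = wmin")
      case False
      have "f z \<le> f 1 / f (M + 1) * f z"
        using mult_right_mono[OF ge1 f_nonneg[OF z]] by simp
      moreover have "f 1 \<le> f 1 / f (M + 1) * f z"
        using fM[OF z False] f_pos[OF M1] f_one_pos by (simp add: field_simps)
      ultimately show ?thesis
        using False f_nonneg[OF z] ge1
        by (auto simp: removal_def simp flip: ennreal_mult'' intro!: ennreal_leI)
    qed (simp add: removal_def)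
  qed
  then show "mean_removal \<theta> \<le> ennreal (f 1 / f (M + 1)) * ennreal (exp \<theta>)" by simp
  have "mean_insertion \<theta> \<le> ennreal (f 1 / f (M + 1)) + 0 * ennreal (exp \<theta>)"
    unfolding mean_insertion_def
  proof (intro nn_integral_\<mu>_le[OF _ nn_integral_f_le])
    fix z assume z: "z \<in> I"
    have "insertion z \<le> f 1 / f (M + 1)"
    proof (cases "Fin z = wmax")
      case False
      then have "f (M + 1) \<le> f (z + 1)" using fM succ_in_I z by blast
      then show ?thesis
        using False f_pos[OF M1] f_one_pos ge1
        by (auto simp: insertion_def intro!: divide_left_mono)
    qed (use ge1 in \<open>simp add: insertion_def\<close>)
    then show "ennreal (insertion z) \<le> ennreal (f 1 / f (M + 1)) + 0 * ennreal (f z)"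
      by (simp add: ennreal_leI)
  qed
  then show "mean_insertion \<theta> \<le> ennreal (f 1 / f (M + 1))" by simp
qed

text \<open>
  Markov's inequality: \<open>insertion\<close> is at least \<open>1\<close> below the maximum, and \<open>removal\<close> is at least \<open>f 1\<close> above
  the minimum.
\<close>

lemma prob_not_extreme:
  "emeasure \<mu> {z \<in> I. Fin z \<noteq> wmax} \<le> mean_insertion \<theta>"
  "ennreal (f 1) * emeasure \<mu> {z \<in> I. Fin z \<noteq> wmin} \<le> mean_removal \<theta>"
proof -
  have "emeasure \<mu> {z \<in> I. Fin z \<noteq> wmax} = (\<integral>\<^sup>+z. indicator {z \<in> I. Fin z \<noteq> wmax} z \<partial>\<mu>)"
    by (rule nn_integral_indicator[symmetric]) auto
  also have "\<dots> \<le> mean_insertion \<theta>"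
    unfolding mean_insertion_def
    by (intro nn_integral_mono) (auto simp: insertion_def indicator_def simp flip: ennreal_1 intro!: ennreal_leI)
  finally show "emeasure \<mu> {z \<in> I. Fin z \<noteq> wmax} \<le> mean_insertion \<theta>" .
  have "ennreal (f 1) * emeasure \<mu> {z \<in> I. Fin z \<noteq> wmin} = (\<integral>\<^sup>+z. ennreal (f 1) * indicator {z \<in> I. Fin z \<noteq> wmin} z \<partial>\<mu>)"
    by (rule nn_integral_cmult_indicator[symmetric]) auto
  also have "\<dots> \<le> mean_removal \<theta>"
    unfolding mean_removal_def by (intro nn_integral_mono) (auto simp: removal_def indicator_def intro!: ennreal_leI)
  finally show "ennreal (f 1) * emeasure \<mu> {z \<in> I. Fin z \<noteq> wmin} \<le> mean_removal \<theta>" .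
qed

end


section \<open>The state space\<close>

lemma finite_support_if_infsum_finite:
  fixes g :: "int \<Rightarrow> int"
  assumes nonneg: "\<And>i. i \<in> A \<Longrightarrow> 0 \<le> g i" and fin: "(\<Sum>\<^sub>\<infinity>i\<in>A. ennreal (of_int (g i))) < top"
  shows "finite {i \<in> A. g i \<noteq> 0}"
proof (rule ccontr)
  let ?B = "{i \<in> A. g i \<noteq> 0}"
  assume "infinite ?B"
  then have "top = emeasure (count_space A) ?B"
    by (subst emeasure_count_space_infinite) auto
  also have "\<dots> = (\<integral>\<^sup>+i. indicator ?B i \<partial>count_space A)"
    by (rule nn_integral_indicator[symmetric]) simp
  also have "\<dots> \<le> (\<integral>\<^sup>+i. ennreal (of_int (g i)) \<partial>count_space A)"
  proof (intro nn_integral_mono)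
    fix i assume "i \<in> space (count_space A)"
    then have "g i \<noteq> 0 \<Longrightarrow> 1 \<le> g i" using nonneg[of i] by simp
    then show "indicator ?B i \<le> ennreal (of_int (g i))"
      by (auto simp: indicator_def simp flip: ennreal_1 intro!: ennreal_leI)
  qed
  also have "\<dots> = (\<Sum>\<^sub>\<infinity>i\<in>A. ennreal (of_int (g i)))"
    by (rule infsum_eq_nn_integral_count_space[symmetric]) simp
  finally show False using fin by simp
qed

lemma move_move: "move \<Lambda> j i (move \<Lambda> i j x) = x"
  by (auto simp: move_def)

text \<open>
  On a countable set of points, sums against the point masses are bounded by integrals. It
  transfers estimates of sums over the state space to the product measure.
\<close>

lemma nn_integral_point_masses_le:
  assumes S: "countable S" "\<And>x. x \<in> S \<Longrightarrow> {x} \<in> sets M" and [measurable]: "g \<in> borel_measurable M"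
  shows "(\<integral>\<^sup>+x. emeasure M {x} * g x \<partial>count_space S) \<le> (\<integral>\<^sup>+x. g x \<partial>M)"
proof -
  have "(\<integral>\<^sup>+x. emeasure M {x} * g x \<partial>count_space S)
      = (\<integral>\<^sup>+x. \<integral>\<^sup>+w. g w * indicator {x} w \<partial>M \<partial>count_space S)"
  proof (intro nn_integral_cong)
    fix x assume "x \<in> space (count_space S)"
    then have [measurable]: "{x} \<in> sets M" using S by simp
    have "(\<integral>\<^sup>+w. g w * indicator {x} w \<partial>M) = (\<integral>\<^sup>+w. g x * indicator {x} w \<partial>M)"
      by (intro nn_integral_cong) (auto simp: indicator_def)
    also have "\<dots> = g x * emeasure M {x}"
      by (rule nn_integral_cmult_indicator) measurable
    finally show "emeasure M {x} * g x = (\<integral>\<^sup>+w. g w * indicator {x} w \<partial>M)"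
      by (simp add: mult.commute)
  qed
  also have "\<dots> = (\<integral>\<^sup>+w. \<integral>\<^sup>+x. g w * indicator {x} w \<partial>count_space S \<partial>M)"
    using S by (intro nn_integral_count_space_nn_integral[symmetric]) auto
  also have "\<dots> \<le> (\<integral>\<^sup>+w. g w \<partial>M)"
  proof (intro nn_integral_mono)
    fix w
    show "(\<integral>\<^sup>+x. g w * indicator {x} w \<partial>count_space S) \<le> g w"
      by (cases "w \<in> S"; subst nn_integral_count_space'[of "{w} \<inter> S"]) (auto simp: indicator_def)
  qed
  finally show ?thesis .
qed

lemma suminf_geometric_finite:
  fixes h :: "nat \<Rightarrow> ennreal" and r b :: real
  assumes "0 \<le> r" "r < 1" "0 \<le> b" "\<And>n. h n \<le> ennreal (b * r ^ n)"
  shows "(\<Sum>n. h n) < top"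
proof -
  have "(\<Sum>n. h n) \<le> (\<Sum>n. ennreal (b * r ^ n))"
    by (intro suminf_le assms) auto
  also have "\<dots> = ennreal (\<Sum>n. b * r ^ n)"
    using assms by (intro suminf_ennreal2) (auto intro: summable_mult summable_geometric)
  finally show ?thesis by (rule le_less_trans) simp
qed

context blocking_system
begin

abbreviation \<Lambda> :: "int set" where "\<Lambda> \<equiv> int_interval L R"
abbreviation \<Omega> :: "(int \<Rightarrow> int) set" where "\<Omega> \<equiv> state_space L R wmin wmax"

definition edges :: "int set" where "edges = {i. L \<le> Fin i \<and> Fin i < R}"

lemma edge_in_\<Lambda>:
  assumes "i \<in> edges"
  shows "i \<in> \<Lambda>" "i + 1 \<in> \<Lambda>"
proof -
  have "L \<le> Fin i" "Fin i < R" using assms by (auto simp: edges_def)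
  then show "i \<in> \<Lambda>" "i + 1 \<in> \<Lambda>"
    by (cases L; cases R; simp add: int_interval_def)+
qed

lemma left_in_\<Lambda>: "L = Fin l \<Longrightarrow> l \<in> \<Lambda>" and right_in_\<Lambda>: "R = Fin r \<Longrightarrow> r \<in> \<Lambda>"
  using volume order_trans[OF volume] by (auto simp: int_interval_def)

lemma state_space_subset: "\<Omega> \<subseteq> \<Lambda> \<rightarrow>\<^sub>E I"
  by (auto simp: state_space_def)

text \<open>
  A sum of integers is finite only if almost all of them vanish. For finite \<open>L\<close> both sides are
  true, the right-hand side with \<open>n = - L\<close>.
\<close>

lemma particles_finite_iff:
  assumes x: "x \<in> \<Lambda> \<rightarrow>\<^sub>E I"
  shows "(L > Minf \<or> N_particles L R wmin x < top) \<longleftrightarrow> (\<exists>n. \<forall>i\<in>\<Lambda>. i < - n \<longrightarrow> i \<le> 0 \<longrightarrow> Fin (x i) = wmin)"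
proof (cases L)
  case (Fin l)
  then have "\<forall>i\<in>\<Lambda>. i < - (- l) \<longrightarrow> i \<le> 0 \<longrightarrow> Fin (x i) = wmin"
    by (auto simp: int_interval_def)
  then show ?thesis using Fin by (auto intro: exI[of _ "- l"])
next
  case Pinf
  then show ?thesis using volume by simp
next
  case Minf
  then obtain w where w: "wmin = Fin w"
    using left_infinite site_values by (cases wmin) auto
  define A where "A = {i \<in> \<Lambda>. i \<le> 0}"
  have N: "N_particles L R wmin x = (\<Sum>\<^sub>\<infinity>i\<in>A. ennreal (of_int (x i - w)))"
    by (simp add: N_particles_def w A_def)
  have nonneg: "0 \<le> x i - w" if "i \<in> A" for i
    using that x by (auto simp: A_def w int_interval_def PiE_iff)
  have "N_particles L R wmin x < top \<longleftrightarrow> finite {i \<in> A. x i - w \<noteq> 0}"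
  proof
    assume "N_particles L R wmin x < top"
    then show "finite {i \<in> A. x i - w \<noteq> 0}"
      unfolding N by (intro finite_support_if_infsum_finite nonneg)
  next
    assume fin: "finite {i \<in> A. x i - w \<noteq> 0}"
    have "N_particles L R wmin x = (\<Sum>\<^sub>\<infinity>i\<in>{i \<in> A. x i - w \<noteq> 0}. ennreal (of_int (x i - w)))"
      unfolding N by (rule infsum_cong_neutral) auto
    then show "N_particles L R wmin x < top"
      using fin by (simp add: less_top)
  qed
  also have "\<dots> \<longleftrightarrow> (\<exists>n. \<forall>i\<in>\<Lambda>. i < - n \<longrightarrow> i \<le> 0 \<longrightarrow> Fin (x i) = wmin)"
  proof
    assume "finite {i \<in> A. x i - w \<noteq> 0}"
    then obtain b where b: "\<forall>i\<in>{i \<in> A. x i - w \<noteq> 0}. b \<le> i"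
      using bdd_below_finite unfolding bdd_below_def by blast
    have "\<forall>i\<in>\<Lambda>. i < - (- b) \<longrightarrow> i \<le> 0 \<longrightarrow> Fin (x i) = wmin"
      using b by (force simp: A_def w)
    then show "\<exists>n. \<forall>i\<in>\<Lambda>. i < - n \<longrightarrow> i \<le> 0 \<longrightarrow> Fin (x i) = wmin" ..
  next
    assume "\<exists>n. \<forall>i\<in>\<Lambda>. i < - n \<longrightarrow> i \<le> 0 \<longrightarrow> Fin (x i) = wmin"
    then obtain n where "\<forall>i\<in>\<Lambda>. i < - n \<longrightarrow> i \<le> 0 \<longrightarrow> Fin (x i) = wmin" ..
    then have "{i \<in> A. x i - w \<noteq> 0} \<subseteq> {- n..0}"
      by (force simp: A_def w)
    then show "finite {i \<in> A. x i - w \<noteq> 0}"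
      by (rule finite_subset) simp
  qed
  finally show ?thesis using Minf by simp
qed

lemma holes_finite_iff:
  assumes x: "x \<in> \<Lambda> \<rightarrow>\<^sub>E I"
  shows "(R < Pinf \<or> N_holes L R wmax x < top) \<longleftrightarrow> (\<exists>n. \<forall>i\<in>\<Lambda>. n < i \<longrightarrow> 1 \<le> i \<longrightarrow> Fin (x i) = wmax)"
proof (cases R)
  case (Fin r)
  then have "\<forall>i\<in>\<Lambda>. r < i \<longrightarrow> 1 \<le> i \<longrightarrow> Fin (x i) = wmax"
    by (auto simp: int_interval_def)
  then show ?thesis using Fin by auto
next
  case Minf
  then show ?thesis using volume by simp
next
  case Pinf
  then obtain w where w: "wmax = Fin w"
    using right_infinite site_values by (cases wmax) auto
  define A where "A = {i \<in> \<Lambda>. 1 \<le> i}"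
  have N: "N_holes L R wmax x = (\<Sum>\<^sub>\<infinity>i\<in>A. ennreal (of_int (w - x i)))"
    by (simp add: N_holes_def w A_def)
  have nonneg: "0 \<le> w - x i" if "i \<in> A" for i
    using that x by (auto simp: A_def w int_interval_def PiE_iff)
  have "N_holes L R wmax x < top \<longleftrightarrow> finite {i \<in> A. w - x i \<noteq> 0}"
  proof
    assume "N_holes L R wmax x < top"
    then show "finite {i \<in> A. w - x i \<noteq> 0}"
      unfolding N by (intro finite_support_if_infsum_finite nonneg)
  next
    assume fin: "finite {i \<in> A. w - x i \<noteq> 0}"
    have "N_holes L R wmax x = (\<Sum>\<^sub>\<infinity>i\<in>{i \<in> A. w - x i \<noteq> 0}. ennreal (of_int (w - x i)))"
      unfolding N by (rule infsum_cong_neutral) auto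
    then show "N_holes L R wmax x < top"
      using fin by (simp add: less_top)
  qed
  also have "\<dots> \<longleftrightarrow> (\<exists>n. \<forall>i\<in>\<Lambda>. n < i \<longrightarrow> 1 \<le> i \<longrightarrow> Fin (x i) = wmax)"
  proof
    assume "finite {i \<in> A. w - x i \<noteq> 0}"
    then obtain b where b: "\<forall>i\<in>{i \<in> A. w - x i \<noteq> 0}. i \<le> b"
      using bdd_above_finite unfolding bdd_above_def by blast
    have "\<forall>i\<in>\<Lambda>. b < i \<longrightarrow> 1 \<le> i \<longrightarrow> Fin (x i) = wmax"
      using b by (force simp: A_def w)
    then show "\<exists>n. \<forall>i\<in>\<Lambda>. n < i \<longrightarrow> 1 \<le> i \<longrightarrow> Fin (x i) = wmax" ..
  next
    assume "\<exists>n. \<forall>i\<in>\<Lambda>. n < i \<longrightarrow> 1 \<le> i \<longrightarrow> Fin (x i) = wmax"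
    then obtain n where "\<forall>i\<in>\<Lambda>. n < i \<longrightarrow> 1 \<le> i \<longrightarrow> Fin (x i) = wmax" ..
    then have "{i \<in> A. w - x i \<noteq> 0} \<subseteq> {1..n}"
      by (force simp: A_def w)
    then show "finite {i \<in> A. w - x i \<noteq> 0}"
      by (rule finite_subset) simp
  qed
  finally show ?thesis using Pinf by simp
qed

lemma state_space_iff:
  "x \<in> \<Omega> \<longleftrightarrow> x \<in> \<Lambda> \<rightarrow>\<^sub>E I \<and>
     (\<exists>n. \<forall>i\<in>\<Lambda>. i < - n \<longrightarrow> i \<le> 0 \<longrightarrow> Fin (x i) = wmin) \<and>
     (\<exists>n. \<forall>i\<in>\<Lambda>. n < i \<longrightarrow> 1 \<le> i \<longrightarrow> Fin (x i) = wmax)"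
  using particles_finite_iff holes_finite_iff by (auto simp: state_space_def)

text \<open>
  A configuration of the state space is determined by finitely many of its values, so the state
  space is a countable union of sets that inject into the integer lists.
\<close>

lemma countable_\<Omega>: "countable \<Omega>"
proof -
  define S where "S k n = {x \<in> \<Lambda> \<rightarrow>\<^sub>E I. (\<forall>i\<in>\<Lambda>. i < - k \<longrightarrow> i \<le> 0 \<longrightarrow> Fin (x i) = wmin) \<and>
     (\<forall>i\<in>\<Lambda>. n < i \<longrightarrow> 1 \<le> i \<longrightarrow> Fin (x i) = wmax)}" for k n :: int
  have "countable (S k n)" for k n
  proof -
    define T where "T = {i. (i < - k \<and> i \<le> 0) \<or> (n < i \<and> 1 \<le> i)}"
    define l where "l = [min 0 (- k)..max 1 n]"
    have l: "i \<in> set l" if "i \<notin> T" for i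
      using that by (auto simp: T_def l_def)
    have "inj_on (\<lambda>x. map x l) (S k n)"
    proof (rule inj_onI, rule ext)
      fix x y i assume xy: "x \<in> S k n" "y \<in> S k n" "map x l = map y l"
      have "Fin (x i) = Fin (y i)" if "i \<in> T" "i \<in> \<Lambda>"
        using that xy(1,2) by (auto simp: S_def T_def)
      moreover have "x i = y i" if "i \<notin> T"
        using l[OF that] xy(3) by simp
      moreover have "x i = y i" if "i \<notin> \<Lambda>"
        using that xy(1,2) by (auto simp: S_def PiE_iff extensional_def)
      ultimately show "x i = y i" by blast
    qed
    then show ?thesis
      by (rule countable_image_inj_on[rotated]) simp
  qed
  then have "countable (\<Union>k. \<Union>n. S k n)"
    by (intro countable_UN) auto
  moreover have "\<Omega> = (\<Union>k. \<Union>n. S k n)"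
    by (rule set_eqI) (simp add: S_def state_space_iff)
  ultimately show ?thesis by simp
qed

end

section \<open>Point masses of the product measure and detailed balance\<close>

locale blocking_measure = blocking_system +
  fixes c :: real and \<theta> :: "int \<Rightarrow> real"
  assumes theta_eq: "\<theta> i = c + of_int i * (ln p - ln q)"
    and theta_range: "i \<in> int_interval L R \<Longrightarrow>
      theta_min wmin f < ereal (\<theta> i) \<and> ereal (\<theta> i) < theta_max wmax f"
    and left_balance: "L = Fin l \<Longrightarrow> z \<in> int_interval wmin wmax \<Longrightarrow> Fin z \<noteq> wmax \<Longrightarrow>
      QL (z + 1) / PL z = f (z + 1) / exp (\<theta> l)"
    and right_balance: "R = Fin r \<Longrightarrow> z \<in> int_interval wmin wmax \<Longrightarrow> Fin z \<noteq> wmax \<Longrightarrow>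
      PR (z + 1) / QR z = f (z + 1) / exp (\<theta> r)"
begin

lemma theta_site: "i \<in> \<Lambda> \<Longrightarrow> site L R wmin wmax P Q PL QL PR QR p q f s (\<theta> i)"
  using theta_range by unfold_locales auto

lemma exp_theta: "exp (\<theta> (i + 1)) = exp (\<theta> i) * (p / q)"
  using p_pos q_pos by (simp add: theta_eq algebra_simps exp_add exp_diff)

text \<open>
  Off the volume the factor is an arbitrary probability measure: this does not affect the product
  over \<open>\<Lambda>\<close>, and makes the whole family one of probability measures.
\<close>

definition \<mu> :: "int \<Rightarrow> int measure" where
  "\<mu> i = (if i \<in> \<Lambda> then marginal wmin wmax f (\<theta> i) else return (count_space {0}) 0)"

abbreviation \<pi> :: "(int \<Rightarrow> int) measure" where "\<pi> \<equiv> PiM \<Lambda> \<mu>"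

lemma \<pi>_eq: "(\<Pi>\<^sub>M i\<in>\<Lambda>. marginal wmin wmax f (\<theta> i)) = \<pi>"
  by (rule PiM_cong) (auto simp: \<mu>_def)

sublocale product_prob_space \<mu> \<Lambda>
proof -
  have "prob_space (\<mu> i)" for i
    using site.prob_space_\<mu>[OF theta_site, of i] by (auto simp: \<mu>_def intro!: prob_space_return)
  then show "product_prob_space \<mu>"
    by (simp add: product_prob_space_def product_sigma_finite_def product_prob_space_axioms_def
        prob_space_imp_sigma_finite)
qed

lemma space_\<mu>: "i \<in> \<Lambda> \<Longrightarrow> space (\<mu> i) = I" and sets_\<mu>: "i \<in> \<Lambda> \<Longrightarrow> sets (\<mu> i) = Pow I"
  using site.space_\<mu>[OF theta_site, of i] site.sets_\<mu>[OF theta_site, of i] by (simp_all add: \<mu>_def)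

lemma space_\<pi>: "space \<pi> = \<Lambda> \<rightarrow>\<^sub>E I"
  by (auto simp: space_PiM space_\<mu> intro!: PiE_cong)

lemma measurable_\<mu>: "i \<in> \<Lambda> \<Longrightarrow> (g :: int \<Rightarrow> ennreal) \<in> borel_measurable (\<mu> i)"
  by (simp add: measurable_def space_\<mu> sets_\<mu>)

lemma measurable_coordinate:
  "i \<in> \<Lambda> \<Longrightarrow> (\<lambda>x. (g :: int \<Rightarrow> ennreal) (x i)) \<in> borel_measurable \<pi>"
  by (rule measurable_compose[where N = "\<mu> i"]) (auto intro: measurable_\<mu> measurable_component_singleton)

definition \<nu> :: "int \<Rightarrow> int \<Rightarrow> real" where
  "\<nu> i z = weight (\<theta> i) z / partition_fun wmin wmax f (\<theta> i)"

lemma emeasure_\<mu>: "i \<in> \<Lambda> \<Longrightarrow> z \<in> I \<Longrightarrow> emeasure (\<mu> i) {z} = ennreal (\<nu> i z)"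
  using site.emeasure_\<mu>_singleton[OF theta_site] by (simp add: \<mu>_def \<nu>_def)

lemma \<nu>_nonneg: "i \<in> \<Lambda> \<Longrightarrow> z \<in> I \<Longrightarrow> 0 \<le> \<nu> i z"
  using site.Z_pos[OF theta_site, of i] weight_pos[of z "\<theta> i"] by (simp add: \<nu>_def)

lemma \<nu>_rec: "z \<in> I \<Longrightarrow> Fin z \<noteq> wmin \<Longrightarrow> \<nu> i z * f z = exp (\<theta> i) * \<nu> i (z - 1)"
  using weight_rec[of z "\<theta> i"] by (simp add: \<nu>_def)

definition window :: "nat \<Rightarrow> int set" where "window n = \<Lambda> \<inter> {- int n..int n}"

lemma finite_window: "finite (window n)" and window_subset: "window n \<subseteq> \<Lambda>"
  by (auto simp: window_def)

lemma window_mono: "m \<le> n \<Longrightarrow> window m \<subseteq> window n"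
  by (auto simp: window_def)

lemma window_exhausts:
  assumes "finite F" "F \<subseteq> \<Lambda>"
  shows "\<forall>\<^sub>F n in sequentially. F \<subseteq> window n"
proof -
  obtain N where "\<forall>i\<in>F. \<bar>i\<bar> \<le> int N"
  proof -
    have "\<forall>i\<in>F. \<bar>i\<bar> \<le> int (nat (\<Sum>i\<in>F. \<bar>i\<bar>))"
      using assms(1) by (auto simp: sum_nonneg intro: member_le_sum)
    then show ?thesis using that by blast
  qed
  then have "F \<subseteq> window n" if "N \<le> n" for n
    using that assms(2) by (force simp: window_def)
  then show ?thesis
    by (rule eventually_mono[OF eventually_ge_at_top])
qed

text \<open>
  A single configuration is the decreasing intersection of the cylinder sets that prescribe its
  values in finite windows.
\<close>

lemma point_limit:
  assumes x: "x \<in> \<Lambda> \<rightarrow>\<^sub>E I"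
  shows "{x} \<in> sets \<pi>" "(\<lambda>n. \<Prod>i\<in>window n. emeasure (\<mu> i) {x i}) \<longlonglongrightarrow> emeasure \<pi> {x}"
proof -
  define A where "A n = {w \<in> space \<pi>. \<forall>i\<in>window n. w i \<in> {x i}}" for n
  have xi: "{x i} \<in> sets (\<mu> i)" if "i \<in> window n" for i n
    using that x window_subset[of n] by (auto simp: sets_\<mu> PiE_iff)
  have A: "A n \<in> sets \<pi>" for n
    unfolding A_def using window_subset[of n] xi[of _ n]
    by (intro sets.sets_Collect_finite_All finite_window sets_Collect_single) auto
  have Inter: "(\<Inter>n. A n) = {x}"
  proof (intro subset_antisym subsetI)
    fix w assume w: "w \<in> (\<Inter>n. A n)"
    have "w i = x i" if "i \<in> \<Lambda>" for i
    proof -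
      have "i \<in> window (nat \<bar>i\<bar>)" using that by (auto simp: window_def)
      then show ?thesis using w by (auto simp: A_def)
    qed
    moreover have "w \<in> \<Lambda> \<rightarrow>\<^sub>E I" using w by (simp add: A_def space_\<pi>)
    ultimately have "w = x"
      using x by (intro PiE_ext) auto
    then show "w \<in> {x}" by simp
  qed (use x in \<open>auto simp: A_def space_\<pi>\<close>)
  show "{x} \<in> sets \<pi>"
    unfolding Inter[symmetric] using A by (intro sets.countable_INT) auto
  have "(\<lambda>n. emeasure \<pi> (A n)) \<longlonglongrightarrow> emeasure \<pi> (\<Inter>n. A n)"
  proof (rule Lim_emeasure_decseq)
    show "decseq A"
      using window_mono by (force simp: decseq_def A_def)
  qed (use A in auto)
  moreover have "emeasure \<pi> (A n) = (\<Prod>i\<in>window n. emeasure (\<mu> i) {x i})" for n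
    unfolding A_def by (rule emeasure_PiM_Collect) (use finite_window window_subset xi in auto)
  ultimately show "(\<lambda>n. \<Prod>i\<in>window n. emeasure (\<mu> i) {x i}) \<longlonglongrightarrow> emeasure \<pi> {x}"
    by (simp add: Inter)
qed

text \<open>
  For configurations that differ on a finite set \<open>F\<close> only, a balance relation between the finite
  products over \<open>F\<close> carries over to the point masses, because the remaining factors in
  every window are the same. Point masses are not divided by, since they may vanish.
\<close>

lemma point_balance:
  fixes a b :: real
  assumes F: "finite F" "F \<subseteq> \<Lambda>" and x: "x \<in> \<Lambda> \<rightarrow>\<^sub>E I" and y: "y \<in> \<Lambda> \<rightarrow>\<^sub>E I"
    and off: "\<And>i. i \<in> \<Lambda> - F \<Longrightarrow> x i = y i" and ab: "0 \<le> a" "0 \<le> b"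
    and balance: "a * (\<Prod>i\<in>F. \<nu> i (x i)) = b * (\<Prod>i\<in>F. \<nu> i (y i))"
  shows "emeasure \<pi> {x} * ennreal a = emeasure \<pi> {y} * ennreal b"
proof -
  let ?w = "\<lambda>x n. \<Prod>i\<in>window n. emeasure (\<mu> i) {x i}"
  have on_F: "(\<Prod>i\<in>F. emeasure (\<mu> i) {x i}) = ennreal (\<Prod>i\<in>F. \<nu> i (x i))"
    if "x \<in> \<Lambda> \<rightarrow>\<^sub>E I" for x
    using that F by (subst prod_ennreal[symmetric]) (auto intro!: prod.cong emeasure_\<mu> \<nu>_nonneg)
  have eq: "ennreal a * (\<Prod>i\<in>F. emeasure (\<mu> i) {x i}) = ennreal b * (\<Prod>i\<in>F. emeasure (\<mu> i) {y i})"
    using on_F[OF x] on_F[OF y] balance ab by (simp flip: ennreal_mult')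
  have "ennreal a * ?w x n = ennreal b * ?w y n" if "F \<subseteq> window n" for n
  proof -
    let ?rest = "\<Prod>i\<in>window n - F. emeasure (\<mu> i) {y i}"
    have split: "?w x n = (\<Prod>i\<in>window n - F. emeasure (\<mu> i) {x i}) * (\<Prod>i\<in>F. emeasure (\<mu> i) {x i})" for x
      using that finite_window by (rule prod.subset_diff)
    have rest: "(\<Prod>i\<in>window n - F. emeasure (\<mu> i) {x i}) = ?rest"
      using off window_subset[of n] by (intro prod.cong refl) auto
    have "ennreal a * ?w x n = ?rest * (ennreal a * (\<Prod>i\<in>F. emeasure (\<mu> i) {x i}))"
      unfolding split[of x] rest by (simp only: mult.left_commute)
    also have "\<dots> = ?rest * (ennreal b * (\<Prod>i\<in>F. emeasure (\<mu> i) {y i}))"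
      by (simp only: eq)
    also have "\<dots> = ennreal b * ?w y n"
      unfolding split[of y] by (simp only: mult.left_commute)
    finally show ?thesis .
  qed
  then have ev: "\<forall>\<^sub>F n in sequentially. ennreal a * ?w x n = ennreal b * ?w y n"
    by (rule eventually_mono[OF window_exhausts[OF F]])
  have lim: "(\<lambda>n. ennreal a * ?w x n) \<longlonglongrightarrow> ennreal a * emeasure \<pi> {x}"
    "(\<lambda>n. ennreal b * ?w y n) \<longlonglongrightarrow> ennreal b * emeasure \<pi> {y}"
    by (intro ennreal_tendsto_cmult point_limit x y; simp)+
  have "ennreal a * emeasure \<pi> {x} = ennreal b * emeasure \<pi> {y}"
    using Lim_transform_eventually[OF lim(1) ev] lim(2) by (rule LIMSEQ_unique)
  then show ?thesis by (simp add: mult.commute)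
qed

text \<open>
  A particle moves from \<open>i\<close> to \<open>i + 1\<close>. Both rates involve the same value of \<open>s\<close>. The two factors of
  \<open>f\<close> turn the weights at \<open>i\<close> and \<open>i + 1\<close> before the jump into those after the jump, at the cost of \<open>exp (\<theta> i)\<close> and
  a gain of \<open>exp (\<theta> (i + 1))\<close>, and this quotient is \<open>q / p\<close>.
\<close>

lemma bulk_balance:
  assumes i: "i \<in> edges" and x: "x \<in> \<Lambda> \<rightarrow>\<^sub>E I" and y: "move \<Lambda> i (i + 1) x \<in> \<Lambda> \<rightarrow>\<^sub>E I" (is "?y \<in> _")
  shows "emeasure \<pi> {x} * ennreal (P (x i) (x (i + 1)))
       = emeasure \<pi> {?y} * ennreal (Q (?y i) (?y (i + 1)))"
proof (rule point_balance[where F = "{i, i + 1}"])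
  note iL = edge_in_\<Lambda>[OF i]
  have yi: "?y i = x i - 1" "?y (i + 1) = x (i + 1) + 1"
    using iL by (auto simp: move_def)
  have I: "x i \<in> I" "x (i + 1) \<in> I" "x i - 1 \<in> I" "x (i + 1) + 1 \<in> I"
    using x y iL yi by (metis PiE_mem)+
  have ne: "Fin (x i) \<noteq> wmin" "Fin (x (i + 1) + 1) \<noteq> wmin"
    using above_min[OF I(3), of "x i"] above_min[OF I(2), of "x (i + 1) + 1"] by auto
  show "P (x i) (x (i + 1)) \<ge> 0" "Q (?y i) (?y (i + 1)) \<ge> 0"
    using bulk_nonneg I yi by auto
  have "P (x i) (x (i + 1)) * (\<nu> i (x i) * \<nu> (i + 1) (x (i + 1)))
      = p * s (x i) (x (i + 1) + 1) * (\<nu> i (x i) * f (x i)) * \<nu> (i + 1) (x (i + 1))"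
    using P_eq I by (simp add: mult_ac)
  also have "\<dots> = p * s (x i) (x (i + 1) + 1) * (exp (\<theta> i) * \<nu> i (x i - 1)) * \<nu> (i + 1) (x (i + 1))"
    by (simp add: \<nu>_rec I ne)
  also have "\<dots> = q * s (x i) (x (i + 1) + 1) * \<nu> i (x i - 1) * (exp (\<theta> (i + 1)) * \<nu> (i + 1) (x (i + 1)))"
    using q_pos by (simp add: exp_theta mult_ac)
  also have "\<dots> = q * s (x i) (x (i + 1) + 1) * \<nu> i (x i - 1) * (\<nu> (i + 1) (x (i + 1) + 1) * f (x (i + 1) + 1))"
    using \<nu>_rec[OF I(4) ne(2), of "i + 1"] by simp
  also have "\<dots> = Q (?y i) (?y (i + 1)) * (\<nu> i (?y i) * \<nu> (i + 1) (?y (i + 1)))"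
    using Q_eq I yi by (simp add: mult_ac)
  finally show "P (x i) (x (i + 1)) * (\<Prod>j\<in>{i, i + 1}. \<nu> j (x j))
      = Q (?y i) (?y (i + 1)) * (\<Prod>j\<in>{i, i + 1}. \<nu> j (?y j))"
    by simp
  show "\<And>j. j \<in> \<Lambda> - {i, i + 1} \<Longrightarrow> x j = ?y j"
    by (simp add: move_def)
qed (use edge_in_\<Lambda>[OF i] x y in auto)

text \<open>
  The reservoir is the site \<open>j\<close> outside the volume, so only the coordinate \<open>i\<close> changes.
\<close>

lemma reservoir_balance:
  fixes \<alpha> \<beta> :: "int \<Rightarrow> real"
  assumes i: "i \<in> \<Lambda>" "j \<notin> \<Lambda>" and x: "x \<in> \<Lambda> \<rightarrow>\<^sub>E I" and y: "move \<Lambda> j i x \<in> \<Lambda> \<rightarrow>\<^sub>E I" (is "?y \<in> _")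
    and nonneg: "\<And>z. z \<in> I \<Longrightarrow> 0 \<le> \<alpha> z" "\<And>z. z \<in> I \<Longrightarrow> 0 \<le> \<beta> z"
    and balance: "\<And>z. z \<in> I \<Longrightarrow> Fin z \<noteq> wmax \<Longrightarrow> \<beta> (z + 1) = \<alpha> z * f (z + 1) / exp (\<theta> i)"
  shows "emeasure \<pi> {x} * ennreal (\<alpha> (x i)) = emeasure \<pi> {?y} * ennreal (\<beta> (?y i))"
proof (rule point_balance[where F = "{i}"])
  have yi: "?y i = x i + 1"
    using i by (auto simp: move_def)
  have I: "x i \<in> I" "x i + 1 \<in> I"
    using x y i(1) yi by (metis PiE_mem)+
  have ne: "Fin (x i) \<noteq> wmax" "Fin (x i + 1) \<noteq> wmin"
    using pred_in_I(2)[OF I(2)] above_min[OF I(1), of "x i + 1"] by auto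
  show "\<alpha> (x i) \<ge> 0" "\<beta> (?y i) \<ge> 0"
    using nonneg I yi by auto
  have "\<nu> i (x i + 1) * f (x i + 1) = exp (\<theta> i) * \<nu> i (x i)"
    using \<nu>_rec[OF I(2) ne(2), of i] by simp
  then have "\<nu> i (x i) = \<nu> i (x i + 1) * f (x i + 1) / exp (\<theta> i)"
    by simp
  then show "\<alpha> (x i) * (\<Prod>j\<in>{i}. \<nu> j (x j)) = \<beta> (?y i) * (\<Prod>j\<in>{i}. \<nu> j (?y j))"
    using balance[OF I(1) ne(1)] yi by simp
  show "\<And>k. k \<in> \<Lambda> - {i} \<Longrightarrow> x k = ?y k"
    using i by (auto simp: move_def)
qed (use i x y in auto)

end


section \<open>Detailed balance for the total jump rate\<close>

lemma nn_integral_single_target_le: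
  "(\<integral>\<^sup>+y. (if y = z then r else 0) \<partial>count_space S) \<le> (r :: ennreal)"
  by (cases "z \<in> S"; subst nn_integral_count_space'[of "{z} \<inter> S"]) auto

lemma nn_integral_geometric_finite:
  fixes g :: "'a \<Rightarrow> ennreal" and e :: "nat \<Rightarrow> 'a"
  assumes "inj e" "0 \<le> r" "r < 1" "0 \<le> b" "\<And>n. g (e n) \<le> ennreal (b * r ^ n)"
  shows "(\<integral>\<^sup>+x. g x \<partial>count_space (range e)) < top"
proof -
  have "(\<integral>\<^sup>+x. g x \<partial>count_space (range e)) = (\<integral>\<^sup>+n. g (e n) \<partial>count_space UNIV)"
    using assms(1) by (intro nn_integral_bij_count_space[symmetric]) (simp add: inj_on_imp_bij_betw)
  also have "\<dots> = (\<Sum>n. g (e n))"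
    by (rule nn_integral_count_space_nat)
  also have "\<dots> < top"
    by (rule suminf_geometric_finite[OF assms(2-5)])
  finally show ?thesis .
qed

lemma move_eq_iff: "y = move \<Lambda> i j x \<longleftrightarrow> x = move \<Lambda> j i y"
  using move_move by metis

definition bulk_rate ::
  "int extended \<Rightarrow> int extended \<Rightarrow> (int \<Rightarrow> int \<Rightarrow> real) \<Rightarrow> (int \<Rightarrow> int \<Rightarrow> real) \<Rightarrow>
   (int \<Rightarrow> int) \<Rightarrow> (int \<Rightarrow> int) \<Rightarrow> int \<Rightarrow> ennreal" where
  "bulk_rate L R P Q x y i =
     (if y = move (int_interval L R) i (i + 1) x then ennreal (P (x i) (x (i + 1))) else 0) +
     (if y = move (int_interval L R) (i + 1) i x then ennreal (Q (x i) (x (i + 1))) else 0)"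

definition reservoir_rate ::
  "int extended \<Rightarrow> int extended \<Rightarrow> (int \<Rightarrow> real) \<Rightarrow> (int \<Rightarrow> real) \<Rightarrow> int \<Rightarrow> int \<Rightarrow>
   (int \<Rightarrow> int) \<Rightarrow> (int \<Rightarrow> int) \<Rightarrow> ennreal" where
  "reservoir_rate L R \<alpha> \<beta> j i x y =
     (if y = move (int_interval L R) j i x then ennreal (\<alpha> (x i)) else 0) +
     (if y = move (int_interval L R) i j x then ennreal (\<beta> (x i)) else 0)"

context blocking_measure
begin

abbreviation rate :: "(int \<Rightarrow> int) \<Rightarrow> (int \<Rightarrow> int) \<Rightarrow> ennreal" where
  "rate \<equiv> jump_rate L R P Q PL QL PR QR"

definition left_rate :: "(int \<Rightarrow> int) \<Rightarrow> (int \<Rightarrow> int) \<Rightarrow> ennreal" where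
  "left_rate x y = (case L of Fin l \<Rightarrow> reservoir_rate L R PL QL (l - 1) l x y | _ \<Rightarrow> 0)"

definition right_rate :: "(int \<Rightarrow> int) \<Rightarrow> (int \<Rightarrow> int) \<Rightarrow> ennreal" where
  "right_rate x y = (case R of Fin r \<Rightarrow> reservoir_rate L R QR PR (r + 1) r x y | _ \<Rightarrow> 0)"

text \<open>
  At the right end the reservoir inserts particles with rate \<open>QR\<close> and removes them with rate \<open>PR\<close>,
  whereas \<open>PL\<close> inserts and \<open>QL\<close> removes at the left end.
\<close>

lemma rate_eq:
  "rate x y = (\<integral>\<^sup>+i. bulk_rate L R P Q x y i \<partial>count_space edges) + left_rate x y + right_rate x y"
proof -
  have "(\<Sum>\<^sub>\<infinity>i\<in>edges. bulk_rate L R P Q x y i) = (\<integral>\<^sup>+i. bulk_rate L R P Q x y i \<partial>count_space edges)"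
    by (rule infsum_eq_nn_integral_count_space) simp
  then show ?thesis
    by (simp add: jump_rate_def Let_def bulk_rate_def edges_def left_rate_def right_rate_def
        reservoir_rate_def add.commute split: extended.split)
qed

lemma left_rate_Fin: "L = Fin l \<Longrightarrow> left_rate x y = reservoir_rate L R PL QL (l - 1) l x y"
  unfolding left_rate_def by simp

lemma left_rate_infinite: "\<nexists>l. L = Fin l \<Longrightarrow> left_rate x y = 0"
  unfolding left_rate_def by (cases L) auto

lemma left_reservoir:
  assumes "L = Fin l" "z \<in> I"
  shows "0 \<le> PL z" "0 \<le> QL z" "Fin z \<noteq> wmax \<Longrightarrow> QL (z + 1) = PL z * f (z + 1) / exp (\<theta> l)"
  using left_nonneg[of z] left_balance[of l z] PL_nonzero[of z] assms by (auto simp: field_simps)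

lemma right_rate_Fin: "R = Fin r \<Longrightarrow> right_rate x y = reservoir_rate L R QR PR (r + 1) r x y"
  unfolding right_rate_def by simp

lemma right_rate_infinite: "\<nexists>r. R = Fin r \<Longrightarrow> right_rate x y = 0"
  unfolding right_rate_def by (cases R) auto

lemma right_reservoir:
  assumes "R = Fin r" "z \<in> I"
  shows "0 \<le> QR z" "0 \<le> PR z" "Fin z \<noteq> wmax \<Longrightarrow> PR (z + 1) = QR z * f (z + 1) / exp (\<theta> r)"
  using right_nonneg[of z] right_balance[of r z] QR_nonzero[of z] assms by (auto simp: field_simps)

lemma bulk_rate_balance:
  assumes "i \<in> edges" "x \<in> \<Lambda> \<rightarrow>\<^sub>E I" "y \<in> \<Lambda> \<rightarrow>\<^sub>E I"
  shows "emeasure \<pi> {x} * bulk_rate L R P Q x y i = emeasure \<pi> {y} * bulk_rate L R P Q y x i"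
proof -
  have "emeasure \<pi> {x} * (if y = move \<Lambda> i (i + 1) x then ennreal (P (x i) (x (i + 1))) else 0) =
      emeasure \<pi> {y} * (if x = move \<Lambda> (i + 1) i y then ennreal (Q (y i) (y (i + 1))) else 0)"
    if "x \<in> \<Lambda> \<rightarrow>\<^sub>E I" "y \<in> \<Lambda> \<rightarrow>\<^sub>E I" for x y
    using bulk_balance[OF assms(1) that(1)] that(2) move_eq_iff[of y \<Lambda> i "i + 1" x] by auto
  from this[OF assms(2,3)] this[OF assms(3,2)] show ?thesis
    by (simp add: bulk_rate_def distrib_left add.commute)
qed

lemma reservoir_rate_balance:
  fixes \<alpha> \<beta> :: "int \<Rightarrow> real"
  assumes "i \<in> \<Lambda>" "j \<notin> \<Lambda>" "x \<in> \<Lambda> \<rightarrow>\<^sub>E I" "y \<in> \<Lambda> \<rightarrow>\<^sub>E I"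
    and "\<And>z. z \<in> I \<Longrightarrow> 0 \<le> \<alpha> z" "\<And>z. z \<in> I \<Longrightarrow> 0 \<le> \<beta> z"
    and "\<And>z. z \<in> I \<Longrightarrow> Fin z \<noteq> wmax \<Longrightarrow> \<beta> (z + 1) = \<alpha> z * f (z + 1) / exp (\<theta> i)"
  shows "emeasure \<pi> {x} * reservoir_rate L R \<alpha> \<beta> j i x y = emeasure \<pi> {y} * reservoir_rate L R \<alpha> \<beta> j i y x"
proof -
  have "emeasure \<pi> {x} * (if y = move \<Lambda> j i x then ennreal (\<alpha> (x i)) else 0) =
      emeasure \<pi> {y} * (if x = move \<Lambda> i j y then ennreal (\<beta> (y i)) else 0)"
    if "x \<in> \<Lambda> \<rightarrow>\<^sub>E I" "y \<in> \<Lambda> \<rightarrow>\<^sub>E I" for x y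
    using reservoir_balance[OF assms(1,2) that(1) _ assms(5-7)] that(2) move_eq_iff[of y \<Lambda> j i x]
    by auto
  from this[OF assms(3,4)] this[OF assms(4,3)] show ?thesis
    by (simp add: reservoir_rate_def distrib_left add.commute)
qed

lemma left_outside: "L = Fin l \<Longrightarrow> l - 1 \<notin> \<Lambda>" and right_outside: "R = Fin r \<Longrightarrow> r + 1 \<notin> \<Lambda>"
  by (auto simp: int_interval_def)

text \<open>
  Balance holds mechanism by mechanism: for every edge and for each reservoir, the two possible
  jumps of the mechanism are the reverses of each other. This is also correct if several mechanisms
  lead from \<open>x\<close> to \<open>y\<close>.
\<close>

lemma rate_balance:
  assumes "x \<in> \<Omega>" "y \<in> \<Omega>"
  shows "emeasure \<pi> {x} * rate x y = emeasure \<pi> {y} * rate y x"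
proof -
  have x: "x \<in> \<Lambda> \<rightarrow>\<^sub>E I" and y: "y \<in> \<Lambda> \<rightarrow>\<^sub>E I"
    using assms state_space_subset by auto
  have "emeasure \<pi> {x} * (\<integral>\<^sup>+i. bulk_rate L R P Q x y i \<partial>count_space edges) =
      emeasure \<pi> {y} * (\<integral>\<^sup>+i. bulk_rate L R P Q y x i \<partial>count_space edges)"
    by (subst (1 2) nn_integral_cmult[symmetric]) (auto intro!: nn_integral_cong bulk_rate_balance x y)
  moreover have "emeasure \<pi> {x} * left_rate x y = emeasure \<pi> {y} * left_rate y x"
  proof (cases "\<exists>l. L = Fin l")
    case True
    then obtain l where Fin: "L = Fin l" ..
    show ?thesis
      unfolding left_rate_Fin[OF Fin]
      by (rule reservoir_rate_balance[OF left_in_\<Lambda>[OF Fin] left_outside[OF Fin] x y left_reservoir[OF Fin]])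
  qed (simp add: left_rate_infinite)
  moreover have "emeasure \<pi> {x} * right_rate x y = emeasure \<pi> {y} * right_rate y x"
  proof (cases "\<exists>r. R = Fin r")
    case True
    then obtain r where Fin: "R = Fin r" ..
    show ?thesis
      unfolding right_rate_Fin[OF Fin]
      by (rule reservoir_rate_balance[OF right_in_\<Lambda>[OF Fin] right_outside[OF Fin] x y right_reservoir[OF Fin]])
  qed (simp add: right_rate_infinite)
  ultimately show ?thesis
    by (simp add: rate_eq distrib_left)
qed

section \<open>The mean total jump rate\<close>

abbreviation rem :: "int \<Rightarrow> ennreal" where "rem i \<equiv> mean_removal (\<theta> i)"
abbreviation ins :: "int \<Rightarrow> ennreal" where "ins i \<equiv> mean_insertion (\<theta> i)"

lemma nn_integral_coordinate:
  fixes g :: "int \<Rightarrow> ennreal"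
  assumes "i \<in> \<Lambda>"
  shows "(\<integral>\<^sup>+x. g (x i) \<partial>\<pi>) = (\<integral>\<^sup>+z. g z \<partial>\<mu> i)"
proof -
  have "(\<integral>\<^sup>+z. g z \<partial>distr \<pi> (\<mu> i) (\<lambda>x. x i)) = (\<integral>\<^sup>+x. g (x i) \<partial>\<pi>)"
    using assms measurable_\<mu>[OF assms, of g] by (intro nn_integral_distr) (simp_all add: measurable_component_singleton)
  then show ?thesis
    by (simp add: PiM_component assms)
qed

lemma nn_integral_two_coordinates:
  fixes g h :: "int \<Rightarrow> ennreal"
  assumes "i \<in> \<Lambda>" "j \<in> \<Lambda>" "i \<noteq> j"
  shows "(\<integral>\<^sup>+x. g (x i) * h (x j) \<partial>\<pi>) = (\<integral>\<^sup>+z. g z \<partial>\<mu> i) * (\<integral>\<^sup>+z. h z \<partial>\<mu> j)"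
proof -
  define k where "k l = (if l = i then g else h)" for l
  have meas: "(\<lambda>x. \<Prod>l\<in>{i, j}. k l (x l)) \<in> borel_measurable (PiM {i, j} \<mu>)"
  proof (intro borel_measurable_prod_ennreal)
    fix l assume l: "l \<in> {i, j}"
    have "k l \<in> borel_measurable (\<mu> l)"
      using l assms by (intro measurable_\<mu>) auto
    then show "(\<lambda>x. k l (x l)) \<in> borel_measurable (PiM {i, j} \<mu>)"
      by (rule measurable_compose[OF measurable_component_singleton[OF l]])
  qed
  have "(\<integral>\<^sup>+x. g (x i) * h (x j) \<partial>\<pi>) = (\<integral>\<^sup>+x. (\<Prod>l\<in>{i, j}. k l (restrict x {i, j} l)) \<partial>\<pi>)"
    using assms by (simp add: k_def)
  also have "\<dots> = (\<integral>\<^sup>+x. (\<Prod>l\<in>{i, j}. k l (x l)) \<partial>distr \<pi> (PiM {i, j} \<mu>) (\<lambda>x. restrict x {i, j}))"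
  proof (rule nn_integral_distr[symmetric])
    show "(\<lambda>x. restrict x {i, j}) \<in> measurable \<pi> (PiM {i, j} \<mu>)"
      using assms by (intro measurable_restrict_subset) auto
  qed (simp only: measurable_distr_eq1 meas)
  also have "\<dots> = (\<integral>\<^sup>+x. (\<Prod>l\<in>{i, j}. k l (x l)) \<partial>PiM {i, j} \<mu>)"
    using assms by (subst distr_PiM_restrict_finite) auto
  also have "\<dots> = (\<Prod>l\<in>{i, j}. \<integral>\<^sup>+z. k l z \<partial>\<mu> l)"
    using assms by (intro product_nn_integral_prod measurable_\<mu>) auto
  also have "\<dots> = (\<integral>\<^sup>+z. g z \<partial>\<mu> i) * (\<integral>\<^sup>+z. h z \<partial>\<mu> j)"
    using assms by (simp add: k_def)
  finally show ?thesis .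
qed

lemma mean_\<mu>:
  assumes "i \<in> \<Lambda>"
  shows "(\<integral>\<^sup>+z. ennreal (removal z) \<partial>\<mu> i) = rem i" "(\<integral>\<^sup>+z. ennreal (insertion z) \<partial>\<mu> i) = ins i"
  using assms by (simp_all add: \<mu>_def mean_removal_def mean_insertion_def)

lemma mean_finite: "i \<in> \<Lambda> \<Longrightarrow> rem i < top" "i \<in> \<Lambda> \<Longrightarrow> ins i < top"
  using site.mean_removal_finite[OF theta_site] site.mean_insertion_finite[OF theta_site] by auto

lemma exp_theta_shift: "exp (\<theta> (i + int n)) = exp (\<theta> i) * (p / q) ^ n"
proof (induction n)
  case (Suc n)
  then show ?case
    using exp_theta[of "i + int n"] by (simp add: add.assoc add.commute[of 1] mult_ac)
qed simp

lemma exp_theta_right: "exp (- \<theta> (int n)) = exp (- \<theta> 0) * (q / p) ^ n"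
  using exp_theta_shift[of 0 n] p_pos q_pos by (simp add: exp_minus power_divide field_simps)

lemma exp_theta_left: "exp (\<theta> (- int n)) = exp (\<theta> 0) * (q / p) ^ n"
  using exp_theta_shift[of "- int n" n] p_pos q_pos by (simp add: power_divide field_simps)

lemma theta_mono: "exp (\<theta> i) \<le> exp (\<theta> (i + 1))"
proof -
  have "1 \<le> p / q" using q_less_p q_pos by simp
  from mult_left_mono[OF this, of "exp (\<theta> i)"] show ?thesis
    by (simp add: exp_theta)
qed

lemma ratio: "0 \<le> q / p" "q / p < 1"
  using p_pos q_pos q_less_p by auto

lemma ennreal_mult_le:
  assumes "x \<le> ennreal a" "y \<le> ennreal b" "0 \<le> b"
  shows "x * y \<le> ennreal (a * b)"
  using mult_mono[OF assms(1,2)] assms(3) by (simp add: ennreal_mult'')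

lemma min_ratio_nonneg:
  assumes "wmin = Fin M"
  shows "0 \<le> f 1 / f (M + 1)"
proof -
  have "M + 1 \<in> I"
    using assms site_values one_in_I zero_in_I by (cases wmax) (auto simp: int_interval_def)
  then show ?thesis
    using f_nonneg one_in_I by simp
qed

text \<open>
  If the volume is infinite to the right, then \<open>ins i\<close> decreases like \<open>exp (- \<theta> i)\<close>, that is
  like \<open>(q / p) ^ i\<close>, and \<open>rem i\<close> is bounded.
\<close>

lemma right_mean_rates_summable:
  assumes "edges \<inter> {0..} = E"
  shows "(\<integral>\<^sup>+i. rem i * ins (i + 1) + ins i * rem (i + 1) \<partial>count_space E) < top"
proof (cases R)
  case (Fin r)
  then have "edges \<inter> {0..} \<subseteq> {0..r}" unfolding edges_def by auto
  then have fin: "finite E" using assms finite_subset by auto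
  have "rem i * ins (i + 1) + ins i * rem (i + 1) < top" if "i \<in> E" for i
    using that assms edge_in_\<Lambda>[of i] by (auto simp: ennreal_mult_less_top mean_finite)
  then show ?thesis
    using fin by (simp add: nn_integral_count_space_finite)
next
  case Minf
  then show ?thesis using volume by simp
next
  case Pinf
  then obtain M where M: "wmax = Fin M"
    using right_infinite site_values by (cases wmax) auto
  have E: "E = range int"
    unfolding assms[symmetric] edges_def using Pinf volume
    by (cases L) (auto simp: image_iff intro: zero_le_imp_eq_int)
  have fM: "0 \<le> f M"
    using M site_values order_trans[of wmin "Fin 0" "Fin M"]
    by (intro f_nonneg) (auto simp: int_interval_def)
  show ?thesis
    unfolding E
  proof (rule nn_integral_geometric_finite[OF _ ratio, where b = "2 * f M * f M * exp (- \<theta> 0)"])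
    fix n
    let ?i = "int n"
    have "?i \<in> edges" using E assms by blast
    note i = edge_in_\<Lambda>[OF this]
    have rem: "rem j \<le> ennreal (f M)" if "j \<in> \<Lambda>" for j
      using site.means_le_if_bounded_above(1)[OF theta_site M] that by simp
    have ins: "ins j \<le> ennreal (f M * exp (- \<theta> ?i))" if "j \<in> {?i, ?i + 1}" for j
    proof -
      have "exp (- \<theta> j) \<le> exp (- \<theta> ?i)"
        using that theta_mono[of ?i] by auto
      then have "ennreal (f M) * ennreal (exp (- \<theta> j)) \<le> ennreal (f M * exp (- \<theta> ?i))"
        using fM by (auto simp flip: ennreal_mult' intro!: ennreal_leI mult_left_mono)
      moreover have "ins j \<le> ennreal (f M) * ennreal (exp (- \<theta> j))"
        using site.means_le_if_bounded_above(2)[OF theta_site M, of j] that i by auto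
      ultimately show ?thesis by (rule order_trans[rotated])
    qed
    have "rem ?i * ins (?i + 1) + ins ?i * rem (?i + 1)
        \<le> ennreal (f M * (f M * exp (- \<theta> ?i))) + ennreal (f M * exp (- \<theta> ?i) * f M)"
      using i fM by (intro add_mono ennreal_mult_le rem ins) auto
    also have "\<dots> = ennreal (2 * f M * f M * exp (- \<theta> 0) * (q / p) ^ n)"
      using fM ratio(1) by (subst ennreal_plus[symmetric]) (auto simp: exp_theta_right mult_ac)
    finally show "rem ?i * ins (?i + 1) + ins ?i * rem (?i + 1) \<le> \<dots>" .
  qed (use fM in auto)
qed

text \<open>
  If the volume is infinite to the left, then \<open>rem i\<close> decreases like \<open>exp (\<theta> i)\<close>, and \<open>ins i\<close> is
  bounded.
\<close>

lemma left_mean_rates_summable: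
  assumes "edges \<inter> {..<0} = E"
  shows "(\<integral>\<^sup>+i. rem i * ins (i + 1) + ins i * rem (i + 1) \<partial>count_space E) < top"
proof (cases L)
  case (Fin l)
  then have "edges \<inter> {..<0} \<subseteq> {l..0}" unfolding edges_def by auto
  then have fin: "finite E" using assms finite_subset by auto
  have "rem i * ins (i + 1) + ins i * rem (i + 1) < top" if "i \<in> E" for i
    using that assms edge_in_\<Lambda>[of i] by (auto simp: ennreal_mult_less_top mean_finite)
  then show ?thesis
    using fin by (simp add: nn_integral_count_space_finite)
next
  case Pinf
  then show ?thesis using volume by simp
next
  case Minf
  then obtain M where M: "wmin = Fin M"
    using left_infinite site_values by (cases wmin) auto
  have E: "E = range (\<lambda>n. - int n - 1)"
  proof -
    have "E = {..<0}"
      unfolding assms[symmetric] edges_def using Minf volume by (cases R) auto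
    also have "\<dots> = range (\<lambda>n. - int n - 1)"
    proof (intro subset_antisym subsetI)
      fix i :: int assume "i \<in> {..<0}"
      then have "i = - int (nat (- i - 1)) - 1" by simp
      then show "i \<in> range (\<lambda>n. - int n - 1)" by blast
    qed auto
    finally show ?thesis .
  qed
  define b where "b = f 1 / f (M + 1)"
  have b: "0 \<le> b"
    unfolding b_def by (rule min_ratio_nonneg[OF M])
  show ?thesis
    unfolding E
  proof (rule nn_integral_geometric_finite[OF _ ratio, where b = "2 * b * b * exp (\<theta> 0)"])
    fix n
    let ?i = "- int n - 1"
    have "?i \<in> edges" using E assms by blast
    note i = edge_in_\<Lambda>[OF this]
    have ins: "ins j \<le> ennreal b" if "j \<in> \<Lambda>" for j
      using site.means_le_if_bounded_below(2)[OF theta_site M] that by (simp add: b_def)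
    have rem: "rem j \<le> ennreal (b * exp (\<theta> (- int n)))" if "j \<in> {?i, ?i + 1}" for j
    proof -
      have "exp (\<theta> j) \<le> exp (\<theta> (- int n))"
        using that theta_mono[of ?i] by auto
      then have "ennreal b * ennreal (exp (\<theta> j)) \<le> ennreal (b * exp (\<theta> (- int n)))"
        using b by (auto simp flip: ennreal_mult' intro!: ennreal_leI mult_left_mono)
      moreover have "rem j \<le> ennreal b * ennreal (exp (\<theta> j))"
        using site.means_le_if_bounded_below(1)[OF theta_site M, of j] that i by (auto simp: b_def)
      ultimately show ?thesis by (rule order_trans[rotated])
    qed
    have "rem ?i * ins (?i + 1) + ins ?i * rem (?i + 1)
        \<le> ennreal (b * exp (\<theta> (- int n)) * b) + ennreal (b * (b * exp (\<theta> (- int n))))"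
      using i b by (intro add_mono ennreal_mult_le rem ins) auto
    also have "\<dots> = ennreal (2 * b * b * exp (\<theta> 0) * (q / p) ^ n)"
      using b ratio(1) by (subst ennreal_plus[symmetric]) (auto simp: exp_theta_left mult_ac)
    finally show "rem ?i * ins (?i + 1) + ins ?i * rem (?i + 1) \<le> \<dots>" .
  qed (use b in \<open>auto simp: inj_on_def\<close>)
qed

lemma mean_rates_summable:
  "(\<integral>\<^sup>+i. rem i * ins (i + 1) + ins i * rem (i + 1) \<partial>count_space edges) < top"
proof -
  let ?g = "\<lambda>i. rem i * ins (i + 1) + ins i * rem (i + 1)"
  have "(\<integral>\<^sup>+i. ?g i \<partial>count_space edges) =
      (\<integral>\<^sup>+i. ?g i * indicator (edges \<inter> {0..}) i + ?g i * indicator (edges \<inter> {..<0}) i \<partial>count_space UNIV)"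
    by (subst nn_integral_count_space_indicator) (auto intro!: nn_integral_cong simp: indicator_def)
  also have "\<dots> = (\<integral>\<^sup>+i. ?g i \<partial>count_space (edges \<inter> {0..})) + (\<integral>\<^sup>+i. ?g i \<partial>count_space (edges \<inter> {..<0}))"
    by (subst nn_integral_add) (auto simp: nn_integral_count_space_indicator)
  also have "\<dots> < top"
    using right_mean_rates_summable[OF refl] left_mean_rates_summable[OF refl] by simp
  finally show ?thesis .
qed

text \<open>
  Bounds for the total rate of the jumps over the edge from \<open>i\<close> to \<open>i + 1\<close> and of the jumps to and from a
  reservoir at site \<open>i\<close>. In contrast to the rates, they depend on each coordinate through a separate
  factor.
\<close>

definition edge_bound :: "int \<Rightarrow> (int \<Rightarrow> int) \<Rightarrow> ennreal" where
  "edge_bound i x = ennreal (s 1 1) * (ennreal (removal (x i)) * ennreal (insertion (x (i + 1)))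
     + ennreal (insertion (x i)) * ennreal (removal (x (i + 1))))"

definition site_bound :: "real \<Rightarrow> int \<Rightarrow> (int \<Rightarrow> int) \<Rightarrow> ennreal" where
  "site_bound a i x = ennreal a * ennreal (insertion (x i)) + ennreal (a / exp (\<theta> i)) * ennreal (removal (x i))"

lemma edge_bound_measurable: "i \<in> edges \<Longrightarrow> edge_bound i \<in> borel_measurable \<pi>"
  unfolding edge_bound_def[abs_def] using edge_in_\<Lambda>[of i]
  by (intro borel_measurable_times_ennreal borel_measurable_add borel_measurable_const measurable_coordinate) auto

lemma site_bound_measurable: "i \<in> \<Lambda> \<Longrightarrow> site_bound a i \<in> borel_measurable \<pi>"
  unfolding site_bound_def[abs_def]
  by (intro borel_measurable_times_ennreal borel_measurable_add borel_measurable_const measurable_coordinate) auto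

lemma mean_edge_bound:
  assumes "i \<in> edges"
  shows "(\<integral>\<^sup>+x. edge_bound i x \<partial>\<pi>) = ennreal (s 1 1) * (rem i * ins (i + 1) + ins i * rem (i + 1))"
proof -
  note i = edge_in_\<Lambda>[OF assms]
  note meas = borel_measurable_times_ennreal borel_measurable_add measurable_coordinate[of _ "\<lambda>z. ennreal (_ z)"]
  show ?thesis
    unfolding edge_bound_def using i
    by (subst nn_integral_cmult, (intro meas; simp), subst nn_integral_add)
       (auto simp: nn_integral_two_coordinates[of _ _ "\<lambda>z. ennreal (_ z)" "\<lambda>z. ennreal (_ z)"] mean_\<mu> intro!: meas)
qed

lemma mean_site_bound:
  assumes "i \<in> \<Lambda>"
  shows "(\<integral>\<^sup>+x. site_bound a i x \<partial>\<pi>) < top"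
proof -
  have [measurable]: "(\<lambda>x. ennreal (g (x i))) \<in> borel_measurable \<pi>" for g :: "int \<Rightarrow> real"
    using measurable_coordinate[OF assms, of "\<lambda>z. ennreal (g z)"] .
  have "(\<integral>\<^sup>+x. site_bound a i x \<partial>\<pi>) = ennreal a * ins i + ennreal (a / exp (\<theta> i)) * rem i"
    unfolding site_bound_def
    by (simp add: nn_integral_add nn_integral_cmult mean_\<mu> assms
        nn_integral_coordinate[OF assms, of "\<lambda>z. ennreal (_ z)"])
  then show ?thesis
    using mean_finite[OF assms] by (simp add: ennreal_mult_less_top)
qed

lemma sum_bulk_rate_le:
  assumes "i \<in> edges" "x \<in> \<Lambda> \<rightarrow>\<^sub>E I"
  shows "(\<integral>\<^sup>+y. bulk_rate L R P Q x y i \<partial>count_space S) \<le> edge_bound i x"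
proof -
  have I: "x i \<in> I" "x (i + 1) \<in> I"
    using assms edge_in_\<Lambda>[OF assms(1)] by (metis PiE_mem)+
  have s11: "0 \<le> s 1 1"
    using s_nonneg one_in_I by simp
  have "(\<integral>\<^sup>+y. bulk_rate L R P Q x y i \<partial>count_space S)
      \<le> ennreal (P (x i) (x (i + 1))) + ennreal (Q (x i) (x (i + 1)))"
    unfolding bulk_rate_def
    by (subst nn_integral_add) (auto intro!: add_mono nn_integral_single_target_le)
  also have "\<dots> \<le> ennreal (s 1 1 * (removal (x i) * insertion (x (i + 1))))
      + ennreal (s 1 1 * (insertion (x i) * removal (x (i + 1))))"
    using bulk_rate_le[OF I] by (intro add_mono ennreal_leI) auto
  also have "\<dots> = edge_bound i x"
    using s11 removal_nonneg I insertion_nonneg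
    by (simp add: edge_bound_def ennreal_mult distrib_left)
  finally show ?thesis .
qed

lemma sum_reservoir_rate_le:
  fixes \<alpha> \<beta> :: "int \<Rightarrow> real"
  assumes nonneg: "\<And>z. z \<in> I \<Longrightarrow> 0 \<le> \<alpha> z"
    and bounds: "\<alpha> (x i) \<le> \<alpha> 0 * insertion (x i)" "\<beta> (x i) \<le> \<alpha> 0 / exp (\<theta> i) * removal (x i)"
  shows "(\<integral>\<^sup>+y. reservoir_rate L R \<alpha> \<beta> j i x y \<partial>count_space S) \<le> site_bound (\<alpha> 0) i x"
proof -
  have "(\<integral>\<^sup>+y. reservoir_rate L R \<alpha> \<beta> j i x y \<partial>count_space S) \<le> ennreal (\<alpha> (x i)) + ennreal (\<beta> (x i))"
    unfolding reservoir_rate_def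
    by (subst nn_integral_add) (auto intro!: add_mono nn_integral_single_target_le)
  also have "\<dots> \<le> ennreal (\<alpha> 0 * insertion (x i)) + ennreal (\<alpha> 0 / exp (\<theta> i) * removal (x i))"
    using bounds by (intro add_mono ennreal_leI) auto
  also have "\<dots> = site_bound (\<alpha> 0) i x"
    using nonneg[OF zero_in_I] by (simp add: site_bound_def ennreal_mult' del: times_divide_eq_left)
  finally show ?thesis .
qed

definition left_bound :: "(int \<Rightarrow> int) \<Rightarrow> ennreal" where
  "left_bound x = (case L of Fin l \<Rightarrow> site_bound (PL 0) l x | _ \<Rightarrow> 0)"

definition right_bound :: "(int \<Rightarrow> int) \<Rightarrow> ennreal" where
  "right_bound x = (case R of Fin r \<Rightarrow> site_bound (QR 0) r x | _ \<Rightarrow> 0)"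

lemma left_bound_Fin: "L = Fin l \<Longrightarrow> left_bound x = site_bound (PL 0) l x"
  unfolding left_bound_def by simp

lemma left_bound_infinite: "\<nexists>l. L = Fin l \<Longrightarrow> left_bound x = 0"
  unfolding left_bound_def by (cases L) auto

lemma sum_left_rate_le:
  assumes "x \<in> \<Lambda> \<rightarrow>\<^sub>E I"
  shows "(\<integral>\<^sup>+y. left_rate x y \<partial>count_space S) \<le> left_bound x"
proof (cases "\<exists>l. L = Fin l")
  case True
  then obtain l where Fin: "L = Fin l" ..
  have I: "x l \<in> I" using assms left_in_\<Lambda>[OF Fin] by (metis PiE_mem)
  have "PL (x l) \<le> PL 0 * insertion (x l)" "QL (x l) \<le> PL 0 / exp (\<theta> l) * removal (x l)"
    by (rule reservoir_rate_le[of PL QL "\<theta> l" "x l"];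
        use I left_reservoir[OF Fin] left_attractive left_zero_min left_zero_max Fin in auto)+
  then show ?thesis
    using sum_reservoir_rate_le[of PL x l QL S "l - 1"] left_reservoir(1)[OF Fin]
    by (simp add: left_rate_Fin[OF Fin] left_bound_Fin[OF Fin])
qed (simp add: left_rate_infinite)

lemma right_bound_Fin: "R = Fin r \<Longrightarrow> right_bound x = site_bound (QR 0) r x"
  unfolding right_bound_def by simp

lemma right_bound_infinite: "\<nexists>r. R = Fin r \<Longrightarrow> right_bound x = 0"
  unfolding right_bound_def by (cases R) auto

lemma sum_right_rate_le:
  assumes "x \<in> \<Lambda> \<rightarrow>\<^sub>E I"
  shows "(\<integral>\<^sup>+y. right_rate x y \<partial>count_space S) \<le> right_bound x"
proof (cases "\<exists>r. R = Fin r")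
  case True
  then obtain r where Fin: "R = Fin r" ..
  have I: "x r \<in> I" using assms right_in_\<Lambda>[OF Fin] by (metis PiE_mem)
  have "QR (x r) \<le> QR 0 * insertion (x r)" "PR (x r) \<le> QR 0 / exp (\<theta> r) * removal (x r)"
    by (rule reservoir_rate_le[of QR PR "\<theta> r" "x r"];
        use I right_reservoir[OF Fin] right_attractive right_zero_min right_zero_max Fin in auto)+
  then show ?thesis
    using sum_reservoir_rate_le[of QR x r PR S "r + 1"] right_reservoir(1)[OF Fin]
    by (simp add: right_rate_Fin[OF Fin] right_bound_Fin[OF Fin])
qed (simp add: right_rate_infinite)

lemma boundary_bounds:
  "left_bound \<in> borel_measurable \<pi>" "right_bound \<in> borel_measurable \<pi>"
  "(\<integral>\<^sup>+x. left_bound x \<partial>\<pi>) < top" "(\<integral>\<^sup>+x. right_bound x \<partial>\<pi>) < top"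
proof -
  have "left_bound \<in> borel_measurable \<pi> \<and> (\<integral>\<^sup>+x. left_bound x \<partial>\<pi>) < top"
  proof (cases "\<exists>l. L = Fin l")
    case True
    then obtain l where Fin: "L = Fin l" ..
    have "left_bound = site_bound (PL 0) l" by (rule ext) (rule left_bound_Fin[OF Fin])
    then show ?thesis
      using site_bound_measurable mean_site_bound left_in_\<Lambda>[OF Fin] by simp
  next
    case False
    have "left_bound = (\<lambda>_. 0)" by (rule ext) (rule left_bound_infinite[OF False])
    then show ?thesis by simp
  qed
  then show "left_bound \<in> borel_measurable \<pi>" "(\<integral>\<^sup>+x. left_bound x \<partial>\<pi>) < top" by simp_all
  have "right_bound \<in> borel_measurable \<pi> \<and> (\<integral>\<^sup>+x. right_bound x \<partial>\<pi>) < top"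
  proof (cases "\<exists>r. R = Fin r")
    case True
    then obtain r where Fin: "R = Fin r" ..
    have "right_bound = site_bound (QR 0) r" by (rule ext) (rule right_bound_Fin[OF Fin])
    then show ?thesis
      using site_bound_measurable mean_site_bound right_in_\<Lambda>[OF Fin] by simp
  next
    case False
    have "right_bound = (\<lambda>_. 0)" by (rule ext) (rule right_bound_infinite[OF False])
    then show ?thesis by simp
  qed
  then show "right_bound \<in> borel_measurable \<pi>" "(\<integral>\<^sup>+x. right_bound x \<partial>\<pi>) < top" by simp_all
qed

lemma singleton_in_sets: "x \<in> \<Omega> \<Longrightarrow> {x} \<in> sets \<pi>"
  using point_limit(1) state_space_subset by blast

text \<open>
  Every rate is replaced by its bound, sums over targets, edges and configurations are exchanged,
  and independence of the coordinates reduces the claim to \<open>mean_rates_summable\<close>.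
\<close>

lemma mean_total_rate_finite:
  "(\<integral>\<^sup>+x. emeasure \<pi> {x} * (\<Sum>\<^sub>\<infinity>y\<in>\<Omega> - {x}. rate x y) \<partial>count_space \<Omega>) < top"
proof -
  note le_mean = nn_integral_point_masses_le[OF countable_\<Omega> singleton_in_sets]
  let ?bound = "\<lambda>x. (\<integral>\<^sup>+i. edge_bound i x \<partial>count_space edges) + left_bound x + right_bound x"
  have bound_measurable: "(\<lambda>x. \<integral>\<^sup>+i. edge_bound i x \<partial>count_space edges) \<in> borel_measurable \<pi>"
    "left_bound \<in> borel_measurable \<pi>" "right_bound \<in> borel_measurable \<pi>"
    using boundary_bounds by (auto intro!: measurable_nn_integral_count_space edge_bound_measurable)
  have total_le: "(\<Sum>\<^sub>\<infinity>y\<in>\<Omega> - {x}. rate x y) \<le> ?bound x" if "x \<in> \<Omega>" for x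
  proof -
    have x: "x \<in> \<Lambda> \<rightarrow>\<^sub>E I" using that state_space_subset by blast
    let ?S = "count_space (\<Omega> - {x})"
    have "(\<integral>\<^sup>+y. \<integral>\<^sup>+i. bulk_rate L R P Q x y i \<partial>count_space edges \<partial>?S) =
        (\<integral>\<^sup>+i. \<integral>\<^sup>+y. bulk_rate L R P Q x y i \<partial>?S \<partial>count_space edges)"
      by (rule nn_integral_count_space_nn_integral) auto
    also have "\<dots> \<le> (\<integral>\<^sup>+i. edge_bound i x \<partial>count_space edges)"
      using sum_bulk_rate_le[OF _ x] by (intro nn_integral_mono) simp
    finally have bulk: "(\<integral>\<^sup>+y. \<integral>\<^sup>+i. bulk_rate L R P Q x y i \<partial>count_space edges \<partial>?S) \<le> \<dots>" .
    have "(\<Sum>\<^sub>\<infinity>y\<in>\<Omega> - {x}. rate x y) = (\<integral>\<^sup>+y. rate x y \<partial>?S)"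
      using countable_\<Omega> by (intro infsum_eq_nn_integral_count_space) auto
    also have "\<dots> = (\<integral>\<^sup>+y. \<integral>\<^sup>+i. bulk_rate L R P Q x y i \<partial>count_space edges \<partial>?S) +
        (\<integral>\<^sup>+y. left_rate x y \<partial>?S) + (\<integral>\<^sup>+y. right_rate x y \<partial>?S)"
      by (simp add: rate_eq nn_integral_add)
    also have "\<dots> \<le> ?bound x"
      by (intro add_mono bulk sum_left_rate_le[OF x] sum_right_rate_le[OF x])
    finally show ?thesis .
  qed
  have "(\<integral>\<^sup>+x. \<integral>\<^sup>+i. edge_bound i x \<partial>count_space edges \<partial>\<pi>)
      = (\<integral>\<^sup>+i. \<integral>\<^sup>+x. edge_bound i x \<partial>\<pi> \<partial>count_space edges)"
    by (rule nn_integral_count_space_nn_integral) (auto intro: edge_bound_measurable)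
  also have "\<dots> = (\<integral>\<^sup>+i. ennreal (s 1 1) * (rem i * ins (i + 1) + ins i * rem (i + 1)) \<partial>count_space edges)"
    by (intro nn_integral_cong mean_edge_bound) simp
  also have "\<dots> = ennreal (s 1 1) * (\<integral>\<^sup>+i. rem i * ins (i + 1) + ins i * rem (i + 1) \<partial>count_space edges)"
    by (rule nn_integral_cmult) simp
  finally have mean_edges: "(\<integral>\<^sup>+x. \<integral>\<^sup>+i. edge_bound i x \<partial>count_space edges \<partial>\<pi>) = \<dots>" .
  have "(\<integral>\<^sup>+x. emeasure \<pi> {x} * (\<Sum>\<^sub>\<infinity>y\<in>\<Omega> - {x}. rate x y) \<partial>count_space \<Omega>)
      \<le> (\<integral>\<^sup>+x. emeasure \<pi> {x} * ?bound x \<partial>count_space \<Omega>)"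
    by (intro nn_integral_mono mult_left_mono total_le) auto
  also have "\<dots> \<le> (\<integral>\<^sup>+x. ?bound x \<partial>\<pi>)"
    using bound_measurable by (intro le_mean) auto
  also have "\<dots> = (\<integral>\<^sup>+x. \<integral>\<^sup>+i. edge_bound i x \<partial>count_space edges \<partial>\<pi>) +
      (\<integral>\<^sup>+x. left_bound x \<partial>\<pi>) + (\<integral>\<^sup>+x. right_bound x \<partial>\<pi>)"
    using bound_measurable by (simp add: nn_integral_add)
  also have "\<dots> = ennreal (s 1 1) * (\<integral>\<^sup>+i. rem i * ins (i + 1) + ins i * rem (i + 1) \<partial>count_space edges) +
      (\<integral>\<^sup>+x. left_bound x \<partial>\<pi>) + (\<integral>\<^sup>+x. right_bound x \<partial>\<pi>)"
    by (simp only: mean_edges)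
  also have "\<dots> < top"
    using mean_rates_summable boundary_bounds by (simp add: ennreal_mult_less_top)
  finally show ?thesis .
qed

section \<open>Concentration on the state space\<close>

text \<open>
  Borel--Cantelli along a sequence of sites.
\<close>

lemma eventually_extreme:
  fixes e :: "nat \<Rightarrow> int"
  assumes e: "\<And>n. e n \<in> \<Lambda>" and bad: "\<And>n. emeasure (\<mu> (e n)) {z \<in> I. \<not> good z} \<le> ennreal (b * (q / p) ^ n)" "0 \<le> b"
  shows "AE x in \<pi>. \<forall>\<^sub>F n in sequentially. good (x (e n))"
proof -
  define A where "A n = {x \<in> space \<pi>. x (e n) \<in> {z \<in> I. \<not> good z}}" for n
  have A: "A n \<in> sets \<pi>" for n
    unfolding A_def using e by (intro sets_Collect_single) (auto simp: sets_\<mu>)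
  have A_le: "emeasure \<pi> (A n) \<le> ennreal (b * (q / p) ^ n)" for n
    using emeasure_PiM_Collect_single[OF e, of "{z \<in> I. \<not> good z}" n] bad(1)[of n] e
    by (simp add: A_def sets_\<mu>)
  have "(\<Sum>n. emeasure \<pi> (A n)) < top"
    by (rule suminf_geometric_finite[OF ratio bad(2) A_le])
  then have "summable (\<lambda>n. measure \<pi> (A n))"
    by (intro summable_suminf_not_top) (simp_all add: P.emeasure_eq_measure less_top)
  then have "AE x in \<pi>. \<forall>\<^sub>F n in sequentially. x \<in> space \<pi> - A n"
    using A by (intro borel_cantelli_AE1) (auto simp: P.emeasure_eq_measure)
  then show ?thesis
  proof (rule AE_mp, intro AE_I2 impI)
    fix x assume x: "x \<in> space \<pi>" and ev: "\<forall>\<^sub>F n in sequentially. x \<in> space \<pi> - A n"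
    have "x (e n) \<in> I" for n
      using x e[of n] by (auto simp: space_\<pi> PiE_iff)
    then show "\<forall>\<^sub>F n in sequentially. good (x (e n))"
      using ev x by (auto simp: A_def elim: eventually_mono)
  qed
qed

lemma AE_left: "AE x in \<pi>. \<exists>n. \<forall>i\<in>\<Lambda>. i < - n \<longrightarrow> i \<le> 0 \<longrightarrow> Fin (x i) = wmin"
proof (cases L)
  case (Fin l)
  then have "\<forall>i\<in>\<Lambda>. i < - (- l) \<longrightarrow> i \<le> 0 \<longrightarrow> Fin (x i) = wmin" for x
    by (auto simp: int_interval_def)
  then show ?thesis by (intro AE_I2 exI)
next
  case Pinf
  then show ?thesis using volume by simp
next
  case Minf
  then obtain M where M: "wmin = Fin M"
    using left_infinite site_values by (cases wmin) auto
  have \<Lambda>: "- int n \<in> \<Lambda>" for n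
    using Minf volume by (cases R) (auto simp: int_interval_def)
  define b where "b = f 1 / f (M + 1)"
  have b: "0 \<le> b"
    unfolding b_def by (rule min_ratio_nonneg[OF M])
  have "AE x in \<pi>. \<forall>\<^sub>F n in sequentially. Fin (x (- int n)) = wmin"
  proof (rule eventually_extreme[where b = "b / f 1 * exp (\<theta> 0)"])
    fix n
    let ?B = "emeasure (\<mu> (- int n)) {z \<in> I. Fin z \<noteq> wmin}"
    have "ennreal (f 1) * ?B \<le> rem (- int n)"
      using site.prob_not_extreme(2)[OF theta_site[OF \<Lambda>[of n]]] \<Lambda>[of n] by (simp add: \<mu>_def)
    also have "\<dots> \<le> ennreal b * ennreal (exp (\<theta> (- int n)))"
      unfolding b_def by (rule site.means_le_if_bounded_below(1)[OF theta_site[OF \<Lambda>] M])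
    finally have "ennreal (1 / f 1) * (ennreal (f 1) * ?B) \<le> ennreal (1 / f 1) * (ennreal b * ennreal (exp (\<theta> (- int n))))"
      by (rule mult_left_mono) simp
    also have "\<dots> = ennreal (b / f 1 * exp (\<theta> 0) * (q / p) ^ n)"
      using b f_one_pos by (simp add: exp_theta_left mult_ac flip: ennreal_mult')
    finally show "?B \<le> \<dots>"
      using f_one_pos by (simp add: mult.assoc[symmetric] flip: ennreal_mult')
  qed (use \<Lambda> b f_one_pos in auto)
  then show ?thesis
  proof (rule AE_mp, intro AE_I2 impI)
    fix x assume "\<forall>\<^sub>F n in sequentially. Fin (x (- int n)) = wmin"
    then obtain N where N: "\<And>n. N \<le> n \<Longrightarrow> Fin (x (- int n)) = wmin"
      by (auto simp: eventually_sequentially)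
    have "Fin (x i) = wmin" if "i < - int N" for i
      using N[of "nat (- i)"] that by simp
    then show "\<exists>n. \<forall>i\<in>\<Lambda>. i < - n \<longrightarrow> i \<le> 0 \<longrightarrow> Fin (x i) = wmin" by blast
  qed
qed

lemma AE_right: "AE x in \<pi>. \<exists>n. \<forall>i\<in>\<Lambda>. n < i \<longrightarrow> 1 \<le> i \<longrightarrow> Fin (x i) = wmax"
proof (cases R)
  case (Fin r)
  then have "\<forall>i\<in>\<Lambda>. r < i \<longrightarrow> 1 \<le> i \<longrightarrow> Fin (x i) = wmax" for x
    by (auto simp: int_interval_def)
  then show ?thesis by (intro AE_I2 exI)
next
  case Minf
  then show ?thesis using volume by simp
next
  case Pinf
  then obtain M where M: "wmax = Fin M"
    using right_infinite site_values by (cases wmax) auto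
  have \<Lambda>: "int n \<in> \<Lambda>" for n
    using Pinf volume by (cases L) (auto simp: int_interval_def)
  have fM: "0 \<le> f M"
    using M site_values order_trans[of wmin "Fin 0" "Fin M"]
    by (intro f_nonneg) (auto simp: int_interval_def)
  have "AE x in \<pi>. \<forall>\<^sub>F n in sequentially. Fin (x (int n)) = wmax"
  proof (rule eventually_extreme[where b = "f M * exp (- \<theta> 0)"])
    fix n
    have "emeasure (\<mu> (int n)) {z \<in> I. Fin z \<noteq> wmax} \<le> ins (int n)"
      using site.prob_not_extreme(1)[OF theta_site[OF \<Lambda>[of n]]] \<Lambda>[of n] by (simp add: \<mu>_def)
    also have "\<dots> \<le> ennreal (f M) * ennreal (exp (- \<theta> (int n)))"
      by (rule site.means_le_if_bounded_above(2)[OF theta_site[OF \<Lambda>] M])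
    also have "\<dots> = ennreal (f M * exp (- \<theta> 0) * (q / p) ^ n)"
      using fM by (simp add: exp_theta_right mult_ac flip: ennreal_mult')
    finally show "emeasure (\<mu> (int n)) {z \<in> I. Fin z \<noteq> wmax} \<le> \<dots>" .
  qed (use \<Lambda> fM in auto)
  then show ?thesis
  proof (rule AE_mp, intro AE_I2 impI)
    fix x assume "\<forall>\<^sub>F n in sequentially. Fin (x (int n)) = wmax"
    then obtain N where N: "\<And>n. N \<le> n \<Longrightarrow> Fin (x (int n)) = wmax"
      by (auto simp: eventually_sequentially)
    have "Fin (x i) = wmax" if "int N < i" for i
      using N[of "nat i"] that by simp
    then show "\<exists>n. \<forall>i\<in>\<Lambda>. n < i \<longrightarrow> 1 \<le> i \<longrightarrow> Fin (x i) = wmax" by blast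
  qed
qed

lemma concentrated: "distribution_on \<Omega> \<pi>"
proof -
  have sets: "\<Omega> \<in> sets \<pi>"
    by (rule sets.countable[OF singleton_in_sets countable_\<Omega>])
  have "AE x in \<pi>. x \<in> \<Omega>"
    using AE_left AE_right AE_space by eventually_elim (simp add: state_space_iff space_\<pi>)
  then have "emeasure \<pi> \<Omega> = 1"
    by (intro P.emeasure_eq_1_AE sets)
  then show ?thesis
    using sets P.prob_space_axioms by (simp add: distribution_on_def)
qed

lemma reversible_stationary:
  "stationary_distribution \<Omega> rate \<pi>" "reversible_distribution \<Omega> rate \<pi>"
  using reversible_stationary_if_mean_rate_finite[OF countable_\<Omega> concentrated]
    rate_balance mean_total_rate_finite by simp_all

end

theorem theorem3p1:
  fixes L R wmin wmax :: "int extended"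
    and P Q :: "int \<Rightarrow> int \<Rightarrow> real"
    and PL QL PR QR :: "int \<Rightarrow> real"
    and p q c :: real
    and f :: "int \<Rightarrow> real"
    and s :: "int \<Rightarrow> int \<Rightarrow> real"
    and \<theta> :: "int \<Rightarrow> real"
  assumes "blocking_system L R wmin wmax P Q PL QL PR QR p q f s"
    and "theta_min wmin f < ereal c" "ereal c < theta_max wmax f"
    and "\<And>i. \<theta> i = c + of_int i * (ln p - ln q)"
    and "\<And>i. i \<in> int_interval L R \<Longrightarrow>
           theta_min wmin f < ereal (\<theta> i) \<and> ereal (\<theta> i) < theta_max wmax f"
    and "\<And>l z. L = Fin l \<Longrightarrow> z \<in> int_interval wmin wmax \<Longrightarrow> Fin z \<noteq> wmax \<Longrightarrow>
           QL (z + 1) / PL z = f (z + 1) / exp (\<theta> l)"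
    and "\<And>r z. R = Fin r \<Longrightarrow> z \<in> int_interval wmin wmax \<Longrightarrow> Fin z \<noteq> wmax \<Longrightarrow>
           PR (z + 1) / QR z = f (z + 1) / exp (\<theta> r)"
  shows "distribution_on (state_space L R wmin wmax)
           (\<Pi>\<^sub>M i\<in>int_interval L R. marginal wmin wmax f (\<theta> i)) \<and>
         stationary_distribution (state_space L R wmin wmax) (jump_rate L R P Q PL QL PR QR)
           (\<Pi>\<^sub>M i\<in>int_interval L R. marginal wmin wmax f (\<theta> i)) \<and>
         reversible_distribution (state_space L R wmin wmax) (jump_rate L R P Q PL QL PR QR)
           (\<Pi>\<^sub>M i\<in>int_interval L R. marginal wmin wmax f (\<theta> i))"
proof -
  interpret blocking_system L R wmin wmax P Q PL QL PR QR p q f s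
    by (rule assms(1))
  interpret blocking_measure L R wmin wmax P Q PL QL PR QR p q f s c \<theta>
    using assms(4-7) by unfold_locales
  show ?thesis
    unfolding \<pi>_eq using concentrated reversible_stationary by blast
qed

end
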